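(* Let $\mathbf{k}$ be a field, let $A$ be a finitely generated $\mathbf{k}$-algebra which is a domain of Krull dimension $d$, let $\mathcal{B}=\{b_1,\dots,b_n\}$ be a set of $\mathbf{k}$-algebra generators of $A$, and let $I\subset \mathbf{k}[x_1,\dots,x_n]$ be the kernel of the surjection $\pi:\mathbf{k}[x_1,\dots,x_n]\to A$, $x_i\mapsto b_i$. For each prime cone $C$ in the tropical variety $\mathcal{T}(I)$ there is a discrete valuation $\mathfrak{v}=\mathfrak{v}_C: A\setminus\{0\}\to\mathbb{Q}^d$ (for some group ordering on $\mathbb{Q}^d$) such that: (1) $\mathcal{B}$ is a finite Khovanskii basis for $(A,\mathfrak{v})$; (2) the rank of $\mathfrak{v}$ is at least $\dim(C)$; (3) the associated graded algebra $\mathrm{gr}_{\mathfrak{v}}(A)$ is isomorphic to $\mathbf{k}[x_1,\dots,x_n]/\mathrm{in}_C(I)$.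
   Context: Valuations: let $\mathbb{Q}^r$ be equipped with a total ordering $\succ$ compatible with addition (a group ordering). A valuation over $\mathbf{k}$ is a map $\mathfrak{v}:A\setminus\{0\}\to\mathbb{Q}^r$ with $\mathfrak{v}(f+g)\succeq\min\{\mathfrak{v}(f),\mathfrak{v}(g)\}$ (if $f+g\ne0$), $\mathfrak{v}(fg)=\mathfrak{v}(f)+\mathfrak{v}(g)$, and $\mathfrak{v}(cf)=\mathfrak{v}(f)$ for $0\neq c\in\mathbf{k}$. It is discrete if its image is a discrete subset of $\mathbb{Q}^r$. Its value semigroup is $S(A,\mathfrak{v})=\{\mathfrak{v}(f)\mid 0\ne f\in A\}$, and its rank is the rank of the group generated by $S(A,\mathfrak{v})$. Put $F_{\mathfrak{v}\succeq a}=\{f\ne 0\mid\mathfrak{v}(f)\succeq a\}\cup\{0\}$, similarly $F_{\mathfrak{v}\succ a}$, and $\mathrm{gr}_{\mathfrak{v}}(A)=\bigoplus_a F_{\mathfrak{v}\succeq a}/F_{\mathfrak{v}\succ a}$. For $0\neq f\in A$ with $\mathfrak{v}(f)=a$, the image $\bar f\in\mathrm{gr}_{\mathfrak{v}}(A)$ is the class of $f$ in $F_{\mathfrak{v}\succeq a}/F_{\mathfrak{v}\succ a}$. A set $\mathcal{B}\subset A$ is a Khovanskii basis for $(A,\mathfrak{v})$ if the images of its elements generate $\mathrm{gr}_{\mathfrak{v}}(A)$ as a $\mathbf{k}$-algebra. Tropical variety (min convention): for $u\in\mathbb{Q}^n$ and $p=\sum c_\alpha x^\alpha$, $\mathrm{in}_u(p)$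 is the sum of the terms $c_\alpha x^\alpha$ ($c_\alpha\neq 0$) for which $u\cdot\alpha$ is minimal; $\mathrm{in}_u(I)$ is the ideal generated by all $\mathrm{in}_u(p)$, $p\in I$. $\mathcal{T}(I)$ is the set of $u\in\mathbb{Q}^n$ such that $\mathrm{in}_u(I)$ contains no monomial. An open cone $C\subset\mathcal{T}(I)$ is a polyhedral cone equal to its relative interior, contained in $\mathcal{T}(I)$, such that $\mathrm{in}_u(I)$ is the same ideal, denoted $\mathrm{in}_C(I)$, for all $u\in C$ (e.g. an open cone of the fan structure on $\mathcal{T}(I)$ coming from the Gröbner fan of the homogenization of $I$). $C$ is a prime cone if $\mathrm{in}_C(I)$ is a prime ideal. *)

theory Defs
  imports
    "HOL-Algebra.QuotRing"
    "HOL-Algebra.Generated_Rings"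
    "HOL-Algebra.Product_Groups"
    "HOL-Algebra.Algebraic_Closure_Type"
    "HOL-Library.Poly_Mapping"
    "HOL-Library.Extended_Nat"
    "HOL-Analysis.Function_Topology"
    "HOL-Analysis.Isolated"
begin

section \<open>Rational vectors\<close>

text \<open>Vectors over the rationals are finitely supported functions on the naturals, and
  \<open>rat_space n\<close> is the n-dimensional space spanned by the first n coordinates. This
  allows the dimension to be an arbitrary natural number, including 0.\<close>

type_synonym ratvec = "nat \<Rightarrow>\<^sub>0 rat"

definition rat_space :: "nat \<Rightarrow> ratvec set" where
  "rat_space n = {x. Poly_Mapping.keys x \<subseteq> {..<n}}"

definition scaleQ :: "rat \<Rightarrow> ratvec \<Rightarrow> ratvec" where
  "scaleQ q x = Poly_Mapping.map (\<lambda>t. q * t) x"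

definition scaleZ :: "int \<Rightarrow> ratvec \<Rightarrow> ratvec" where
  "scaleZ k x = scaleQ (of_int k) x"

definition dot :: "ratvec \<Rightarrow> ratvec \<Rightarrow> rat" where
  "dot w u = (\<Sum>i\<in>Poly_Mapping.keys w. Poly_Mapping.lookup w i * Poly_Mapping.lookup u i)"

lemma lookup_scaleQ: "Poly_Mapping.lookup (scaleQ q x) i = q * Poly_Mapping.lookup x i"
  unfolding scaleQ_def by transfer (simp add: when_def)

global_interpretation ratvec: vector_space scaleQ
  by unfold_locales (auto intro!: poly_mapping_eqI simp: lookup_scaleQ lookup_add algebra_simps)

global_interpretation intmod: Modules.module scaleZ
  by unfold_locales (simp_all add: scaleZ_def ratvec.scale_right_distrib ratvec.scale_left_distrib)

text \<open>Relative interior. A vector y lies in the affine hull of S, for x in S, iff y - x is in the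
  linear span of the differences z - x with z in S.\<close>

definition rel_int :: "ratvec set \<Rightarrow> ratvec set" where
  "rel_int S = {x \<in> S. \<exists>e>0. \<forall>y. y - x \<in> ratvec.span ((\<lambda>z. z - x) ` S) \<and>
     (\<forall>i. \<bar>Poly_Mapping.lookup y i - Poly_Mapping.lookup x i\<bar> < e) \<longrightarrow> y \<in> S}"

text \<open>Both weak and strict inequalities are allowed, so that a polyhedral cone need not be closed.\<close>

definition polyhedral_cone :: "nat \<Rightarrow> ratvec set \<Rightarrow> bool" where
  "polyhedral_cone n C \<longleftrightarrow> (\<exists>W S. finite W \<and> finite S \<and> W \<subseteq> rat_space n \<and> S \<subseteq> rat_space n \<and>
     C = {u \<in> rat_space n. (\<forall>w\<in>W. dot w u \<ge> 0) \<and> (\<forall>w\<in>S. dot w u > 0)} \<and> C \<noteq> {})"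

text \<open>The affine hull of a nonempty cone is its linear span.\<close>

definition cone_dim :: "ratvec set \<Rightarrow> nat" where
  "cone_dim C = ratvec.dim (ratvec.span C)"


section \<open>Polynomials, initial ideals and tropical varieties\<close>

type_synonym 'k mpoly = "(nat \<Rightarrow>\<^sub>0 nat) \<Rightarrow>\<^sub>0 'k"

text \<open>The polynomial ring in the variables with index below n.\<close>

definition mpoly_ring :: "nat \<Rightarrow> 'k::field mpoly ring" where
  "mpoly_ring n = (ring_of_type_algebra :: 'k mpoly ring)
     \<lparr>carrier := {p. \<forall>\<alpha>\<in>Poly_Mapping.keys p. Poly_Mapping.keys \<alpha> \<subseteq> {..<n}}\<rparr>"

definition mpoly_const :: "'k::field \<Rightarrow> 'k mpoly" where
  "mpoly_const c = Poly_Mapping.single 0 c"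

text \<open>\<open>\<phi>\<close> is the structure map of the algebra; the i-th variable is sent to \<open>b i\<close>.\<close>

definition mpoly_eval :: "('k::field \<Rightarrow> 'a::idom) \<Rightarrow> (nat \<Rightarrow> 'a) \<Rightarrow> 'k mpoly \<Rightarrow> 'a" where
  "mpoly_eval \<phi> b p = (\<Sum>\<alpha>\<in>Poly_Mapping.keys p. \<phi> (Poly_Mapping.lookup p \<alpha>) *
     (\<Prod>i\<in>Poly_Mapping.keys \<alpha>. b i ^ Poly_Mapping.lookup \<alpha> i))"

definition relation_ideal ::
    "nat \<Rightarrow> ('k::field \<Rightarrow> 'a::idom) \<Rightarrow> (nat \<Rightarrow> 'a) \<Rightarrow> 'k mpoly set" where
  "relation_ideal n \<phi> b =
     a_kernel (mpoly_ring n) (ring_of_type_algebra :: 'a ring) (mpoly_eval \<phi> b)"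

definition weight :: "ratvec \<Rightarrow> (nat \<Rightarrow>\<^sub>0 nat) \<Rightarrow> rat" where
  "weight u \<alpha> = (\<Sum>i\<in>Poly_Mapping.keys \<alpha>. Poly_Mapping.lookup u i * of_nat (Poly_Mapping.lookup \<alpha> i))"

definition init_form :: "ratvec \<Rightarrow> 'k::field mpoly \<Rightarrow> 'k mpoly" where
  "init_form u p =
     (\<Sum>\<alpha> | \<alpha> \<in> Poly_Mapping.keys p \<and> (\<forall>\<beta>\<in>Poly_Mapping.keys p. weight u \<alpha> \<le> weight u \<beta>).
        Poly_Mapping.single \<alpha> (Poly_Mapping.lookup p \<alpha>))"

definition init_ideal :: "nat \<Rightarrow> ratvec \<Rightarrow> 'k::field mpoly set \<Rightarrow> 'k mpoly set" where
  "init_ideal n u I = genideal (mpoly_ring n) (init_form u ` I)"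

text \<open>Over a field an ideal contains a monomial with nonzero coefficient iff it contains the
  corresponding monomial with coefficient 1.\<close>

definition tropical_variety :: "nat \<Rightarrow> 'k::field mpoly set \<Rightarrow> ratvec set" where
  "tropical_variety n I = {u \<in> rat_space n. \<forall>\<alpha>. Poly_Mapping.keys \<alpha> \<subseteq> {..<n} \<longrightarrow>
     Poly_Mapping.single \<alpha> 1 \<notin> init_ideal n u I}"

definition open_cone :: "nat \<Rightarrow> 'k::field mpoly set \<Rightarrow> ratvec set \<Rightarrow> bool" where
  "open_cone n I C \<longleftrightarrow> polyhedral_cone n C \<and> rel_int C = C \<and> C \<subseteq> tropical_variety n I \<and>
     (\<forall>u\<in>C. \<forall>u'\<in>C. init_ideal n u I = init_ideal n u' I)"

definition init_ideal_cone :: "nat \<Rightarrow> ratvec set \<Rightarrow> 'k::field mpoly set \<Rightarrow> 'k mpoly set" where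
  "init_ideal_cone n C I = (THE J. \<forall>u\<in>C. init_ideal n u I = J)"

definition prime_cone :: "nat \<Rightarrow> 'k::field mpoly set \<Rightarrow> ratvec set \<Rightarrow> bool" where
  "prime_cone n I C \<longleftrightarrow> open_cone n I C \<and> primeideal (init_ideal_cone n C I) (mpoly_ring n)"


section \<open>Krull dimension and algebra generators\<close>

definition krull_dim :: "('r, 'm) ring_scheme \<Rightarrow> enat" where
  "krull_dim R = Sup {enat l | l. \<exists>P :: nat \<Rightarrow> 'r set.
     (\<forall>i\<le>l. primeideal (P i) R) \<and> (\<forall>i<l. P i \<subset> P (Suc i))}"

text \<open>An algebra over a field is given by a ring together with its structure map \<open>\<kappa>\<close>.\<close>

definition alg_generates :: "('r, 'm) ring_scheme \<Rightarrow> ('k \<Rightarrow> 'r) \<Rightarrow> 'r set \<Rightarrow> bool" where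
  "alg_generates R \<kappa> S \<longleftrightarrow> generate_ring R (range \<kappa> \<union> S) = carrier R"

definition alg_isomorphic ::
    "('r, 'm) ring_scheme \<Rightarrow> ('k \<Rightarrow> 'r) \<Rightarrow> ('s, 'l) ring_scheme \<Rightarrow> ('k \<Rightarrow> 's) \<Rightarrow> bool" where
  "alg_isomorphic R \<kappa> S \<mu> \<longleftrightarrow> (\<exists>h \<in> ring_iso R S. \<forall>c. h (\<kappa> c) = \<mu> c)"


section \<open>Valuations\<close>

text \<open>A pair \<open>(x, y) \<in> r\<close> means that x is below or equal to y.\<close>

definition group_ordering :: "nat \<Rightarrow> ratvec rel \<Rightarrow> bool" where
  "group_ordering d r \<longleftrightarrow> linear_order_on (rat_space d) r \<and>
     (\<forall>x y z. (x, y) \<in> r \<longrightarrow> z \<in> rat_space d \<longrightarrow> (x + z, y + z) \<in> r)"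

definition min_wrt :: "'v rel \<Rightarrow> 'v \<Rightarrow> 'v \<Rightarrow> 'v" where
  "min_wrt r x y = (if (x, y) \<in> r then x else y)"

text \<open>The value of v at 0 is irrelevant here and below.\<close>

definition valuation ::
    "('k::field \<Rightarrow> 'a::idom) \<Rightarrow> nat \<Rightarrow> ratvec rel \<Rightarrow> ('a \<Rightarrow> ratvec) \<Rightarrow> bool" where
  "valuation \<phi> d r v \<longleftrightarrow>
     (\<forall>f. f \<noteq> 0 \<longrightarrow> v f \<in> rat_space d) \<and>
     (\<forall>f g. f \<noteq> 0 \<longrightarrow> g \<noteq> 0 \<longrightarrow> f + g \<noteq> 0 \<longrightarrow> (min_wrt r (v f) (v g), v (f + g)) \<in> r) \<and>
     (\<forall>f g. f \<noteq> 0 \<longrightarrow> g \<noteq> 0 \<longrightarrow> v (f * g) = v f + v g) \<and>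
     (\<forall>c f. c \<noteq> 0 \<longrightarrow> f \<noteq> 0 \<longrightarrow> v (\<phi> c * f) = v f)"

definition value_semigroup :: "('a::idom \<Rightarrow> ratvec) \<Rightarrow> ratvec set" where
  "value_semigroup v = v ` (UNIV - {0})"

text \<open>The topology on rational vectors is the one induced from real vectors.\<close>

definition discrete_valuation :: "('a::idom \<Rightarrow> ratvec) \<Rightarrow> bool" where
  "discrete_valuation v \<longleftrightarrow>
     discrete ((\<lambda>x i. real_of_rat (Poly_Mapping.lookup x i)) ` value_semigroup v)"

text \<open>The rank of an abelian group is the maximal number of elements that are linearly independent
  over the integers; the integer span is the subgroup generated by the value semigroup.\<close>

definition valuation_rank :: "('a::idom \<Rightarrow> ratvec) \<Rightarrow> enat" where
  "valuation_rank v = Sup {enat (card E) | E.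
     E \<subseteq> intmod.span (value_semigroup v) \<and> finite E \<and> intmod.independent E}"


section \<open>The associated graded algebra\<close>

definition filt_ge :: "ratvec rel \<Rightarrow> ('a::idom \<Rightarrow> ratvec) \<Rightarrow> ratvec \<Rightarrow> 'a set" where
  "filt_ge r v a = {f. f \<noteq> 0 \<and> (a, v f) \<in> r} \<union> {0}"

definition filt_gt :: "ratvec rel \<Rightarrow> ('a::idom \<Rightarrow> ratvec) \<Rightarrow> ratvec \<Rightarrow> 'a set" where
  "filt_gt r v a = {f. f \<noteq> 0 \<and> (a, v f) \<in> r \<and> v f \<noteq> a} \<union> {0}"

definition gr_piece :: "ratvec rel \<Rightarrow> ('a::idom \<Rightarrow> ratvec) \<Rightarrow> ratvec \<Rightarrow> 'a set monoid" where
  "gr_piece r v a =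
     add_monoid ((ring_of_type_algebra :: 'a ring)\<lparr>carrier := filt_ge r v a\<rparr>) Mod filt_gt r v a"

definition gr_class :: "ratvec rel \<Rightarrow> ('a::idom \<Rightarrow> ratvec) \<Rightarrow> ratvec \<Rightarrow> 'a \<Rightarrow> 'a set" where
  "gr_class r v a f = filt_gt r v a +>\<^bsub>ring_of_type_algebra :: 'a ring\<^esub> f"

text \<open>Product of a class S of degree a and a class T of degree b. All products of
  representatives have the same class in degree a + b, so the union below is that class.\<close>

definition gr_class_mult ::
    "ratvec rel \<Rightarrow> ('a::idom \<Rightarrow> ratvec) \<Rightarrow> ratvec \<Rightarrow> ratvec \<Rightarrow> 'a set \<Rightarrow> 'a set \<Rightarrow> 'a set" where
  "gr_class_mult r v a b S T = (\<Union>x\<in>S. \<Union>y\<in>T. gr_class r v (a + b) (x * y))"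

text \<open>The element of the direct sum with the class of f in degree a and zero in all other degrees.\<close>

definition gr_homogeneous ::
    "nat \<Rightarrow> ratvec rel \<Rightarrow> ('a::idom \<Rightarrow> ratvec) \<Rightarrow> ratvec \<Rightarrow> 'a \<Rightarrow> ratvec \<Rightarrow> 'a set" where
  "gr_homogeneous d r v a f =
     (\<lambda>c\<in>rat_space d. if c = a then gr_class r v a f else \<one>\<^bsub>gr_piece r v c\<^esub>)"

text \<open>The pieces and their direct sum are written as multiplicative groups, so their group operation
  and unit are the addition and zero of the associated graded algebra, and \<open>finprod\<close> is a finite
  sum in one of the pieces.\<close>

definition gr_alg :: "nat \<Rightarrow> ratvec rel \<Rightarrow> ('a::idom \<Rightarrow> ratvec) \<Rightarrow> (ratvec \<Rightarrow> 'a set) ring" where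
  "gr_alg d r v = (let G = sum_group (rat_space d) (gr_piece r v) in
     \<lparr>carrier = carrier G,
      monoid.mult = (\<lambda>g h. \<lambda>c\<in>rat_space d.
        finprod (gr_piece r v c) (\<lambda>a. gr_class_mult r v a (c - a) (g a) (h (c - a)))
          {a \<in> rat_space d. g a \<noteq> \<one>\<^bsub>gr_piece r v a\<^esub>}),
      one = gr_homogeneous d r v 0 1,
      zero = \<one>\<^bsub>G\<^esub>,
      add = monoid.mult G\<rparr>)"

definition gr_const ::
    "('k::field \<Rightarrow> 'a::idom) \<Rightarrow> nat \<Rightarrow> ratvec rel \<Rightarrow> ('a \<Rightarrow> ratvec) \<Rightarrow> 'k \<Rightarrow> ratvec \<Rightarrow> 'a set" where
  "gr_const \<phi> d r v c = gr_homogeneous d r v 0 (\<phi> c)"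

definition gr_image ::
    "nat \<Rightarrow> ratvec rel \<Rightarrow> ('a::idom \<Rightarrow> ratvec) \<Rightarrow> 'a \<Rightarrow> ratvec \<Rightarrow> 'a set" where
  "gr_image d r v f = gr_homogeneous d r v (v f) f"

text \<open>Only nonzero elements have an image in the associated graded algebra.\<close>

definition khovanskii_basis ::
    "('k::field \<Rightarrow> 'a::idom) \<Rightarrow> nat \<Rightarrow> ratvec rel \<Rightarrow> ('a \<Rightarrow> ratvec) \<Rightarrow> 'a set \<Rightarrow> bool" where
  "khovanskii_basis \<phi> d r v B \<longleftrightarrow>
     alg_generates (gr_alg d r v) (gr_const \<phi> d r v) (gr_image d r v ` (B - {0}))"

end

theory Submission
  imports Defs
begin

text \<open>
  Choose a basis \<open>u\<^sub>1, \<dots>, u\<^sub>r\<close> of the span of \<open>C\<close> inside \<open>C\<close>. All the initial ideals of \<open>I\<close> at the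
  \<open>u\<^sub>j\<close> are the same ideal \<open>J\<close>, which is therefore homogeneous for the vector-valued weight
  \<open>W \<alpha> = (u\<^sub>1 \<bullet> \<alpha>, \<dots>, u\<^sub>r \<bullet> \<alpha>)\<close>. Order the weights lexicographically and let \<open>v f\<close> be the largest
  \<open>W\<close>-order of a polynomial representing \<open>f\<close>. For \<open>f \<noteq> 0\<close> the maximum exists: otherwise a Krull
  intersection argument would give \<open>1 \<in> J\<close>. Taking lowest \<open>W\<close>-forms of representatives identifies
  \<open>k[x]/J\<close> with the associated graded algebra, so \<open>v\<close> is multiplicative because \<open>J\<close> is prime.

  It remains to see that \<open>r \<le> d\<close>. The columns of the matrix with rows \<open>u\<^sub>j\<close> are the values of the
  generators, so some \<open>r\<close> generators have independent values and are algebraically independent.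
  Counting monomials, every Noether normalization of \<open>A\<close> then has at least \<open>r\<close> variables, and
  a polynomial ring over which \<open>A\<close> is finite yields a chain of primes as long as its number of
  variables.
\<close>

section \<open>Multivariate polynomials\<close>

text \<open>The weights in \<open>C\<close> may have entries of either sign and \<open>I\<close>
  need not be homogeneous, so neither a division algorithm nor a degree bound limits how far the
  order of a representative can be raised. Initial ideals are therefore described through lifting of
  homogeneous components (\<open>init_ideal_char\<close>), which works for every weight, and a
  Noetherian argument replaces termination. That argument is needed for one rational weight only.
  The lexicographic order compares the first row first, so a representative that is best for the
  first row already has an initial form outside \<open>J\<close>; the remaining rows merely select
  one of the finitely many \<open>W\<close>-components of that form. Taking the rows inside
  \<open>C\<close>, and not just in its span, gives all of them the same initial ideal. The ideal
  \<open>J\<close> contains no monomial because \<open>C\<close> lies in the tropical variety; this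
  excludes \<open>1 \<in> J\<close>, makes the generators nonzero and yields the algebraic
  independence. The bound of \<open>r\<close> by \<open>d\<close> is what lets the values, a priori
  in \<open>r\<close>-space, be regarded as vectors of \<open>rat_space d\<close>.\<close>

abbreviation coef :: "('i \<Rightarrow>\<^sub>0 'c::zero) \<Rightarrow> 'i \<Rightarrow> 'c" where "coef \<equiv> Poly_Mapping.lookup"
abbreviation supp :: "('i \<Rightarrow>\<^sub>0 'c::zero) \<Rightarrow> 'i set" where "supp \<equiv> Poly_Mapping.keys"
abbreviation sgl :: "'i \<Rightarrow> 'c \<Rightarrow> ('i \<Rightarrow>\<^sub>0 'c::zero)" where "sgl \<equiv> Poly_Mapping.single"

type_synonym expo = "nat \<Rightarrow>\<^sub>0 nat"

definition expos :: "nat \<Rightarrow> expo set" where "expos n = {\<alpha>. supp \<alpha> \<subseteq> {..<n}}"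
definition polys :: "nat \<Rightarrow> 'k::field mpoly set" where "polys n = {p. supp p \<subseteq> expos n}"

definition mon :: "(nat \<Rightarrow> 'a::comm_monoid_mult) \<Rightarrow> expo \<Rightarrow> 'a" where
  "mon b \<alpha> = (\<Prod>i\<in>supp \<alpha>. b i ^ coef \<alpha> i)"

lemma mem_supp: "x \<in> supp p \<longleftrightarrow> coef p x \<noteq> 0"
  by (rule in_keys_iff)

lemma supp_add_nat: "supp (\<alpha> + \<beta> :: 'i \<Rightarrow>\<^sub>0 nat) = supp \<alpha> \<union> supp \<beta>"
  by (auto simp: mem_supp lookup_add)

lemma expos_0 [simp]: "0 \<in> expos n" by (simp add: expos_def)
lemma expos_add: "\<alpha> + \<beta> \<in> expos n \<longleftrightarrow> \<alpha> \<in> expos n \<and> \<beta> \<in> expos n"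
  by (auto simp: expos_def supp_add_nat)
lemma expos_sgl: "i < n \<Longrightarrow> sgl i k \<in> expos n" by (simp add: expos_def)

lemma mon_superset: "finite U \<Longrightarrow> supp \<alpha> \<subseteq> U \<Longrightarrow> mon b \<alpha> = (\<Prod>i\<in>U. b i ^ coef \<alpha> i)"
  unfolding mon_def by (rule prod.mono_neutral_left) (auto simp: mem_supp)

lemma mon_add: "mon b (\<alpha> + \<beta>) = mon b \<alpha> * mon b \<beta>"
proof -
  have "mon b (\<alpha> + \<beta>) = (\<Prod>i\<in>supp \<alpha> \<union> supp \<beta>. b i ^ coef (\<alpha> + \<beta>) i)"
    by (rule mon_superset) (auto simp: supp_add_nat)
  also have "\<dots> = (\<Prod>i\<in>supp \<alpha> \<union> supp \<beta>. b i ^ coef \<alpha> i) * (\<Prod>i\<in>supp \<alpha> \<union> supp \<beta>. b i ^ coef \<beta> i)"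
    by (simp add: lookup_add power_add prod.distrib)
  also have "\<dots> = mon b \<alpha> * mon b \<beta>"
    by (simp add: mon_superset[symmetric])
  finally show ?thesis .
qed

lemma mon_0 [simp]: "mon b 0 = 1" by (simp add: mon_def)
lemma mon_sgl [simp]: "mon b (sgl i k) = b i ^ k" by (cases "k = 0") (simp_all add: mon_def)

lemma expo_induct [consumes 1, case_names zero step]:
  assumes "supp \<alpha> \<subseteq> U" and "P 0" and "\<And>\<alpha> i. P \<alpha> \<Longrightarrow> i \<in> U \<Longrightarrow> P (\<alpha> + sgl i 1)"
  shows "P (\<alpha> :: expo)"
  using assms(1)
proof (induction "\<Sum>i\<in>supp \<alpha>. coef \<alpha> i" arbitrary: \<alpha> rule: less_induct)
  case less
  show ?case
  proof (cases "\<alpha> = 0")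
    case True then show ?thesis using assms(2) by simp
  next
    case False
    then obtain i where i: "i \<in> supp \<alpha>" using keys_eq_empty[of "\<alpha>"] by fastforce
    define \<beta> where "\<beta> = \<alpha> - sgl i 1"
    have ab: "\<alpha> = \<beta> + sgl i 1"
      using i unfolding \<beta>_def
      by (intro poly_mapping_eqI) (auto simp: lookup_add lookup_minus lookup_single mem_supp when_def)
    have s: "supp \<beta> \<subseteq> supp \<alpha>" unfolding ab by (auto simp: supp_add_nat)
    have "(\<Sum>i\<in>supp \<beta>. coef \<beta> i) = (\<Sum>i\<in>supp \<alpha>. coef \<beta> i)"
      by (rule sum.mono_neutral_left) (use s in \<open>auto simp: mem_supp\<close>)
    also have "\<dots> < (\<Sum>i\<in>supp \<alpha>. coef \<alpha> i)"
    proof (rule sum_strict_mono_ex1)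
      show "\<exists>j\<in>supp \<alpha>. coef \<beta> j < coef \<alpha> j"
        using i by (intro bexI[of _ i]) (simp_all add: ab lookup_add)
    qed (simp_all add: ab lookup_add)
    finally have "P \<beta>" using less s by (meson order_trans)
    with i less.prems assms(3) ab show ?thesis by auto
  qed
qed

lemma poly_expand: "p = (\<Sum>\<alpha>\<in>supp p. sgl \<alpha> (coef p \<alpha>))"
  by (rule poly_mapping_eqI) (simp add: lookup_sum lookup_single when_def mem_supp)

lemma polysD: "p \<in> polys n \<Longrightarrow> \<alpha> \<in> supp p \<Longrightarrow> \<alpha> \<in> expos n" by (auto simp: polys_def)
lemma polys_0 [simp]: "0 \<in> polys n" by (simp add: polys_def)
lemma polys_sgl: "\<alpha> \<in> expos n \<Longrightarrow> sgl \<alpha> c \<in> polys n" by (simp add: polys_def)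
lemma polys_1 [simp]: "1 \<in> polys n" by (simp add: polys_def)
lemma polys_add: "p \<in> polys n \<Longrightarrow> q \<in> polys n \<Longrightarrow> p + q \<in> polys n"
  using keys_add[of p q] by (auto simp: polys_def)
lemma supp_uminus [simp]: "supp (- p :: 'i \<Rightarrow>\<^sub>0 'c::ab_group_add) = supp p"
  by (auto simp: mem_supp)
lemma supp_diff: "supp (p - q :: 'i \<Rightarrow>\<^sub>0 'c::ab_group_add) \<subseteq> supp p \<union> supp q"
  by (auto simp: mem_supp lookup_minus)
lemma polys_uminus: "p \<in> polys n \<Longrightarrow> - p \<in> polys n"
  by (simp add: polys_def)
lemma polys_diff: "p \<in> polys n \<Longrightarrow> q \<in> polys n \<Longrightarrow> p - q \<in> polys n"
  using supp_diff[of p q] by (auto simp: polys_def)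
lemma polys_mult: "p \<in> polys n \<Longrightarrow> q \<in> polys n \<Longrightarrow> p * q \<in> polys n"
  using keys_mult[of p q] by (fastforce simp: polys_def expos_add)
lemma polys_sum: "(\<And>x. x \<in> U \<Longrightarrow> f x \<in> polys n) \<Longrightarrow> sum f U \<in> polys n"
  by (induction U rule: infinite_finite_induct) (auto intro: polys_add)

lemma poly_induct [consumes 1, case_names add sgl]:
  assumes "supp p \<subseteq> U"
    and add: "\<And>p q. Q p \<Longrightarrow> Q q \<Longrightarrow> Q (p + q)"
    and sgl: "\<And>\<alpha> c. \<alpha> \<in> U \<Longrightarrow> Q (sgl \<alpha> c)" and "U \<noteq> {}"
  shows "Q (p :: 'k::comm_ring_1 mpoly)"
proof -
  \<comment> \<open>The zero polynomial is reached as a single term with coefficient 0; this is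
    where \<open>U\<close> being nonempty enters.\<close>
  have Q0: "Q 0" using assms(4) sgl[of _ 0] by auto
  have "Q (\<Sum>\<alpha>\<in>Y. sgl \<alpha> (coef p \<alpha>))" if "finite Y" "Y \<subseteq> U" for Y
    using that by (induction Y rule: finite_induct) (auto intro: Q0 add sgl)
  from this[of "supp p"] assms(1) show ?thesis by (subst poly_expand) simp
qed

lemma coef_mult_sgl: "coef (sgl \<beta> c * p) (\<beta> + \<alpha>) = c * coef (p :: 'k::field mpoly) \<alpha>"
proof -
  have "sgl \<beta> c * p = (\<Sum>\<gamma>\<in>supp p. sgl (\<beta> + \<gamma>) (c * coef p \<gamma>))"
    by (subst (1) poly_expand[of p]) (simp add: sum_distrib_left mult_single)
  then show ?thesis
    by (simp add: lookup_sum lookup_single when_def mem_supp)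
qed

lemma supp_mult_sgl: "supp (sgl \<beta> c * p) \<subseteq> (\<lambda>\<alpha>. \<beta> + \<alpha>) ` supp (p :: 'k::field mpoly)"
  using keys_mult[of "sgl \<beta> c" p] by (auto split: if_splits)

text \<open>One restriction operator serves for initial forms, for components of a scalar weight and
  for components of the vector weight; iterated restrictions merge by
  \<open>res_res\<close>.\<close>

definition res :: "('i \<Rightarrow> bool) \<Rightarrow> ('i \<Rightarrow>\<^sub>0 'c::zero) \<Rightarrow> ('i \<Rightarrow>\<^sub>0 'c)" where
  "res P p = Poly_Mapping.mapp (\<lambda>\<alpha> c. c when P \<alpha>) p"

lemma coef_res: "coef (res P p) \<alpha> = (coef p \<alpha> when P \<alpha>)"
  by (auto simp: res_def lookup_mapp when_def mem_supp)
lemma supp_res: "supp (res P p) = {\<alpha> \<in> supp p. P \<alpha>}"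
  by (auto simp: mem_supp coef_res)
lemma res_add: "res P (p + q :: 'i \<Rightarrow>\<^sub>0 'c::monoid_add) = res P p + res P q"
  by (rule poly_mapping_eqI) (simp add: coef_res lookup_add when_def)
lemma res_diff: "res P (p - q :: 'i \<Rightarrow>\<^sub>0 'c::ab_group_add) = res P p - res P q"
  by (rule poly_mapping_eqI) (simp add: coef_res lookup_minus when_def)
lemma res_0 [simp]: "res P 0 = 0" by (rule poly_mapping_eqI) (simp add: coef_res)
lemma res_sum: "res P (sum f U :: 'i \<Rightarrow>\<^sub>0 'c::comm_monoid_add) = (\<Sum>x\<in>U. res P (f x))"
  by (induction U rule: infinite_finite_induct) (auto simp: res_add)
lemma res_res: "res P (res Q p) = res (\<lambda>\<alpha>. P \<alpha> \<and> Q \<alpha>) p"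
  by (rule poly_mapping_eqI) (simp add: coef_res when_def)
lemma res_True: "(\<And>\<alpha>. \<alpha> \<in> supp p \<Longrightarrow> P \<alpha>) \<Longrightarrow> res P p = p"
  by (rule poly_mapping_eqI) (auto simp: coef_res when_def mem_supp)
lemma res_False: "(\<And>\<alpha>. \<alpha> \<in> supp p \<Longrightarrow> \<not> P \<alpha>) \<Longrightarrow> res P p = 0"
  by (rule poly_mapping_eqI) (auto simp: coef_res when_def mem_supp)
lemma polys_res: "p \<in> polys n \<Longrightarrow> res P p \<in> polys n"
  by (auto simp: polys_def supp_res)

lemma supp_minus_res: "supp (p - res P p :: 'i \<Rightarrow>\<^sub>0 'c::ab_group_add) = {\<alpha> \<in> supp p. \<not> P \<alpha>}"
  by (auto simp: mem_supp lookup_minus coef_res when_def split: if_splits)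

lemma sum_res_levels:
  assumes "finite L" "f ` supp p \<subseteq> L"
  shows "(\<Sum>l\<in>L. res (\<lambda>\<alpha>. f \<alpha> = l) p) = (p :: 'i \<Rightarrow>\<^sub>0 'c::comm_monoid_add)"
proof (rule poly_mapping_eqI)
  fix \<alpha>
  have "coef (\<Sum>l\<in>L. res (\<lambda>\<alpha>. f \<alpha> = l) p) \<alpha> = (\<Sum>l\<in>L. coef p \<alpha> when f \<alpha> = l)"
    by (simp add: lookup_sum coef_res)
  also have "\<dots> = coef p \<alpha>"
    using assms by (cases "\<alpha> \<in> supp p") (auto simp: when_def mem_supp)
  finally show "coef (\<Sum>l\<in>L. res (\<lambda>\<alpha>. f \<alpha> = l) p) \<alpha> = coef p \<alpha>" .
qed

section \<open>Evaluation\<close>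

lemma type_algebra_uminus: "\<ominus>\<^bsub>ring_of_type_algebra\<^esub> x = - (x :: 'a::comm_ring_1)"
proof -
  interpret cring "ring_of_type_algebra :: 'a ring" by (rule cring_from_type_algebra)
  show ?thesis by (rule minus_equality) (auto simp: ring_of_type_algebra_def)
qed

locale scalar_hom =
  fixes \<phi> :: "'k::field \<Rightarrow> 'a::idom"
  assumes hom: "\<phi> \<in> ring_hom (ring_of_type_algebra :: 'k ring) (ring_of_type_algebra :: 'a ring)"
begin

lemma phi_add: "\<phi> (x + y) = \<phi> x + \<phi> y"
  using ring_hom_add[OF hom] by (simp add: ring_of_type_algebra_def)
lemma phi_mult: "\<phi> (x * y) = \<phi> x * \<phi> y"
  using ring_hom_mult[OF hom] by (simp add: ring_of_type_algebra_def)
lemma phi_1 [simp]: "\<phi> 1 = 1"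
  using ring_hom_one[OF hom] by (simp add: ring_of_type_algebra_def)
lemma phi_0 [simp]: "\<phi> 0 = 0"
  using phi_add[of 0 0] by (metis add_0 add_cancel_right_right)
lemma phi_eq_0 [simp]: "\<phi> x = 0 \<longleftrightarrow> x = 0"
  using phi_mult[of x "inverse x"] by (cases "x = 0") auto
lemma phi_uminus: "\<phi> (- x) = - \<phi> x"
  using phi_add[of x "- x"] by (simp add: add_eq_0_iff)

definition ev :: "(nat \<Rightarrow> 'a) \<Rightarrow> 'k mpoly \<Rightarrow> 'a" where
  "ev b p = (\<Sum>\<alpha>\<in>supp p. \<phi> (coef p \<alpha>) * mon b \<alpha>)"

lemma mpoly_eval_ev: "mpoly_eval \<phi> b p = ev b p"
  by (simp add: ev_def mpoly_eval_def mon_def)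

lemma ev_superset: "finite U \<Longrightarrow> supp p \<subseteq> U \<Longrightarrow> ev b p = (\<Sum>\<alpha>\<in>U. \<phi> (coef p \<alpha>) * mon b \<alpha>)"
  unfolding ev_def by (rule sum.mono_neutral_left) (auto simp: mem_supp)

lemma ev_0 [simp]: "ev b 0 = 0" by (simp add: ev_def)

lemma ev_add: "ev b (p + q) = ev b p + ev b q"
proof -
  have "ev b (p + q) = (\<Sum>\<alpha>\<in>supp p \<union> supp q. \<phi> (coef (p + q) \<alpha>) * mon b \<alpha>)"
    by (rule ev_superset) (use keys_add[of p q] in auto)
  also have "\<dots> = ev b p + ev b q"
    by (simp add: lookup_add phi_add algebra_simps sum.distrib ev_superset[of "supp p \<union> supp q"])
  finally show ?thesis .
qed

lemma ev_uminus: "ev b (- p) = - ev b p"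
  using ev_add[of b p "- p"] by (simp add: add_eq_0_iff)
lemma ev_diff: "ev b (p - q) = ev b p - ev b q"
  using ev_add[of b p "- q"] by (simp add: ev_uminus)
lemma ev_sum: "ev b (sum f U) = (\<Sum>x\<in>U. ev b (f x))"
  by (induction U rule: infinite_finite_induct) (auto simp: ev_add)
lemma ev_sgl [simp]: "ev b (sgl \<alpha> c) = \<phi> c * mon b \<alpha>"
  by (cases "c = 0") (auto simp: ev_def)
lemma ev_1 [simp]: "ev b 1 = 1"
  using ev_sgl[of b 0 1] by (simp del: ev_sgl)

lemma ev_mult: "ev b (p * q) = ev b p * ev b q"
proof -
  have "ev b (p * q) = ev b ((\<Sum>\<alpha>\<in>supp p. sgl \<alpha> (coef p \<alpha>)) * (\<Sum>\<alpha>\<in>supp q. sgl \<alpha> (coef q \<alpha>)))"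
    using poly_expand[of p] poly_expand[of q] by simp
  also have "\<dots> = ev b p * ev b q"
    unfolding sum_product ev_sum mult_single
    by (simp add: mon_add phi_mult ev_def[of b p] ev_def[of b q] sum_product mult_ac)
  finally show ?thesis .
qed

end

section \<open>Dickson's lemma\<close>

lemma nat_mono_subseq:
  fixes s :: "nat \<Rightarrow> nat"
  shows "\<exists>f::nat \<Rightarrow> nat. strict_mono f \<and> mono (\<lambda>j. s (f j))"
proof -
  obtain f where f: "strict_mono f" "monoseq (\<lambda>n. s (f n))"
    using seq_monosub[of s] by blast
  show ?thesis
  proof (cases "\<forall>m. \<forall>n\<ge>m. s (f m) \<le> s (f n)")
    case True then have "mono (\<lambda>j. s (f j))" by (simp add: mono_def)
    with f(1) show ?thesis by blast
  next
    case False
    then have dec: "\<And>m n. m \<le> n \<Longrightarrow> s (f n) \<le> s (f m)" using f(2) by (auto simp: monoseq_def)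
    \<comment> \<open>A nonincreasing sequence of naturals attains its minimum at \<open>N\<close>
      and is constant from there on, so its tail is monotone.\<close>
    obtain N where N: "\<And>n. s (f N) \<le> s (f n)"
      using ex_has_least_nat[of "\<lambda>_. True" 0 "\<lambda>n. s (f n)"] by auto
    have "strict_mono (\<lambda>j. f (N + j))" using f(1) by (simp add: strict_mono_def)
    moreover have "mono (\<lambda>j. s (f (N + j)))"
      unfolding mono_def using dec[of N] N by (meson le_add1 order_trans)
    ultimately show ?thesis by blast
  qed
qed

lemma dickson_subseq:
  fixes s :: "nat \<Rightarrow> nat \<Rightarrow> nat"
  shows "\<exists>f::nat \<Rightarrow> nat. strict_mono f \<and> (\<forall>i<m. mono (\<lambda>j. s (f j) i))"
proof (induction m)
  case 0 have "strict_mono (id :: nat \<Rightarrow> nat)" by (simp add: strict_mono_def)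
  then show ?case by auto
next
  case (Suc m)
  then obtain f :: "nat \<Rightarrow> nat" where f: "strict_mono f" "\<forall>i<m. mono (\<lambda>j. s (f j) i)" by blast
  obtain g :: "nat \<Rightarrow> nat" where g: "strict_mono g" "mono (\<lambda>j. s (f (g j)) m)"
    using nat_mono_subseq[of "\<lambda>j. s (f j) m"] by blast
  have "strict_mono (\<lambda>j. f (g j))" using f g by (simp add: strict_mono_def)
  moreover have "mono (\<lambda>j. s (f (g j)) i)" if "i < Suc m" for i
    using that f(2) g by (cases "i = m") (auto simp: mono_def strict_mono_less_eq)
  ultimately show ?case by blast
qed

text \<open>Dickson's lemma in \<open>n + 1\<close> coordinates: \<open>w\<close> occupies
  coordinate \<open>n\<close>, so divisibility of exponents and comparison of \<open>w\<close> hold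
  for the same pair. The Krull argument puts an excess weight there.\<close>

lemma dickson:
  fixes \<alpha> :: "nat \<Rightarrow> expo" and w :: "nat \<Rightarrow> nat"
  assumes "\<And>j. \<alpha> j \<in> expos n"
  obtains i j \<beta> where "i < j" "\<alpha> j = \<beta> + \<alpha> i" "w i \<le> w j"
proof -
  obtain f :: "nat \<Rightarrow> nat" where f: "strict_mono f" "\<forall>i<Suc n. mono (\<lambda>j. (if i < n then coef (\<alpha> (f j)) i else w (f j)))"
    using dickson_subseq[of "Suc n" "\<lambda>j i. if i < n then coef (\<alpha> j) i else w j"] by blast
  have le: "coef (\<alpha> (f 0)) i \<le> coef (\<alpha> (f 1)) i" for i
  proof (cases "i < n")
    case True then show ?thesis using f(2)[rule_format, of i] monoD[of _ 0 1] by fastforce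
  next
    case False
    then have "coef (\<alpha> (f 0)) i = 0" using assms[of "f 0"] by (auto simp: expos_def mem_supp subset_iff)
    then show ?thesis by simp
  qed
  have "\<alpha> (f 1) = (\<alpha> (f 1) - \<alpha> (f 0)) + \<alpha> (f 0)"
    using le by (intro poly_mapping_eqI) (simp add: lookup_add lookup_minus)
  moreover have "w (f 0) \<le> w (f 1)" using f(2)[rule_format, of n] by (auto simp: mono_def)
  moreover have "f 0 < f 1" using f(1) by (simp add: strict_mono_def)
  ultimately show ?thesis using that by blast
qed

text \<open>The order on finitely supported functions is lexicographic, decided at the least index
  of disagreement. It serves both as the monomial order on exponents and as the order on
  values.\<close>

lemma lex_lessI:
  "coef \<alpha> k < coef \<beta> k \<Longrightarrow> (\<And>j. j < k \<Longrightarrow> coef \<alpha> j = coef \<beta> j) \<Longrightarrow> (\<alpha> :: nat \<Rightarrow>\<^sub>0 'c::{zero,linorder}) < \<beta>"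
  by transfer (auto simp: less_fun_def)

text \<open>Together with compatibility with addition, this makes the lexicographic order a monomial
  order: 0 is least because the first nonzero entry of \<open>\<beta>\<close> is positive.\<close>

lemma expo_le_add: "(\<alpha> :: expo) \<le> \<beta> + \<alpha>"
proof -
  have "0 \<le> \<beta>"
  proof (cases "\<beta> = 0")
    case False
    then obtain k where k: "coef \<beta> k \<noteq> 0" by (auto simp: poly_mapping_eq_iff fun_eq_iff)
    have "0 < \<beta>"
      by (rule lex_lessI[of _ "LEAST k. coef \<beta> k \<noteq> 0"])
        (use LeastI[of "\<lambda>k. coef \<beta> k \<noteq> 0", OF k] in \<open>auto dest: not_less_Least\<close>)
    then show ?thesis by simp
  qed simp
  then show ?thesis using add_right_mono[of 0 \<beta> \<alpha>] by simp
qed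

section \<open>Modules over subrings and Noether normalization\<close>

text \<open>The coefficients form an arbitrary set: later it is a subalgebra, the whole ring, or the
  set \<open>higher\<close> of terms of high order, which need not contain 1.\<close>

definition modspan :: "'a::comm_ring_1 set \<Rightarrow> 'a set \<Rightarrow> 'a set" where
  "modspan R E = {\<Sum>e\<in>F. c e * e | F c. finite F \<and> F \<subseteq> E \<and> c \<in> F \<rightarrow> R}"

locale coefs =
  fixes R :: "'a::comm_ring_1 set"
  assumes zero: "0 \<in> R" and add: "x \<in> R \<Longrightarrow> y \<in> R \<Longrightarrow> x + y \<in> R"
begin

lemma modspan_0: "0 \<in> modspan R E"
  unfolding modspan_def by (rule CollectI, rule exI[of _ "{}"]) auto

lemma modspan_base: "r \<in> R \<Longrightarrow> e \<in> E \<Longrightarrow> r * e \<in> modspan R E"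
  unfolding modspan_def by (rule CollectI, rule exI[of _ "{e}"], rule exI[of _ "\<lambda>_. r"]) auto

lemma modspan_extend:
  assumes "x \<in> modspan R E"
  obtains F c where "finite F" "F \<subseteq> E" "\<And>e. c e \<in> R"
    "\<And>F'. finite F' \<Longrightarrow> F \<subseteq> F' \<Longrightarrow> x = (\<Sum>e\<in>F'. c e * e)"
proof -
  obtain F c where F: "finite F" "F \<subseteq> E" "c \<in> F \<rightarrow> R" "x = (\<Sum>e\<in>F. c e * e)"
    using assms unfolding modspan_def by blast
  define c' where "c' e = (if e \<in> F then c e else 0)" for e
  have "x = (\<Sum>e\<in>F'. c' e * e)" if "finite F'" "F \<subseteq> F'" for F'
    unfolding F(4) by (rule sum.mono_neutral_cong_left) (use that in \<open>auto simp: c'_def\<close>)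
  moreover have "c' e \<in> R" for e using F(3) zero by (auto simp: c'_def)
  ultimately show ?thesis using that F by blast
qed

lemma modspan_finite:
  assumes "x \<in> modspan R E" "finite E"
  obtains c where "\<And>e. c e \<in> R" "x = (\<Sum>e\<in>E. c e * e)"
  proof -
  obtain F c where "finite F" "F \<subseteq> E" "\<And>e. c e \<in> R"
    "\<And>F'. finite F' \<Longrightarrow> F \<subseteq> F' \<Longrightarrow> x = (\<Sum>e\<in>F'. c e * e)"
    using assms(1) by (rule modspan_extend) blast
  then show ?thesis using that assms(2) by blast
qed

lemma modspan_add:
  assumes "x \<in> modspan R E" "y \<in> modspan R E"
  shows "x + y \<in> modspan R E"
proof -
  obtain F c where x: "finite F" "F \<subseteq> E" "\<And>e. c e \<in> R"
    "\<And>F'. finite F' \<Longrightarrow> F \<subseteq> F' \<Longrightarrow> x = (\<Sum>e\<in>F'. c e * e)"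
    using assms(1) by (rule modspan_extend) blast
  obtain G d where y: "finite G" "G \<subseteq> E" "\<And>e. d e \<in> R"
    "\<And>F'. finite F' \<Longrightarrow> G \<subseteq> F' \<Longrightarrow> y = (\<Sum>e\<in>F'. d e * e)"
    using assms(2) by (rule modspan_extend) blast
  have "x + y = (\<Sum>e\<in>F \<union> G. (c e + d e) * e)"
    using x(4)[of "F \<union> G"] y(4)[of "F \<union> G"] x(1) y(1) by (simp add: algebra_simps sum.distrib)
  then show ?thesis
    unfolding modspan_def using x y add
    by (intro CollectI exI[of _ "F \<union> G"] exI[of _ "\<lambda>e. c e + d e"]) auto
qed

lemma modspan_sum: "(\<And>i. i \<in> V \<Longrightarrow> f i \<in> modspan R E) \<Longrightarrow> sum f V \<in> modspan R E"
  by (induction V rule: infinite_finite_induct) (auto intro: modspan_0 modspan_add)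

text \<open>The induction rule for \<open>modspan\<close>: in most applications \<open>M\<close> is
  a comprehension stating that a product with a fixed element lands in another span.\<close>

lemma modspan_subset:
  assumes "0 \<in> M" "\<And>x y. x \<in> M \<Longrightarrow> y \<in> M \<Longrightarrow> x + y \<in> M"
    and "\<And>r e. r \<in> R' \<Longrightarrow> e \<in> E \<Longrightarrow> r * e \<in> M"
  shows "modspan R' E \<subseteq> M"
proof -
  have "(\<Sum>e\<in>F. c e * e) \<in> M" if "finite F" "F \<subseteq> E" "c \<in> F \<rightarrow> R'" for F c
    using that by (induction F rule: finite_induct) (auto simp: assms)
  then show ?thesis unfolding modspan_def by blast
qed

lemma modspan_scale:
  assumes "\<And>r. r \<in> R' \<Longrightarrow> a * r \<in> R" "x \<in> modspan R' E"
  shows "a * x \<in> modspan R E"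
proof -
  have "modspan R' E \<subseteq> {x. a * x \<in> modspan R E}"
    by (rule modspan_subset)
      (auto simp: modspan_0 ring_distribs mult.assoc[symmetric] intro: modspan_add modspan_base assms(1))
  then show ?thesis using assms(2) by auto
qed

lemma modspan_mult:
  assumes "x \<in> modspan R1 E1" "y \<in> modspan R2 E2"
    and "\<And>r1 r2 e1 e2. r1 \<in> R1 \<Longrightarrow> r2 \<in> R2 \<Longrightarrow> e1 \<in> E1 \<Longrightarrow> e2 \<in> E2 \<Longrightarrow> r1 * r2 * (e1 * e2) \<in> modspan R E"
  shows "x * y \<in> modspan R E"
proof -
  have 1: "modspan R2 E2 \<subseteq> {y. r1 * e1 * y \<in> modspan R E}" if "r1 \<in> R1" "e1 \<in> E1" for r1 e1
  proof (rule modspan_subset)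
    fix r e assume re: "r \<in> R2" "e \<in> E2"
    have "r1 * e1 * (r * e) = r1 * r * (e1 * e)" by (simp add: mult_ac)
    then show "r * e \<in> {y. r1 * e1 * y \<in> modspan R E}"
      using assms(3)[OF that(1) re(1) that(2) re(2)] by (simp only: mem_Collect_eq)
  qed (auto simp: modspan_0 ring_distribs intro: modspan_add)
  have "modspan R1 E1 \<subseteq> {x. x * y \<in> modspan R E}"
    by (rule modspan_subset) (use 1 assms(2) in \<open>auto simp: modspan_0 ring_distribs intro: modspan_add\<close>)
  then show ?thesis using assms(1) by auto
qed

end

locale subalg = coefs R for R :: "'a::comm_ring_1 set" +
  assumes one: "1 \<in> R" and mult: "x \<in> R \<Longrightarrow> y \<in> R \<Longrightarrow> x * y \<in> R"
begin

lemma modspan_gen: "e \<in> E \<Longrightarrow> e \<in> modspan R E"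
  using modspan_base[OF one] by simp

lemma modspan_smult: "r \<in> R \<Longrightarrow> x \<in> modspan R E \<Longrightarrow> r * x \<in> modspan R E"
  by (rule modspan_scale) (auto intro: mult)

lemma modspan_mono:
  assumes "E \<subseteq> modspan R E'" shows "modspan R E \<subseteq> modspan R E'"
  by (rule modspan_subset) (use assms in \<open>auto intro: modspan_0 modspan_add modspan_smult\<close>)

end

text \<open>The number with base-\<open>K\<close> digits \<open>a 0, ..., a (m - 1)\<close>, leading
  digit first. It is additive without any bound on the digits, and injective on digits below
  \<open>K\<close>.\<close>

fun mixed_radix :: "nat \<Rightarrow> (nat \<Rightarrow> nat) \<Rightarrow> nat \<Rightarrow> nat" where
  "mixed_radix K a 0 = 0"
| "mixed_radix K a (Suc m) = K * mixed_radix K a m + a m"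

lemma mixed_radix_inj:
  assumes "mixed_radix K a m = mixed_radix K a' m" "\<And>i. i < m \<Longrightarrow> a i < K" "\<And>i. i < m \<Longrightarrow> a' i < K"
  shows "\<forall>i<m. a i = a' i"
  using assms
proof (induction m)
  case (Suc m)
  let ?x = "mixed_radix K a m" and ?y = "mixed_radix K a' m"
  have lt: "a m < K" "a' m < K" using Suc.prems by auto
  have eq: "K * ?x + a m = K * ?y + a' m" using Suc.prems(1) by simp
  have "?x = (K * ?x + a m) div K" "?y = (K * ?y + a' m) div K" using lt by simp_all
  then have x: "?x = ?y" using eq by simp
  then have "a m = a' m" using eq by simp
  moreover have "\<forall>i<m. a i = a' i" using Suc.IH x Suc.prems by auto
  ultimately show ?case by (auto simp: less_Suc_eq)
qed simp

lemma mixed_radix_add: "mixed_radix K (\<lambda>i. a i + a' i) m = mixed_radix K a m + mixed_radix K a' m"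
  by (induction m) (auto simp: algebra_simps)

lemma mixed_radix_unit: "i < m \<Longrightarrow> mixed_radix K (\<lambda>j. if j = i then 1 else 0) m = K ^ (m - 1 - i)"
proof (induction m)
  case (Suc m)
  have z: "mixed_radix K (\<lambda>j. if j = i then 1 else 0) k = 0" if "k \<le> i" for k
    using that by (induction k) auto
  show ?case
  proof (cases "i = m")
    case False
    with Suc have "i < m" by simp
    then have "Suc m - 1 - i = Suc (m - 1 - i)" by simp
    with Suc \<open>i < m\<close> show ?thesis by simp
  qed (use z[of m] in simp)
qed simp

section \<open>Nagata's change of variables and Noether normalization\<close>

context scalar_hom begin

definition subal :: "(nat \<Rightarrow> 'a) \<Rightarrow> nat \<Rightarrow> 'a set" where "subal y s = ev y ` polys s"

lemma subalg_subal: "subalg (subal y s)"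
proof
  show "0 \<in> subal y s" unfolding subal_def by (rule image_eqI[of _ _ 0]) auto
  show "1 \<in> subal y s" unfolding subal_def by (rule image_eqI[of _ _ 1]) auto
  fix u v assume "u \<in> subal y s" "v \<in> subal y s"
  then obtain p q where "u = ev y p" "v = ev y q" "p \<in> polys s" "q \<in> polys s"
    unfolding subal_def by blast
  then show "u + v \<in> subal y s" "u * v \<in> subal y s"
    unfolding subal_def by (auto simp: ev_add[symmetric] ev_mult[symmetric] intro!: imageI polys_add polys_mult)
qed

lemma subal_phi: "\<phi> c \<in> subal y s"
  unfolding subal_def by (rule image_eqI[of _ _ "sgl 0 c"]) (auto simp: polys_sgl)

lemma subal_var: "i < s \<Longrightarrow> y i \<in> subal y s"
  unfolding subal_def by (rule image_eqI[of _ _ "sgl (sgl i 1) 1"]) (auto simp: polys_sgl expos_sgl)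

text \<open>With \<open>t = y s\<close>, the substitution
  \<open>y i = z i + t ^ (K ^ (s - i))\<close> turns the monomial \<open>\<alpha>\<close> into
  \<open>t ^ D \<alpha>\<close> plus terms of lower degree in \<open>t\<close>. Distinct monomials
  of \<open>p\<close> have distinct \<open>D\<close>, so exactly one of them supplies the top power
  of \<open>t\<close>. The relation thus becomes monic in \<open>t\<close> over the subalgebra of
  \<open>z\<close>, and all powers of \<open>t\<close> reduce to finitely many.\<close>

lemma nagata:
  assumes p: "p \<in> polys (Suc s)" "p \<noteq> 0" "ev y p = 0"
  obtains z E where "finite E" "subal y (Suc s) \<subseteq> modspan (subal z s) E"
proof -
  \<comment> \<open>Larger than every exponent occurring in \<open>p\<close>, so that
    \<open>D\<close> separates the monomials of \<open>p\<close>.\<close>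
  define K where "K = Suc (Max (insert 0 ((\<lambda>(\<alpha>,i). coef \<alpha> i) ` (supp p \<times> {..s}))))"
  have K: "coef \<alpha> i < K" if "\<alpha> \<in> supp p" "i \<le> s" for \<alpha> i
    unfolding K_def less_Suc_eq_le by (rule Max_ge) (use that in auto)
  have K0: "K > 0" by (simp add: K_def)
  define D where "D \<alpha> = mixed_radix K (coef \<alpha>) (Suc s)" for \<alpha> :: expo
  have D_add: "D (\<alpha> + \<beta>) = D \<alpha> + D \<beta>" for \<alpha> \<beta>
    unfolding D_def lookup_add mixed_radix_add ..
  have D_sgl: "D (sgl i 1) = K ^ (s - i)" if "i < Suc s" for i
  proof -
    have "coef (sgl i (1::nat)) = (\<lambda>j. if j = i then 1 else 0)"
      by (auto simp: fun_eq_iff lookup_single when_def)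
    then show ?thesis using mixed_radix_unit[OF that, of K] by (simp add: D_def)
  qed
  have D0: "D 0 = 0" using D_add[of 0 0] by simp
  have D_inj: "\<alpha> = \<beta>" if "\<alpha> \<in> supp p" "\<beta> \<in> supp p" "D \<alpha> = D \<beta>" for \<alpha> \<beta>
  proof (rule poly_mapping_eqI)
    fix i
    have "\<forall>i<Suc s. coef \<alpha> i = coef \<beta> i"
      by (rule mixed_radix_inj[of K]) (use that K in \<open>auto simp: D_def\<close>)
    moreover have "coef \<alpha> i = 0 \<and> coef \<beta> i = 0" if "\<not> i < Suc s"
      using polysD[OF p(1) \<open>\<alpha> \<in> supp p\<close>] polysD[OF p(1) \<open>\<beta> \<in> supp p\<close>] that
      by (auto simp: expos_def mem_supp subset_iff)
    ultimately show "coef \<alpha> i = coef \<beta> i" by (cases "i < Suc s") auto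
  qed
  define t where "t = y s"
  \<comment> \<open>For \<open>i = s\<close> the exponent is \<open>K ^ 0 = 1\<close>, so
    \<open>z s = 0\<close>: this is how one variable disappears.\<close>
  define z where "z i = y i - t ^ (K ^ (s - i))" for i
  interpret R: subalg "subal z s" by (rule subalg_subal)
  \<comment> \<open>The analogue of the polynomials of degree below \<open>D\<close> in
    \<open>t\<close> with coefficients in the subalgebra of \<open>z\<close>.\<close>
  define L where "L D = modspan (subal z s) ((\<lambda>j. t ^ j) ` {..<D})" for D
  have L_mono: "L a \<subseteq> L a'" if "a \<le> a'" for a a'
    unfolding L_def by (rule R.modspan_mono) (use that in \<open>auto intro!: R.modspan_gen\<close>)
  have tpow: "t ^ j \<in> L a" if "j < a" for j a
    unfolding L_def by (rule R.modspan_gen) (use that in auto)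
  have z_in: "z i \<in> subal z s" if "i < Suc s" for i
    using that R.zero by (cases "i = s") (auto simp: z_def[of s] t_def intro: subal_var)
  have lead: "mon y \<alpha> - t ^ D \<alpha> \<in> L (D \<alpha>)" if "\<alpha> \<in> expos (Suc s)" for \<alpha>
  proof -
    have "supp \<alpha> \<subseteq> {..<Suc s}" using that by (simp add: expos_def)
    then show ?thesis
    proof (induction rule: expo_induct[where U="{..<Suc s}"])
      case zero show ?case by (simp add: D0 L_def R.modspan_0)
    next
      case (step \<alpha> i)
      define e where "e = K ^ (s - i)"
      have e: "D (\<alpha> + sgl i 1) = D \<alpha> + e" "e > 0" using D_sgl step D_add K0 by (auto simp: e_def)
      define l where "l = mon y \<alpha> - t ^ D \<alpha>"
      have "mon y (\<alpha> + sgl i 1) - t ^ (D \<alpha> + e) = z i * t ^ D \<alpha> + l * t ^ e + z i * l"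
        by (simp add: mon_add z_def l_def e_def power_add algebra_simps)
      moreover have "z i * t ^ D \<alpha> \<in> L (D \<alpha> + e)"
        unfolding L_def using step z_in e by (intro R.modspan_base) auto
      moreover have "l * t ^ e \<in> L (D \<alpha> + e)"
      proof -
        have "l \<in> modspan (subal z s) ((\<lambda>j. t ^ j) ` {..<D \<alpha>})" using step l_def L_def by simp
        then show ?thesis unfolding L_def
          by (rule R.modspan_mult[OF _ R.modspan_gen[of _ "{t ^ e}"]])
            (auto simp: power_add[symmetric] intro!: R.modspan_base R.mult)
      qed
      moreover have "z i * l \<in> L (D \<alpha> + e)"
        using step z_in L_mono[of "D \<alpha>" "D \<alpha> + e"] R.modspan_smult[of "z i" l] by (auto simp: l_def L_def)
      ultimately show ?case unfolding e(1) by (auto simp: L_def intro: R.modspan_add)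
    qed
  qed
  obtain \<alpha> where \<alpha>: "\<alpha> \<in> supp p" "\<And>\<beta>. \<beta> \<in> supp p \<Longrightarrow> D \<beta> \<le> D \<alpha>"
  proof -
    have "finite (supp p)" "supp p \<noteq> {}" using p(2) by auto
    then have "Max (D ` supp p) \<in> D ` supp p" by simp
    then obtain \<alpha> where "\<alpha> \<in> supp p" "D \<alpha> = Max (D ` supp p)" by auto
    then show ?thesis using that by simp
  qed
  have L_add: "u + v \<in> L a" if "u \<in> L a" "v \<in> L a" for u v a
    using that unfolding L_def by (rule R.modspan_add)
  have L_smult: "r * v \<in> L a" if "r \<in> subal z s" "v \<in> L a" for r v a
    using that unfolding L_def by (rule R.modspan_smult)
  have L_sum: "sum f V \<in> L a" if "\<And>i. i \<in> V \<Longrightarrow> f i \<in> L a" for f a and V :: "expo set"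
    using that unfolding L_def by (rule R.modspan_sum)
  have low: "mon y \<beta> \<in> L (D \<alpha>)" if "\<beta> \<in> supp p - {\<alpha>}" for \<beta>
  proof -
    have "D \<beta> < D \<alpha>" using \<alpha> that D_inj[of \<beta> \<alpha>] by (cases "D \<beta> = D \<alpha>") (auto simp: nat_less_le)
    then have "t ^ D \<beta> \<in> L (D \<alpha>)" "mon y \<beta> - t ^ D \<beta> \<in> L (D \<alpha>)"
      using lead[of \<beta>] polysD[OF p(1)] that L_mono[of "D \<beta>" "D \<alpha>"] tpow by auto
    from L_add[OF this] show ?thesis by simp
  qed
  define c where "c = \<phi> (inverse (coef p \<alpha>))"
  have c: "c * \<phi> (coef p \<alpha>) = 1"
    using \<alpha>(1) by (simp add: c_def phi_mult[symmetric] mem_supp)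
  define S where "S = (\<Sum>\<beta>\<in>supp p - {\<alpha>}. \<phi> (coef p \<beta>) * mon y \<beta>)"
  have S: "\<phi> (coef p \<alpha>) * mon y \<alpha> + S = 0"
    using p(3) \<alpha>(1) by (simp add: ev_def sum.remove S_def)
  have "mon y \<alpha> + c * S = (c * \<phi> (coef p \<alpha>)) * mon y \<alpha> + c * S" unfolding c by simp
  also have "\<dots> = c * (\<phi> (coef p \<alpha>) * mon y \<alpha> + S)" by (simp only: distrib_left mult.assoc)
  also have "\<dots> = 0" by (simp only: S mult_zero_right)
  finally have "c * S = - mon y \<alpha>" by (simp only: add_eq_0_iff)
  \<comment> \<open>Dividing the relation by the coefficient of \<open>\<alpha>\<close> and
    exchanging the monomial for its top power writes \<open>t ^ D \<alpha>\<close> as a combination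
    of smaller powers.\<close>
  then have "t ^ D \<alpha> = \<phi> (- 1) * ((mon y \<alpha> - t ^ D \<alpha>) + c * S)"
    by (simp add: phi_uminus)
  also have "\<dots> \<in> L (D \<alpha>)"
    unfolding S_def by (intro L_smult L_add L_sum low) (use \<alpha> lead polysD[OF p(1)] in \<open>auto simp: c_def subal_phi\<close>)
  finally have tD: "t ^ D \<alpha> \<in> L (D \<alpha>)" .
  \<comment> \<open>This puts \<open>1 = t ^ 0\<close> among the spanning powers; for
    \<open>D \<alpha> = 0\<close> the previous fact would place 1 in the span of the empty
    set.\<close>
  have D_pos: "D \<alpha> > 0"
  proof (rule ccontr)
    assume "\<not> ?thesis"
    then have "1 \<in> modspan (subal z s) {}" using tD by (simp add: L_def)
    then show False by (auto simp: modspan_def)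
  qed
  have t_closed: "v * t \<in> L (D \<alpha>)" if "v \<in> L (D \<alpha>)" for v
  proof -
    have "v \<in> modspan (subal z s) ((\<lambda>j. t ^ j) ` {..<D \<alpha>})" using that by (simp add: L_def)
    then show ?thesis unfolding L_def
    proof (rule R.modspan_mult[OF _ R.modspan_gen[of _ "{t}"]])
      fix r1 r2 e1 e2 assume a: "r1 \<in> subal z s" "r2 \<in> subal z s" "e1 \<in> (^) t ` {..<D \<alpha>}" "e2 \<in> {t}"
      then obtain j where "e1 = t ^ j" "e2 = t" "j < D \<alpha>" by blast
      then have j: "e1 * e2 = t ^ Suc j" "Suc j \<le> D \<alpha>" by simp_all
      have "e1 * e2 \<in> L (D \<alpha>)" using j tD tpow[of "Suc j" "D \<alpha>"] by (cases "Suc j = D \<alpha>") auto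
      then show "r1 * r2 * (e1 * e2) \<in> modspan (subal z s) ((^) t ` {..<D \<alpha>})"
        using L_smult[of "r1 * r2"] a R.mult by (simp add: L_def)
    qed simp
  qed
  have all_t: "t ^ j \<in> L (D \<alpha>)" for j
  proof (induction j)
    case (Suc j)
    from t_closed[OF Suc] show ?case by (simp add: mult.commute)
  qed (use D_pos tpow[of 0] in simp)
  have all_L: "L a \<subseteq> L (D \<alpha>)" for a
    unfolding L_def by (rule R.modspan_mono) (use all_t in \<open>auto simp: L_def\<close>)
  have "mon y \<beta> \<in> L (D \<alpha>)" if "\<beta> \<in> expos (Suc s)" for \<beta>
    using L_add[OF all_t[of "D \<beta>"], of "mon y \<beta> - t ^ D \<beta>"] lead[OF that] all_L by auto
  then have "ev y q \<in> L (D \<alpha>)" if "q \<in> polys (Suc s)" for q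
    unfolding ev_def by (intro L_sum L_smult subal_phi) (use that polysD in blast)
  then have "subal y (Suc s) \<subseteq> L (D \<alpha>)" by (auto simp: subal_def)
  then show ?thesis using that[of "(\<lambda>j. t ^ j) ` {..<D \<alpha>}" z] by (simp add: L_def)
qed

lemma ev_inj_constants:
  assumes "p \<in> polys 0" "ev y p = 0" shows "p = 0"
proof (rule poly_mapping_eqI)
  fix \<alpha> :: expo
  have s: "supp p \<subseteq> {0}" using assms(1) by (auto simp: polys_def expos_def)
  have "ev y p = \<phi> (coef p 0)" using ev_superset[OF _ s, of y] by simp
  then have "coef p 0 = 0" using assms(2) by simp
  then show "coef p \<alpha> = coef 0 \<alpha>" using s by (cases "\<alpha> = 0") (auto simp: mem_supp)
qed

definition fin_over :: "(nat \<Rightarrow> 'a) \<Rightarrow> nat \<Rightarrow> bool" where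
  "fin_over y s \<longleftrightarrow> (\<exists>E. finite E \<and> modspan (subal y s) E = UNIV)"

text \<open>Take the least number of elements over which the ring is finite. A relation among them
  would let \<open>nagata\<close> pass to one fewer, since finiteness is transitive.\<close>

lemma noether_normalization:
  assumes "fin_over b n"
  obtains y s where "fin_over y s" "\<And>p. p \<in> polys s \<Longrightarrow> ev y p = 0 \<Longrightarrow> p = 0"
proof -
  define s where "s = (LEAST s. \<exists>y. fin_over y s)"
  have ex: "\<exists>y. fin_over y s" unfolding s_def by (rule LeastI[of _ n]) (use assms in blast)
  have min: "s \<le> s'" if "fin_over y s'" for y s'
    unfolding s_def by (rule Least_le) (use that in blast)
  obtain y where y: "fin_over y s" using ex by blast
  then obtain E where E: "finite E" "modspan (subal y s) E = UNIV" by (auto simp: fin_over_def)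
  have "p = 0" if p: "p \<in> polys s" "ev y p = 0" for p
  proof (cases "s = 0")
    case True
    with p(1) have "p \<in> polys 0" by (simp only:)
    from this p(2) show "p = 0" by (rule ev_inj_constants)
  next
    case False
    then obtain s' where Suc: "s = Suc s'" using not0_implies_Suc by blast
    show ?thesis
    proof (rule ccontr)
      assume "p \<noteq> 0"
      have "p \<in> polys (Suc s')" using p(1) unfolding Suc .
      from this \<open>p \<noteq> 0\<close> p(2) obtain F z where "finite F" "subal y (Suc s') \<subseteq> modspan (subal z s') F"
        by (rule nagata)
      then have z: "finite F" "subal y s \<subseteq> modspan (subal z s') F" unfolding Suc by simp_all
      interpret R: subalg "subal z s'" by (rule subalg_subal)
      \<comment> \<open>Products of generators of the two finite extensions generate the composite
        extension.\<close>
      define G where "G = (\<lambda>(f, e). f * e) ` (F \<times> E)"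
      have "v \<in> modspan (subal z s') G" for v
      proof -
        have "modspan (subal y s) E \<subseteq> modspan (subal z s') G"
        proof (rule R.modspan_subset)
          fix r e assume r: "r \<in> subal y s" "e \<in> E"
          then have "r \<in> modspan (subal z s') F" using z by auto
          from this R.modspan_gen[of e "{e}"] show "r * e \<in> modspan (subal z s') G"
            by (rule R.modspan_mult) (use r in \<open>auto simp: G_def intro!: R.modspan_base R.mult\<close>)
        qed (auto intro: R.modspan_0 R.modspan_add)
        then show ?thesis using E by auto
      qed
      then have "fin_over z s'" unfolding fin_over_def using z(1) E(1)
        by (intro exI[of _ G]) (auto simp: G_def)
      from min[OF this] show False using Suc by simp
    qed
  qed
  then show ?thesis using that y by blast
qed

end

section \<open>Chains of prime ideals\<close>

definition ideal_set :: "'a::comm_ring_1 set \<Rightarrow> bool" where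
  "ideal_set P \<longleftrightarrow> 0 \<in> P \<and> (\<forall>x\<in>P. \<forall>y\<in>P. x + y \<in> P) \<and> (\<forall>x\<in>P. \<forall>a. a * x \<in> P)"

definition prime_set :: "'a::comm_ring_1 set \<Rightarrow> bool" where
  "prime_set P \<longleftrightarrow> ideal_set P \<and> 1 \<notin> P \<and> (\<forall>x y. x * y \<in> P \<longrightarrow> x \<in> P \<or> y \<in> P)"

lemma ideal_set_adjoin:
  assumes "ideal_set P"
  shows "ideal_set {p + a * x | p a. p \<in> P}" "P \<subseteq> {p + a * x | p a. p \<in> P}" "x \<in> {p + a * x | p a. p \<in> P}"
proof -
  let ?Q = "{p + a * x | p a. p \<in> P}"
  have P: "0 \<in> P" "\<And>x y. x \<in> P \<Longrightarrow> y \<in> P \<Longrightarrow> x + y \<in> P" "\<And>x a. x \<in> P \<Longrightarrow> a * x \<in> P"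
    using assms by (auto simp: ideal_set_def)
  have "u + v \<in> ?Q" if uv: "u \<in> ?Q" "v \<in> ?Q" for u v
  proof -
    obtain p a q c where "u = p + a * x" "v = q + c * x" "p \<in> P" "q \<in> P" using uv by blast
    then show ?thesis using P(2)[of p q]
      by (intro CollectI exI[of _ "p + q"] exI[of _ "a + c"]) (auto simp: algebra_simps)
  qed
  moreover have "c * u \<in> ?Q" if u: "u \<in> ?Q" for u c
  proof -
    obtain p a where "u = p + a * x" "p \<in> P" using u by blast
    then show ?thesis using P(3)[of p c]
      by (intro CollectI exI[of _ "c * p"] exI[of _ "c * a"]) (auto simp: algebra_simps)
  qed
  moreover show "P \<subseteq> ?Q"
  proof
    fix p assume "p \<in> P"
    then show "p \<in> ?Q" by (intro CollectI exI[of _ p] exI[of _ 0]) simp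
  qed
  moreover show "x \<in> ?Q" using P(1) by (intro CollectI exI[of _ 0] exI[of _ 1]) simp
  ultimately show "ideal_set ?Q" using P(1) unfolding ideal_set_def by blast
qed

text \<open>An ideal maximal among those disjoint from a multiplicative set is prime: if
  \<open>x\<close> and \<open>y\<close> are both outside, adjoining either one meets
  \<open>M\<close>, and the product of the two elements found lies in \<open>P\<close> as soon as
  \<open>x * y\<close> does.\<close>

lemma exists_prime_avoiding:
  assumes J: "ideal_set J" and M: "1 \<in> M" "\<And>x y. x \<in> M \<Longrightarrow> y \<in> M \<Longrightarrow> x * y \<in> M" and JM: "J \<inter> M = {}"
  obtains P where "prime_set P" "J \<subseteq> P" "P \<inter> M = {}"
proof -
  define S where "S = {P. ideal_set P \<and> J \<subseteq> P \<and> P \<inter> M = {}}"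
  have "\<exists>P\<in>S. \<forall>Q\<in>S. P \<subseteq> Q \<longrightarrow> Q = P"
  proof (rule subset_Zorn_nonempty)
    show "S \<noteq> {}" using J JM by (auto simp: S_def)
    fix C assume C: "C \<noteq> {}" "subset.chain S C"
    then have CS: "C \<subseteq> S" and tot: "\<And>P Q. P \<in> C \<Longrightarrow> Q \<in> C \<Longrightarrow> P \<subseteq> Q \<or> Q \<subseteq> P"
      by (auto simp: subset_chain_def)
    have "ideal_set (\<Union>C)"
      unfolding ideal_set_def
    proof (intro conjI ballI allI)
      show "0 \<in> \<Union>C" using C CS by (auto simp: S_def ideal_set_def)
      fix x y assume "x \<in> \<Union>C" "y \<in> \<Union>C"
      then obtain P where P: "P \<in> C" "x \<in> P" "y \<in> P" using tot by (meson UnionE subsetD)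
      then have "x + y \<in> P" using CS by (auto simp: S_def ideal_set_def)
      with P show "x + y \<in> \<Union>C" by blast
    next
      fix x a assume "x \<in> \<Union>C"
      then obtain P where P: "P \<in> C" "x \<in> P" by blast
      then have "a * x \<in> P" using CS by (auto simp: S_def ideal_set_def)
      with P show "a * x \<in> \<Union>C" by blast
    qed
    then show "\<Union>C \<in> S" using C CS by (auto simp: S_def)
  qed
  then obtain P where P: "P \<in> S" and max: "\<And>Q. Q \<in> S \<Longrightarrow> P \<subseteq> Q \<Longrightarrow> Q = P" by blast
  have idl: "ideal_set P" "J \<subseteq> P" "P \<inter> M = {}" using P by (auto simp: S_def)
  have meets: "\<exists>p\<in>P. \<exists>a. p + a * x \<in> M" if "x \<notin> P" for x
    using max[of "{p + a * x | p a. p \<in> P}"] ideal_set_adjoin[OF idl(1), of x] idl that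
    unfolding S_def by blast
  have "x \<in> P \<or> y \<in> P" if xy: "x * y \<in> P" for x y
  proof (rule ccontr)
    assume "\<not> ?thesis"
    then obtain p a q c where "p \<in> P" "q \<in> P" "p + a * x \<in> M" "q + c * y \<in> M"
      using meets by blast
    then have "(p + a * x) * (q + c * y) \<in> M" using M by blast
    moreover have "(p + a * x) * (q + c * y) = (q + c * y) * p + (a * x) * q + (a * c) * (x * y)"
      by (simp add: algebra_simps)
    moreover have "\<dots> \<in> P" using idl(1) xy \<open>p \<in> P\<close> \<open>q \<in> P\<close> unfolding ideal_set_def by blast
    ultimately show False using idl by auto
  qed
  then have "prime_set P" using idl M by (auto simp: prime_set_def)
  then show ?thesis using that idl by blast
qed

text \<open>The Coquand-Lombardi boundary monoids: a prime ideal avoiding \<open>bdy_monoid (x # xs)\<close> does not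
  contain \<open>x\<close>, and together with \<open>x\<close> it generates an ideal that avoids \<open>bdy_monoid xs\<close>.\<close>

fun bdy_monoid :: "'a::comm_ring_1 list \<Rightarrow> 'a set" where
  "bdy_monoid [] = {1}"
| "bdy_monoid (x # xs) = {x ^ m * (g + a * x) | m g a. g \<in> bdy_monoid xs}"

lemma bdy_monoid_Cons: "g \<in> bdy_monoid xs \<Longrightarrow> x ^ m * (g + a * x) \<in> bdy_monoid (x # xs)"
  by (simp only: bdy_monoid.simps) blast

lemma bdy_monoid_1: "1 \<in> bdy_monoid xs"
proof (induction xs)
  case (Cons x xs)
  then have "x ^ 0 * (1 + 0 * x) \<in> bdy_monoid (x # xs)" by (rule bdy_monoid_Cons)
  then show ?case by simp
qed simp

lemma bdy_monoid_mult: "u \<in> bdy_monoid xs \<Longrightarrow> v \<in> bdy_monoid xs \<Longrightarrow> u * v \<in> bdy_monoid xs"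
proof (induction xs arbitrary: u v)
  case (Cons x xs)
  obtain m g a m' g' a' where u: "u = x ^ m * (g + a * x)" "g \<in> bdy_monoid xs"
    and v: "v = x ^ m' * (g' + a' * x)" "g' \<in> bdy_monoid xs" using Cons.prems by auto
  have "u * v = x ^ (m + m') * (g * g' + (a * g' + a' * g + a * a' * x) * x)"
    unfolding u v by (simp add: algebra_simps power_add)
  then show ?case using Cons.IH[OF u(2) v(2)] by auto
qed simp

text \<open>Each list entry adds one inclusion, which is strict because the entry lies in the new
  prime and not in the old one.\<close>

lemma prime_chain:
  assumes "prime_set P" "P \<inter> bdy_monoid xs = {}"
  shows "\<exists>Q::nat \<Rightarrow> 'a::comm_ring_1 set. Q 0 = P \<and> (\<forall>i\<le>length xs. prime_set (Q i)) \<and> (\<forall>i<length xs. Q i \<subset> Q (Suc i))"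
  using assms
proof (induction xs arbitrary: P)
  case Nil
  then show ?case by (intro exI[of _ "\<lambda>_. P"]) auto
next
  case (Cons x xs)
  have P: "ideal_set P" using Cons.prems by (simp add: prime_set_def)
  have "x ^ 1 * (1 + 0 * x) \<in> bdy_monoid (x # xs)"
    using bdy_monoid_1[of xs] by (rule bdy_monoid_Cons)
  then have "x \<in> bdy_monoid (x # xs)" by simp
  then have x: "x \<notin> P" using Cons.prems by auto
  let ?J = "{p + a * x | p a. p \<in> P}"
  have "?J \<inter> bdy_monoid xs = {}"
  proof (rule ccontr)
    assume "\<not> ?thesis"
    then obtain p a where pa: "p \<in> P" "p + a * x \<in> bdy_monoid xs" by blast
    \<comment> \<open>The cofactor \<open>- a\<close> cancels the multiple of \<open>x\<close> and
      leaves \<open>p\<close> itself in the monoid.\<close>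
    have "x ^ 0 * ((p + a * x) + (- a) * x) \<in> bdy_monoid (x # xs)" using pa(2) by (rule bdy_monoid_Cons)
    then show False using pa Cons.prems by auto
  qed
  with ideal_set_adjoin(1)[OF P] bdy_monoid_1 bdy_monoid_mult
  obtain P' where P': "prime_set P'" "?J \<subseteq> P'" "P' \<inter> bdy_monoid xs = {}"
    by (rule exists_prime_avoiding)
  obtain Q where Q: "Q 0 = P'" "\<forall>i\<le>length xs. prime_set (Q i)" "\<forall>i<length xs. Q i \<subset> Q (Suc i)"
    using Cons.IH[OF P'(1,3)] by blast
  have "P \<subset> P'" using x ideal_set_adjoin[OF P, of x] P'(2) by blast
  then show ?case
    using Q Cons.prems(1)
    by (intro exI[of _ "case_nat P Q"]) (auto split: nat.split simp: less_Suc_eq_0_disj)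
qed

lemma prime_set_primeideal:
  assumes "prime_set (P :: 'a::idom set)"
  shows "primeideal P (ring_of_type_algebra :: 'a ring)"
proof -
  interpret cring "ring_of_type_algebra :: 'a ring" by (rule cring_from_type_algebra)
  have P: "0 \<in> P" "\<And>x y. x \<in> P \<Longrightarrow> y \<in> P \<Longrightarrow> x + y \<in> P" "\<And>x a. x \<in> P \<Longrightarrow> a * x \<in> P" "1 \<notin> P"
    "\<And>x y. x * y \<in> P \<Longrightarrow> x \<in> P \<or> y \<in> P"
    using assms by (auto simp: prime_set_def ideal_set_def)
  show ?thesis
  proof (intro primeidealI idealI)
    show "subgroup P (add_monoid (ring_of_type_algebra :: 'a ring))"
    proof (rule add.subgroupI)
      fix a assume "a \<in> P"
      then show "\<ominus>\<^bsub>ring_of_type_algebra\<^esub> a \<in> P" using P(3)[of a "- 1"] by (simp add: type_algebra_uminus)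
    qed (use P in \<open>auto simp: ring_of_type_algebra_def\<close>)
  qed (use P in \<open>auto simp: ring_of_type_algebra_def mult.commute intro: cring_axioms[unfolded ring_of_type_algebra_def] ring_axioms[unfolded ring_of_type_algebra_def]\<close>)
qed

lemma krull_dim_ge:
  fixes xs :: "'a::idom list"
  assumes "0 \<notin> bdy_monoid xs"
  shows "enat (length xs) \<le> krull_dim (ring_of_type_algebra :: 'a ring)"
proof -
  have "ideal_set {0::'a}" by (simp add: ideal_set_def)
  moreover have "{0} \<inter> bdy_monoid xs = {}" using assms by simp
  moreover note bdy_monoid_1 bdy_monoid_mult
  ultimately obtain P where "prime_set P" "{0} \<subseteq> P" "P \<inter> bdy_monoid xs = {}"
    using exists_prime_avoiding[of "{0}" "bdy_monoid xs" thesis] by blast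
  from prime_chain[OF this(1,3)] show ?thesis
    unfolding krull_dim_def by (intro Sup_upper) (blast intro: prime_set_primeideal)
qed

text \<open>Unfold \<open>y i ^ k * (f + a * y i)\<close> from the last variable backwards. The
  factor \<open>y i ^ k\<close> joins the monomial \<open>m\<close> of \<open>f\<close>, while
  \<open>a * y i ^ (k + 1)\<close> belongs to a lexicographically larger monomial because the
  exponents in \<open>m\<close> vanish at all indices up to \<open>i\<close>.\<close>

lemma bdy_monoid_lex:
  fixes y :: "nat \<Rightarrow> 'a::idom"
  assumes "g \<in> bdy_monoid (map y [i..<s])" "i \<le> s"
  shows "\<exists>m h. supp m \<subseteq> {i..<s} \<and> h \<in> modspan UNIV (mon y ` {\<nu>\<in>expos s. m < \<nu>}) \<and> g = mon y m + h"
  using assms(2,1)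
proof (induction i arbitrary: g rule: inc_induct)
  case base
  interpret subalg "UNIV :: 'a set" by unfold_locales auto
  show ?case using base by (intro exI[of _ 0]) (auto simp: modspan_0)
next
  case (step i)
  interpret subalg "UNIV :: 'a set" by unfold_locales auto
  obtain k f a where f: "g = y i ^ k * (f + a * y i)" "f \<in> bdy_monoid (map y [Suc i..<s])"
    using step.prems step.hyps by (auto simp: upt_conv_Cons)
  obtain m h where m: "supp m \<subseteq> {Suc i..<s}" "h \<in> modspan UNIV (mon y ` {\<nu>\<in>expos s. m < \<nu>})" "f = mon y m + h"
    using step.IH[OF f(2)] by blast
  let ?m = "m + sgl i k"
  let ?E = "mon y ` {\<nu>\<in>expos s. ?m < \<nu>}"
  have g: "g = mon y ?m + (y i ^ k * h + a * mon y (sgl i (Suc k)))"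
    by (simp add: f(1) m(3) mon_add algebra_simps)
  have i0: "coef m i = 0" "\<And>j. j \<le> i \<Longrightarrow> coef m j = 0" using m(1) by (auto simp: mem_supp subset_iff Suc_le_eq)
  have "?m < sgl i (Suc k)"
    by (rule lex_lessI[of _ i]) (auto simp: lookup_add lookup_single when_def i0)
  then have "mon y (sgl i (Suc k)) \<in> modspan UNIV ?E"
    using step.hyps by (intro modspan_gen imageI) (auto simp: expos_sgl)
  then have "a * mon y (sgl i (Suc k)) \<in> modspan UNIV ?E" by (rule modspan_smult[rotated]) simp
  moreover have "modspan UNIV (mon y ` {\<nu>\<in>expos s. m < \<nu>}) \<subseteq> {h. mon y (sgl i k) * h \<in> modspan UNIV ?E}"
  proof (rule modspan_subset)
    fix r e :: 'a
    assume "e \<in> mon y ` {\<nu> \<in> expos s. m < \<nu>}"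
    then obtain \<nu> where \<nu>: "e = mon y \<nu>" "\<nu> \<in> expos s" "m < \<nu>" by blast
    have "\<nu> + sgl i k \<in> expos s" "?m < \<nu> + sgl i k" using step.hyps \<nu> by (simp_all add: expos_add expos_sgl)
    then have "r * mon y (\<nu> + sgl i k) \<in> modspan UNIV ?E" by (intro modspan_base) auto
    then show "r * e \<in> {h. mon y (sgl i k) * h \<in> modspan UNIV ?E}" unfolding \<nu>(1) mon_add mem_Collect_eq
      by (simp only: mult_ac)
  qed (simp_all add: modspan_0 distrib_left modspan_add)
  then have "mon y (sgl i k) * h \<in> modspan UNIV ?E" using m(2) by blast
  ultimately have "y i ^ k * h + a * mon y (sgl i (Suc k)) \<in> modspan UNIV ?E"
    unfolding mon_sgl by (intro modspan_add)
  moreover have "supp ?m \<subseteq> {i..<s}" using m(1) step.hyps by (auto simp: supp_add_nat split: if_splits)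
  ultimately show ?case using g by blast
qed

section \<open>Matrices with lexicographically dominant diagonal\<close>

context scalar_hom begin

definition higher :: "(nat \<Rightarrow> 'a) \<Rightarrow> nat \<Rightarrow> expo \<Rightarrow> 'a set" where
  "higher y s \<mu> = ev y ` {p \<in> polys s. \<forall>\<alpha>\<in>supp p. \<mu> < \<alpha>}"

lemma higherE:
  assumes "a \<in> higher y s \<mu>"
  obtains p where "a = ev y p" "p \<in> polys s" "\<And>\<alpha>. \<alpha> \<in> supp p \<Longrightarrow> \<mu> < \<alpha>"
  using assms unfolding higher_def by blast

lemma higherI: "p \<in> polys s \<Longrightarrow> (\<And>\<alpha>. \<alpha> \<in> supp p \<Longrightarrow> \<mu> < \<alpha>) \<Longrightarrow> ev y p \<in> higher y s \<mu>"
  unfolding higher_def by blast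

lemma higher_0: "0 \<in> higher y s \<mu>"
  using higherI[of 0 s \<mu> y] by simp

lemma higher_add: "a \<in> higher y s \<mu> \<Longrightarrow> c \<in> higher y s \<mu> \<Longrightarrow> a + c \<in> higher y s \<mu>"
proof (elim higherE)
  fix p q assume a: "a = ev y p" "c = ev y q" "p \<in> polys s" "q \<in> polys s"
    "\<And>\<alpha>. \<alpha> \<in> supp p \<Longrightarrow> \<mu> < \<alpha>" "\<And>\<alpha>. \<alpha> \<in> supp q \<Longrightarrow> \<mu> < \<alpha>"
  show ?thesis unfolding a(1,2) ev_add[symmetric]
    by (rule higherI) (use a keys_add[of p q] in \<open>auto intro: polys_add\<close>)
qed

lemma higher_uminus: "a \<in> higher y s \<mu> \<Longrightarrow> - a \<in> higher y s \<mu>"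
  by (elim higherE) (auto simp: ev_uminus[symmetric] polys_uminus intro!: higherI)

lemma higher_mult_ge:
  assumes "a \<in> higher y s \<mu>" and q: "q \<in> polys s" "\<And>\<alpha>. \<alpha> \<in> supp q \<Longrightarrow> \<nu> \<le> \<alpha>"
  shows "a * ev y q \<in> higher y s (\<mu> + \<nu>)"
proof -
  obtain p where p: "a = ev y p" "p \<in> polys s" "\<And>\<alpha>. \<alpha> \<in> supp p \<Longrightarrow> \<mu> < \<alpha>" using assms(1) by (rule higherE) blast
  show ?thesis unfolding p(1) ev_mult[symmetric]
  proof (rule higherI)
    fix \<alpha> assume "\<alpha> \<in> supp (p * q)"
    then obtain \<beta> \<gamma> where "\<alpha> = \<beta> + \<gamma>" "\<beta> \<in> supp p" "\<gamma> \<in> supp q" using keys_mult[of p q] by blast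
    then show "\<mu> + \<nu> < \<alpha>" using p(3) q(2) by (auto intro: add_less_le_mono)
  qed (use p q in \<open>auto intro: polys_mult\<close>)
qed

lemma higher_mon: "a \<in> higher y s \<mu> \<Longrightarrow> \<nu> \<in> expos s \<Longrightarrow> a * mon y \<nu> \<in> higher y s (\<mu> + \<nu>)"
  using higher_mult_ge[of a y s \<mu> "sgl \<nu> 1" \<nu>] by (auto simp: polys_sgl)

lemma higher_mult: "a \<in> higher y s \<mu> \<Longrightarrow> c \<in> higher y s \<nu> \<Longrightarrow> a * c \<in> higher y s (\<mu> + \<nu>)"
  by (elim higherE[of c]) (auto intro!: higher_mult_ge less_imp_le)

text \<open>Gaussian elimination without division. A diagonal entry is \<open>mon y \<mu>\<close>
  plus higher terms, and the independence of \<open>y\<close> prevents it from vanishing. After one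
  pivot the remaining matrix has the same shape for \<open>\<mu> + \<mu>\<close>, because a product
  of two off-diagonal entries lies above that exponent.\<close>

lemma elimination:
  assumes indep: "\<And>p. p \<in> polys s \<Longrightarrow> ev y p = 0 \<Longrightarrow> p = 0"
    and "finite E" "\<mu> \<in> expos s"
    and "\<And>i. i \<in> E \<Longrightarrow> B i i - mon y \<mu> \<in> higher y s \<mu>"
    and "\<And>i j. i \<in> E \<Longrightarrow> j \<in> E \<Longrightarrow> i \<noteq> j \<Longrightarrow> B i j \<in> higher y s \<mu>"
    and "\<And>i. i \<in> E \<Longrightarrow> (\<Sum>j\<in>E. B i j * x j) = 0"
  shows "\<forall>j\<in>E. x j = (0 :: 'a)"
  using assms(2-)
proof (induction E arbitrary: B \<mu> rule: finite_induct)
  case (insert k E)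
  have nz: "B k k \<noteq> 0"
  proof
    assume "B k k = 0"
    then have "- mon y \<mu> \<in> higher y s \<mu>" using insert.prems(2)[of k] by simp
    then obtain p where p: "- mon y \<mu> = ev y p" "p \<in> polys s" "\<And>\<alpha>. \<alpha> \<in> supp p \<Longrightarrow> \<mu> < \<alpha>" by (rule higherE) blast
    have "ev y (sgl \<mu> 1 + p) = 0" by (simp add: ev_add p(1)[symmetric])
    then have "sgl \<mu> 1 + p = 0" using indep[of "sgl \<mu> 1 + p"] p insert.prems(1) by (simp add: polys_add polys_sgl)
    then have "coef (sgl \<mu> 1 + p) \<mu> = 0" by simp
    moreover have "\<mu> \<notin> supp p" using p(3) by blast
    ultimately show False by (simp add: lookup_add mem_supp)
  qed
  define B' where "B' i j = B k k * B i j - B i k * B k j" for i j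
  have "\<forall>j\<in>E. x j = 0"
  proof (rule insert.IH[where B=B' and \<mu>="\<mu> + \<mu>"])
    show "\<mu> + \<mu> \<in> expos s" using insert.prems(1) by (simp add: expos_add)
    have kk: "B k k - mon y \<mu> \<in> higher y s \<mu>" using insert.prems by blast
    fix i assume i: "i \<in> E"
    have "i \<noteq> k" using i insert.hyps by blast
    have ik: "B i k \<in> higher y s \<mu>" and ki: "B k i \<in> higher y s \<mu>" and ii: "B i i - mon y \<mu> \<in> higher y s \<mu>"
      using insert.prems(2)[of i] insert.prems(3)[of i k] insert.prems(3)[of k i] i \<open>i \<noteq> k\<close> by auto
    have "B' i i - mon y (\<mu> + \<mu>) = (B k k - mon y \<mu>) * (B i i - mon y \<mu>) + (B k k - mon y \<mu>) * mon y \<mu>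
       + (B i i - mon y \<mu>) * mon y \<mu> + - (B i k * B k i)"
      by (simp add: B'_def mon_add algebra_simps)
    then show "B' i i - mon y (\<mu> + \<mu>) \<in> higher y s (\<mu> + \<mu>)"
      by (simp only:) (intro higher_add higher_uminus higher_mult higher_mon ii kk ik ki insert.prems(1))
    show "B' i j \<in> higher y s (\<mu> + \<mu>)" if j: "j \<in> E" "i \<noteq> j" for j
    proof -
      have ij: "B i j \<in> higher y s \<mu>" and kj: "B k j \<in> higher y s \<mu>"
        using i j insert.prems(3)[of i j] insert.prems(3)[of k j] insert.hyps by auto
      have "B' i j = (B k k - mon y \<mu>) * B i j + B i j * mon y \<mu> + - (B i k * B k j)"
        by (simp add: B'_def algebra_simps)
      then show ?thesis
        by (simp only:) (intro higher_add higher_uminus higher_mult higher_mon ij kk ik kj insert.prems(1))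
    qed
    have e: "(\<Sum>j\<in>E. B l j * x j) = - (B l k * x k)" if "l \<in> insert k E" for l
      using insert.prems(4)[OF that] insert.hyps by (simp add: add_eq_0_iff)
    have "(\<Sum>j\<in>E. B' i j * x j) = B k k * (\<Sum>j\<in>E. B i j * x j) - B i k * (\<Sum>j\<in>E. B k j * x j)"
      by (simp add: B'_def sum_distrib_left left_diff_distrib sum_subtractf mult.assoc)
    also have "\<dots> = 0" using e[of i] e[of k] i by simp
    finally show "(\<Sum>j\<in>E. B' i j * x j) = 0" .
  qed
  moreover from this have "B k k * x k = 0" using insert.prems(4)[of k] insert.hyps by simp
  ultimately show ?case using nz by simp
qed simp

text \<open>If \<open>0\<close> were in the boundary monoid of \<open>y\<close>, a monomial \<open>y\<^sup>m\<close> would be an \<open>A\<close>-linear combination of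
  lexicographically larger monomials. Multiplication by it on a finite generating set of \<open>A\<close> over
  \<open>k[y]\<close> is then a matrix whose diagonal dominates for the lexicographic order.\<close>

lemma krull_dim_ge_noether:
  assumes fin: "fin_over y s" and indep: "\<And>p. p \<in> polys s \<Longrightarrow> ev y p = 0 \<Longrightarrow> p = 0"
  shows "enat s \<le> krull_dim (ring_of_type_algebra :: 'a ring)"
proof -
  have "0 \<notin> bdy_monoid (map y [0..<s])"
  proof
    assume "0 \<in> bdy_monoid (map y [0..<s])"
    then obtain m h where m: "supp m \<subseteq> {0..<s}" "h \<in> modspan UNIV (mon y ` {\<nu>\<in>expos s. m < \<nu>})" "mon y m + h = 0"
      using bdy_monoid_lex[of 0 y 0 s] by force
    have ms: "m \<in> expos s" using m(1) by (auto simp: expos_def)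
    obtain E where E: "finite E" "modspan (subal y s) E = UNIV" using fin by (auto simp: fin_over_def)
    interpret H: coefs "higher y s m" by unfold_locales (auto intro: higher_0 higher_add)
    interpret R: subalg "subal y s" by (rule subalg_subal)
    have "h * e \<in> modspan (higher y s m) E" for e
    proof -
      have "modspan UNIV (mon y ` {\<nu>\<in>expos s. m < \<nu>}) \<subseteq> {h. h * e \<in> modspan (higher y s m) E}"
      proof (rule R.modspan_subset)
        fix a u assume "u \<in> mon y ` {\<nu>\<in>expos s. m < \<nu>}"
        then obtain \<nu> where \<nu>: "u = mon y \<nu>" "\<nu> \<in> expos s" "m < \<nu>" by auto
        have "u * (a * e) \<in> modspan (higher y s m) E"
        proof (rule H.modspan_scale)
          show "a * e \<in> modspan (subal y s) E" using E by simp
          fix r assume "r \<in> subal y s"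
          then obtain p where p: "r = ev y p" "p \<in> polys s" by (auto simp: subal_def)
          have "u \<in> higher y s m" using \<nu> higherI[of "sgl \<nu> 1" s m y] by (simp add: polys_sgl)
          from higher_mult_ge[OF this p(2), of 0] show "u * r \<in> higher y s m"
            using expo_le_add[of 0] by (simp add: p(1))
        qed
        then show "a * u \<in> {h. h * e \<in> modspan (higher y s m) E}" by (simp add: mult_ac)
      qed (auto simp: H.modspan_0 ring_distribs intro: H.modspan_add)
      then show ?thesis using m(2) by auto
    qed
    then have "\<exists>c. (\<forall>e'. c e' \<in> higher y s m) \<and> h * e = (\<Sum>e'\<in>E. c e' * e')" for e
      using H.modspan_finite[of "h * e" E] E(1) by metis
    then obtain c where c: "\<And>e e'. c e e' \<in> higher y s m" "\<And>e. h * e = (\<Sum>e'\<in>E. c e e' * e')" by metis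
    \<comment> \<open>The matrix of multiplication by \<open>mon y m + h\<close> on the generators
      \<open>E\<close>. As this element is 0, the vector of generators lies in the kernel of the
      matrix.\<close>
    define B where "B e e' = (if e = e' then mon y m else 0) + c e e'" for e e'
    have "\<forall>e\<in>E. e = 0"
    proof (rule elimination[OF indep E(1) ms, where B=B and x="\<lambda>e. e"])
      fix e assume "e \<in> E"
      have "(\<Sum>e'\<in>E. B e e' * e') = (\<Sum>e'\<in>E. (if e = e' then mon y m * e' else 0)) + (\<Sum>e'\<in>E. c e e' * e')"
        by (simp add: B_def ring_distribs sum.distrib if_distrib[of "\<lambda>u. u * _"] cong: if_cong)
      also have "\<dots> = mon y m * e + h * e" using \<open>e \<in> E\<close> E(1) by (simp add: c(2))
      also have "\<dots> = 0" by (simp only: distrib_right[symmetric] m(3) mult_zero_left)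
      finally show "(\<Sum>e'\<in>E. B e e' * e') = 0" .
    qed (auto simp: B_def c)
    then have z: "(\<Sum>e\<in>E. r e * e) = 0" for r by (intro sum.neutral) simp
    have "(1::'a) \<in> modspan (subal y s) E" using E by simp
    then obtain r where "1 = (\<Sum>e\<in>E. r e * e)" using R.modspan_finite[OF _ E(1)] by metis
    then show False unfolding z by simp
  qed
  from krull_dim_ge[OF this] show ?thesis by simp
qed

end

section \<open>Algebraically independent families\<close>

definition expo_box :: "nat set \<Rightarrow> nat \<Rightarrow> expo set" where
  "expo_box D N = {\<alpha>. supp \<alpha> \<subseteq> D \<and> (\<forall>i\<in>D. coef \<alpha> i < N)}"

lemma card_expo_box:
  assumes "finite D"
  shows "finite (expo_box D N)" "card (expo_box D N) = N ^ card D"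
proof -
  have "bij_betw (\<lambda>\<alpha>. restrict (coef \<alpha>) D) (expo_box D N) (D \<rightarrow>\<^sub>E {..<N})"
  proof (rule bij_betwI')
    fix \<alpha> \<beta> assume ab: "\<alpha> \<in> expo_box D N" "\<beta> \<in> expo_box D N"
    show "(restrict (coef \<alpha>) D = restrict (coef \<beta>) D) = (\<alpha> = \<beta>)"
    proof
      assume eq: "restrict (coef \<alpha>) D = restrict (coef \<beta>) D"
      show "\<alpha> = \<beta>"
      proof (rule poly_mapping_eqI)
        fix i
        show "coef \<alpha> i = coef \<beta> i"
        proof (cases "i \<in> D")
          case False
          then have "i \<notin> supp \<alpha>" "i \<notin> supp \<beta>" using ab by (auto simp: expo_box_def)
          then show ?thesis by (simp add: mem_supp)
        qed (use fun_cong[OF eq, of i] in simp)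
      qed
    qed simp
  next
    fix \<alpha> assume "\<alpha> \<in> expo_box D N"
    then show "restrict (coef \<alpha>) D \<in> D \<rightarrow>\<^sub>E {..<N}" by (auto simp: expo_box_def)
  next
    fix f assume f: "f \<in> D \<rightarrow>\<^sub>E {..<N}"
    define \<alpha> where "\<alpha> = (\<Sum>i\<in>D. sgl i (f i))"
    have c: "coef \<alpha> i = (if i \<in> D then f i else 0)" for i
      using assms by (simp add: \<alpha>_def lookup_sum lookup_single when_def)
    have "supp \<alpha> \<subseteq> D" by (auto simp: mem_supp c split: if_splits)
    moreover have "coef \<alpha> i < N" if "i \<in> D" for i using f that by (auto simp: c)
    ultimately have "\<alpha> \<in> expo_box D N" unfolding expo_box_def by blast
    moreover have "f = restrict (coef \<alpha>) D"
    proof (rule ext)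
      fix i show "f i = restrict (coef \<alpha>) D i" using f by (cases "i \<in> D") (auto simp: c PiE_arb[OF f])
    qed
    ultimately show "\<exists>\<alpha>\<in>expo_box D N. f = restrict (coef \<alpha>) D" by blast
  qed
  note bij = this
  have "finite (D \<rightarrow>\<^sub>E {..<N})" using assms by (intro finite_PiE) auto
  then show "finite (expo_box D N)" using bij_betw_finite[OF bij] by blast
  show "card (expo_box D N) = N ^ card D"
    unfolding bij_betw_same_card[OF bij] using assms by (simp add: card_PiE)
qed

section \<open>Growth of monomials in a finite extension\<close>

context scalar_hom begin

sublocale vs: vector_space "\<lambda>c x. \<phi> c * x"
  by unfold_locales (simp_all add: phi_add phi_mult algebra_simps)

text \<open>Filter the ring by the exponents of \<open>y\<close> needed to write an element. The
  monomials in \<open>b\<close> with exponents below \<open>N\<close> are \<open>N ^ card D\<close>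
  independent elements whose filtration index is at most linear in \<open>N\<close>, and the space
  of that index has dimension at most a constant times \<open>N ^ s\<close>.\<close>

lemma algebraic_independence_bound:
  assumes fin: "fin_over y s" and D: "finite D"
    and indep: "\<And>p. supp p \<subseteq> {\<alpha>. supp \<alpha> \<subseteq> D} \<Longrightarrow> ev b p = 0 \<Longrightarrow> p = 0"
  shows "card D \<le> s"
proof -
  obtain E where E: "finite E" "modspan (subal y s) E = UNIV" using fin by (auto simp: fin_over_def)
  interpret R: subalg "subal y s" by (rule subalg_subal)
  define T where "T M = (\<lambda>(\<beta>, e). mon y \<beta> * e) ` (expo_box {..<s} M \<times> E)" for M
  define W where "W M = vs.span (T M)" for M
  have T: "finite (T M)" "card (T M) \<le> M ^ s * card E" for M
  proof -
    have "finite (expo_box {..<s} M \<times> E)" "card (expo_box {..<s} M \<times> E) = M ^ s * card E"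
      using card_expo_box[of "{..<s}" M] E by (auto simp: card_cartesian_product)
    then show "finite (T M)" "card (T M) \<le> M ^ s * card E"
      unfolding T_def using card_image_le by (blast, metis)
  qed
  have W_mono: "W M \<subseteq> W M'" if "M \<le> M'" for M M'
  proof -
    have "expo_box {..<s} M \<subseteq> expo_box {..<s} M'" using that by (auto simp: expo_box_def intro: less_le_trans)
    then show ?thesis unfolding W_def T_def by (intro vs.span_mono image_mono Sigma_mono) auto
  qed
  have W_bound: "\<exists>M. x \<in> W M" for x
  proof -
    obtain c where c: "\<And>e. c e \<in> subal y s" "x = (\<Sum>e\<in>E. c e * e)"
      using R.modspan_finite[of x E] E by auto
    have "\<exists>p. p \<in> polys s \<and> c e = ev y p" for e using c(1)[of e] by (auto simp: subal_def)
    then obtain p where p: "\<And>e. p e \<in> polys s" "\<And>e. c e = ev y (p e)" by metis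
    define M where "M = Suc (Max (insert 0 (\<Union>e\<in>E. \<Union>\<alpha>\<in>supp (p e). coef \<alpha> ` {..<s})))"
    have M: "coef \<alpha> i < M" if "e \<in> E" "\<alpha> \<in> supp (p e)" "i < s" for e \<alpha> i
      unfolding M_def less_Suc_eq_le by (rule Max_ge) (use that E(1) in auto)
    have "ev y (p e) * e \<in> W M" if e: "e \<in> E" for e
    proof -
      have "ev y (p e) * e = (\<Sum>\<alpha>\<in>supp (p e). \<phi> (coef (p e) \<alpha>) * (mon y \<alpha> * e))"
        by (simp add: ev_def sum_distrib_right mult.assoc)
      moreover have "mon y \<alpha> * e \<in> T M" if "\<alpha> \<in> supp (p e)" for \<alpha>
        unfolding T_def using that e M[OF e that] polysD[OF p(1) that]
        by (intro image_eqI[of _ _ "(\<alpha>, e)"]) (auto simp: expo_box_def expos_def)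
      ultimately show ?thesis
        unfolding W_def by (auto intro!: vs.span_sum vs.span_scale intro: vs.span_base)
    qed
    then have "x \<in> W M" unfolding c(2) p(2) W_def by (intro vs.span_sum) auto
    then show ?thesis by blast
  qed
  \<comment> \<open>The filtration index of \<open>x\<close>.\<close>
  define m where "m x = (LEAST M. x \<in> W M)" for x
  have m: "x \<in> W M" if "m x \<le> M" for x M
    using W_mono[OF that] LeastI_ex[OF W_bound[of x]] by (auto simp: m_def)
  \<comment> \<open>Multiplication by one \<open>b i\<close> raises the filtration index by at most
    this constant; it suffices to look at the finitely many products \<open>b i * e\<close>.\<close>
  define c0 where "c0 = Max (insert 0 ((\<lambda>(i, e). m (b i * e)) ` (D \<times> E)))"
  have c0: "b i * e \<in> W c0" if "i \<in> D" "e \<in> E" for i e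
    by (rule m) (unfold c0_def, rule Max_ge, use that D E in auto)
  have mon_W: "mon y \<beta> * x \<in> W (M + c0)" if "\<beta> \<in> expo_box {..<s} M" "x \<in> W c0" for \<beta> x M
    using that(2) unfolding W_def
  proof (induction rule: vs.span_induct_alt)
    case base then show ?case by (simp add: vs.span_zero)
  next
    case (step c x z)
    obtain \<gamma> e where g: "x = mon y \<gamma> * e" "\<gamma> \<in> expo_box {..<s} c0" "e \<in> E"
      using step(1) unfolding T_def by auto
    have "\<beta> + \<gamma> \<in> expo_box {..<s} (M + c0)"
      using that(1) g(2) by (auto simp: expo_box_def supp_add_nat lookup_add add_strict_mono)
    then have "mon y (\<beta> + \<gamma>) * e \<in> T (M + c0)" unfolding T_def using g(3) by force
    then have "\<phi> c * (mon y (\<beta> + \<gamma>) * e) \<in> vs.span (T (M + c0))"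
      by (intro vs.span_scale vs.span_base)
    then have "\<phi> c * (mon y (\<beta> + \<gamma>) * e) + mon y \<beta> * z \<in> vs.span (T (M + c0))"
      using step(2) by (rule vs.span_add)
    then show ?case by (simp add: g(1) mon_add algebra_simps)
  qed
  have b_W: "x * b i \<in> W (M + c0)" if "x \<in> W M" "i \<in> D" for x i M
    using that(1) unfolding W_def
  proof (induction rule: vs.span_induct_alt)
    case base then show ?case by (simp add: vs.span_zero)
  next
    case (step c x z)
    obtain \<beta> e where g: "x = mon y \<beta> * e" "\<beta> \<in> expo_box {..<s} M" "e \<in> E"
      using step(1) unfolding T_def by auto
    have "mon y \<beta> * (b i * e) \<in> vs.span (T (M + c0))"
      using mon_W[OF g(2) c0[OF that(2) g(3)]] unfolding W_def .
    then have "\<phi> c * (mon y \<beta> * (b i * e)) + z * b i \<in> vs.span (T (M + c0))"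
      using step(2) by (intro vs.span_add vs.span_scale)
    then show ?case by (simp add: g(1) algebra_simps)
  qed
  define tot where "tot \<alpha> = (\<Sum>i\<in>D. coef \<alpha> i)" for \<alpha> :: expo
  have mon_b: "mon b \<alpha> \<in> W (m 1 + c0 * tot \<alpha>)" if "supp \<alpha> \<subseteq> D" for \<alpha>
    using that
  proof (induction rule: expo_induct)
    case zero show ?case using m[of 1 "m 1"] by (simp add: tot_def)
  next
    case (step \<alpha> i)
    have "tot (\<alpha> + sgl i 1) = tot \<alpha> + 1"
      using D step(2) by (simp add: tot_def lookup_add sum.distrib lookup_single when_def)
    then show ?case using b_W[OF step] by (simp add: mon_add algebra_simps)
  qed
  \<comment> \<open>A monomial with exponents below \<open>N\<close> has index at most
    \<open>m 1 + c0 * (card D * N)\<close>, which is at most \<open>c * N\<close> for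
    \<open>N \<ge> 1\<close>.\<close>
  define c where "c = m 1 + c0 * card D"
  have key: "N ^ card D \<le> (c * N) ^ s * card E" if "N \<ge> 1" for N
  proof -
    let ?B = "expo_box D N"
    have sub: "\<alpha> \<in> ?B \<Longrightarrow> supp \<alpha> \<subseteq> D" for \<alpha> by (simp add: expo_box_def)
    have zero: "u \<alpha> = 0" if F: "F \<subseteq> ?B" "finite F" "(\<Sum>\<alpha>\<in>F. \<phi> (u \<alpha>) * mon b \<alpha>) = 0" "\<alpha> \<in> F" for F u \<alpha>
    proof -
      define p where "p = (\<Sum>\<alpha>\<in>F. sgl \<alpha> (u \<alpha>))"
      have c: "coef p \<beta> = (if \<beta> \<in> F then u \<beta> else 0)" for \<beta>
        using F(2) by (simp add: p_def lookup_sum lookup_single when_def)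
      have "supp p \<subseteq> F" by (rule subsetI) (simp add: mem_supp c split: if_splits)
      then have "supp p \<subseteq> {\<alpha>. supp \<alpha> \<subseteq> D}" using F(1) sub by blast
      moreover have "ev b p = 0" using F(3) by (simp add: p_def ev_sum)
      ultimately have "p = 0" by (rule indep)
      then show ?thesis using c[of \<alpha>] F(4) by simp
    qed
    have inj: "inj_on (mon b) ?B"
    proof (rule inj_onI, rule ccontr)
      fix \<alpha> \<beta> assume ab: "\<alpha> \<in> ?B" "\<beta> \<in> ?B" "mon b \<alpha> = mon b \<beta>" "\<alpha> \<noteq> \<beta>"
      have "(1::'k) = 0"
        using zero[of "{\<alpha>, \<beta>}" "\<lambda>\<gamma>. if \<gamma> = \<alpha> then 1 else - 1" \<alpha>] ab by (auto simp: phi_uminus)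
      then show False by simp
    qed
    have "vs.independent (mon b ` ?B)"
      unfolding vs.dependent_explicit
    proof (rule notI, elim exE conjE bexE)
      fix t u v assume t: "finite t" "t \<subseteq> mon b ` ?B" "(\<Sum>v\<in>t. \<phi> (u v) * v) = 0" "v \<in> t" "u v \<noteq> 0"
      define F where "F = {\<alpha>\<in>?B. mon b \<alpha> \<in> t}"
      have Ft: "t = mon b ` F" using t(2) by (auto simp: F_def)
      have injF: "inj_on (mon b) F" using inj by (rule inj_on_subset) (auto simp: F_def)
      have finF: "finite F" unfolding F_def using card_expo_box(1)[OF D] by simp
      have "(\<Sum>\<alpha>\<in>F. \<phi> (u (mon b \<alpha>)) * mon b \<alpha>) = 0"
        using t(3) unfolding Ft sum.reindex[OF injF] by (simp add: comp_def)
      then have "u (mon b \<alpha>) = 0" if "\<alpha> \<in> F" for \<alpha>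
        using zero[of F "\<lambda>\<alpha>. u (mon b \<alpha>)" \<alpha>] finF that by (auto simp: F_def)
      then show False using t(4,5) Ft by auto
    qed
    moreover have "mon b ` ?B \<subseteq> vs.span (T (c * N))"
    proof (rule image_subsetI)
      fix \<alpha> assume a: "\<alpha> \<in> ?B"
      have "tot \<alpha> \<le> card D * N"
        unfolding tot_def using a sum_bounded_above[of D "coef \<alpha>" N] by (auto simp: expo_box_def less_imp_le)
      then have "m 1 + c0 * tot \<alpha> \<le> m 1 * N + c0 * (card D * N)"
        using that by (intro add_mono mult_le_mono) auto
      then have "m 1 + c0 * tot \<alpha> \<le> c * N" by (simp add: c_def algebra_simps)
      then show "mon b \<alpha> \<in> vs.span (T (c * N))"
        using mon_b[OF sub[OF a]] W_mono[of "m 1 + c0 * tot \<alpha>" "c * N"] unfolding W_def by blast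
    qed
    ultimately have "card (mon b ` ?B) \<le> card (T (c * N))"
      using vs.independent_span_bound[OF T(1)] by blast
    also have "\<dots> \<le> (c * N) ^ s * card E" by (rule T(2))
    finally show ?thesis by (simp add: card_image[OF inj] card_expo_box[OF D])
  qed
  show ?thesis
  proof (rule ccontr)
    assume "\<not> ?thesis"
    then have r: "Suc s \<le> card D" by simp
    \<comment> \<open>One more than the constant in front of \<open>N ^ s\<close> in
      \<open>key\<close>, so that \<open>N ^ (s + 1)\<close> already exceeds the bound.\<close>
    define N where "N = c ^ s * card E + 1"
    have "N * N ^ s \<le> N ^ card D" using power_increasing[OF r, of N] by (simp add: N_def)
    also have "\<dots> \<le> (c * N) ^ s * card E" by (rule key) (simp add: N_def)
    also have "\<dots> = (c ^ s * card E) * N ^ s" by (simp add: power_mult_distrib)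
    also have "\<dots> < N * N ^ s" by (intro mult_strict_right_mono) (simp_all add: N_def)
    finally show False by simp
  qed
qed

lemma subal_generated:
  assumes "alg_generates (ring_of_type_algebra :: 'a ring) \<phi> (b ` {..<n})"
  shows "subal b n = UNIV"
proof -
  interpret S: subalg "subal b n" by (rule subalg_subal)
  have "x \<in> subal b n" if "x \<in> generate_ring (ring_of_type_algebra :: 'a ring) (range \<phi> \<union> b ` {..<n})" for x
    using that
  proof (induction rule: generate_ring.induct)
    case (a_inv h)
    then show ?case using S.mult[OF subal_phi[of "- 1" b n] a_inv(2)] by (simp add: phi_uminus type_algebra_uminus)
  qed (auto simp: ring_of_type_algebra_def intro: S.one S.add S.mult subal_phi subal_var)
  then show ?thesis using assms by (auto simp: alg_generates_def ring_of_type_algebra_def)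
qed

text \<open>The number of variables of a Noether normalization lies between the two sides.\<close>

lemma card_le_krull_dim:
  assumes "alg_generates (ring_of_type_algebra :: 'a ring) \<phi> (b ` {..<n})" and D: "finite D"
    and indep: "\<And>p. supp p \<subseteq> {\<alpha>. supp \<alpha> \<subseteq> D} \<Longrightarrow> ev b p = 0 \<Longrightarrow> p = 0"
  shows "enat (card D) \<le> krull_dim (ring_of_type_algebra :: 'a ring)"
proof -
  interpret S: subalg "subal b n" by (rule subalg_subal)
  have "x \<in> modspan (subal b n) {1}" for x
    using S.modspan_base[of x 1 "{1}"] subal_generated[OF assms(1)] by simp
  then have "fin_over b n" unfolding fin_over_def by (intro exI[of _ "{1}"]) auto
  then obtain y s where y: "fin_over y s" "\<And>p. p \<in> polys s \<Longrightarrow> ev y p = 0 \<Longrightarrow> p = 0"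
    by (rule noether_normalization) blast
  have "card D \<le> s" using y(1) D indep by (rule algebraic_independence_bound)
  then have "enat (card D) \<le> enat s" by simp
  also have "\<dots> \<le> krull_dim (ring_of_type_algebra :: 'a ring)" using y by (rule krull_dim_ge_noether)
  finally show ?thesis .
qed

end

section \<open>Initial ideals\<close>

lemma carrier_mpoly_ring [simp]: "carrier (mpoly_ring n :: 'k::field mpoly ring) = polys n"
  by (auto simp: mpoly_ring_def polys_def expos_def)
lemma mpoly_ring_simps [simp]:
  "monoid.mult (mpoly_ring n :: 'k::field mpoly ring) = (*)"
  "monoid.one (mpoly_ring n :: 'k::field mpoly ring) = 1"
  "ring.zero (mpoly_ring n :: 'k::field mpoly ring) = 0"
  "ring.add (mpoly_ring n :: 'k::field mpoly ring) = (+)"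
  by (auto simp: mpoly_ring_def ring_of_type_algebra_def fun_eq_iff)

lemma cring_mpoly_ring: "cring (mpoly_ring n :: 'k::field mpoly ring)"
proof (rule cringI)
  show "abelian_group (mpoly_ring n :: 'k mpoly ring)"
  proof (rule abelian_groupI)
    fix p :: "'k mpoly" assume "p \<in> carrier (mpoly_ring n)"
    then show "\<exists>q\<in>carrier (mpoly_ring n). q \<oplus>\<^bsub>mpoly_ring n\<^esub> p = \<zero>\<^bsub>mpoly_ring n\<^esub>"
      by (intro bexI[of _ "- p"]) (auto simp: polys_uminus)
  qed (auto intro: polys_add simp: add_ac)
  show "Group.comm_monoid (mpoly_ring n :: 'k mpoly ring)"
    by (rule Group.comm_monoidI) (auto intro: polys_mult simp: mult_ac)
qed (auto simp: distrib_right)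

lemma mpoly_ring_uminus:
  assumes "p \<in> polys n" shows "\<ominus>\<^bsub>mpoly_ring n\<^esub> p = - (p :: 'k::field mpoly)"
proof -
  interpret cring "mpoly_ring n :: 'k mpoly ring" by (rule cring_mpoly_ring)
  show ?thesis by (rule minus_equality) (use assms in \<open>auto simp: polys_uminus\<close>)
qed

lemma mpoly_idealI:
  assumes "K \<subseteq> polys n" "0 \<in> K" "\<And>p q. p \<in> K \<Longrightarrow> q \<in> K \<Longrightarrow> p + q \<in> K"
    and "\<And>p q. p \<in> K \<Longrightarrow> q \<in> polys n \<Longrightarrow> q * p \<in> (K :: 'k::field mpoly set)"
  shows "ideal K (mpoly_ring n)"
proof -
  interpret cring "mpoly_ring n :: 'k mpoly ring" by (rule cring_mpoly_ring)
  show ?thesis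
  proof (rule idealI)
    show "subgroup K (add_monoid (mpoly_ring n))"
    proof (rule add.subgroupI)
      fix a assume a: "a \<in> K"
      have "- 1 * a \<in> K" using assms(4)[OF a, of "- 1"] by (simp add: polys_uminus)
      then show "\<ominus>\<^bsub>mpoly_ring n\<^esub> a \<in> K" using a assms(1) by (simp add: mpoly_ring_uminus subset_iff)
    qed (use assms in auto)
  qed (use assms in \<open>auto simp: mult.commute ring_axioms\<close>)
qed

lemma mpoly_idealD:
  assumes "ideal (K :: 'k::field mpoly set) (mpoly_ring n)"
  shows "K \<subseteq> polys n" "0 \<in> K" "\<And>p q. p \<in> K \<Longrightarrow> q \<in> K \<Longrightarrow> p + q \<in> K"
    "\<And>p q. p \<in> K \<Longrightarrow> q \<in> polys n \<Longrightarrow> q * p \<in> K" "\<And>p. p \<in> K \<Longrightarrow> - p \<in> K"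
proof -
  interpret ideal K "mpoly_ring n" by fact
  show s: "K \<subseteq> polys n" using a_subset by simp
  show "0 \<in> K" using additive_subgroup.zero_closed[OF additive_subgroup_axioms] by simp
  show "p + q \<in> K" if "p \<in> K" "q \<in> K" for p q using additive_subgroup.a_closed[OF additive_subgroup_axioms that] by simp
  show m: "q * p \<in> K" if "p \<in> K" "q \<in> polys n" for p q using I_l_closed[of p q] that by simp
  show "- p \<in> K" if "p \<in> K" for p using m[OF that, of "- 1"] by (simp add: polys_uminus)
qed

lemma mpoly_ideal_sum:
  assumes "ideal (K :: 'k::field mpoly set) (mpoly_ring n)" "\<And>x. x \<in> V \<Longrightarrow> f x \<in> K"
  shows "sum f V \<in> K"
  using assms(2) mpoly_idealD(2,3)[OF assms(1)] by (induction V rule: infinite_finite_induct) auto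

lemma weight_superset:
  "finite U \<Longrightarrow> supp \<alpha> \<subseteq> U \<Longrightarrow> weight u \<alpha> = (\<Sum>i\<in>U. coef u i * of_nat (coef \<alpha> i))"
  unfolding weight_def by (rule sum.mono_neutral_left) (auto simp: mem_supp)

lemma weight_add: "weight u (\<alpha> + \<beta>) = weight u \<alpha> + weight u \<beta>"
proof -
  have "weight u (\<alpha> + \<beta>) = (\<Sum>i\<in>supp \<alpha> \<union> supp \<beta>. coef u i * of_nat (coef (\<alpha> + \<beta>) i))"
    by (rule weight_superset) (auto simp: supp_add_nat)
  then show ?thesis
    by (simp add: lookup_add algebra_simps sum.distrib weight_superset[of "supp \<alpha> \<union> supp \<beta>"])
qed

lemma weight_0 [simp]: "weight u 0 = 0" by (simp add: weight_def)

lemma res_mult_sgl: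
  assumes "\<And>\<alpha>. P (\<beta> + \<alpha>) \<longleftrightarrow> Q \<alpha>"
  shows "res P (sgl \<beta> c * p) = sgl \<beta> c * res Q (p :: 'k::field mpoly)"
proof (rule poly_mapping_eqI)
  fix \<gamma>
  show "coef (res P (sgl \<beta> c * p)) \<gamma> = coef (sgl \<beta> c * res Q p) \<gamma>"
  proof (cases "\<exists>\<alpha>. \<gamma> = \<beta> + \<alpha>")
    case True
    then obtain \<alpha> where "\<gamma> = \<beta> + \<alpha>" by blast
    then show ?thesis using assms by (simp add: coef_res coef_mult_sgl when_def)
  next
    case False
    then have "\<gamma> \<notin> supp (sgl \<beta> c * p)" "\<gamma> \<notin> supp (sgl \<beta> c * res Q p)"
      using supp_mult_sgl[of \<beta> c p] supp_mult_sgl[of \<beta> c "res Q p"] by blast+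
    then show ?thesis by (simp add: coef_res mem_supp when_def)
  qed
qed

lemma init_form_res: "init_form u p = res (\<lambda>\<alpha>. \<forall>\<beta>\<in>supp p. weight u \<alpha> \<le> weight u \<beta>) p"
proof (rule poly_mapping_eqI)
  fix \<alpha>
  have "finite {\<alpha> \<in> supp p. \<forall>\<beta>\<in>supp p. weight u \<alpha> \<le> weight u \<beta>}" by simp
  then show "coef (init_form u p) \<alpha> = coef (res (\<lambda>\<alpha>. \<forall>\<beta>\<in>supp p. weight u \<alpha> \<le> weight u \<beta>) p) \<alpha>"
    unfolding init_form_def lookup_sum lookup_single when_def coef_res
    by (subst sum.delta) (auto simp: mem_supp)
qed

abbreviation level :: "ratvec \<Rightarrow> rat \<Rightarrow> 'k::field mpoly \<Rightarrow> 'k mpoly" where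
  "level u a \<equiv> res (\<lambda>\<alpha>. weight u \<alpha> = a)"

text \<open>For nonzero \<open>h\<close> homogeneous of weight \<open>a\<close> this says that
  \<open>h\<close> is the initial form of a member of \<open>I\<close>. In contrast to being an
  initial form, the condition is stable under addition.\<close>

definition level_lift :: "ratvec \<Rightarrow> 'k::field mpoly set \<Rightarrow> rat \<Rightarrow> 'k mpoly \<Rightarrow> bool" where
  "level_lift u I a h \<longleftrightarrow> (\<exists>g\<in>I. \<forall>\<alpha>\<in>supp (h - g). a < weight u \<alpha>)"

lemma level_lift_add:
  assumes I: "ideal (I :: 'k::field mpoly set) (mpoly_ring n)"
    and "level_lift u I a h" "level_lift u I a h'" shows "level_lift u I a (h + h')"
proof -
  obtain g g' where g: "g \<in> I" "\<forall>\<alpha>\<in>supp (h - g). a < weight u \<alpha>" "g' \<in> I" "\<forall>\<alpha>\<in>supp (h' - g'). a < weight u \<alpha>"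
    using assms by (auto simp: level_lift_def)
  have "supp (h + h' - (g + g')) \<subseteq> supp (h - g) \<union> supp (h' - g')"
    using keys_add[of "h - g" "h' - g'"] by (simp add: algebra_simps)
  then show ?thesis unfolding level_lift_def
    by (intro bexI[of _ "g + g'"]) (use g mpoly_idealD[OF I] in auto)
qed

lemma level_lift_sgl:
  assumes I: "ideal (I :: 'k::field mpoly set) (mpoly_ring n)"
    and h: "level_lift u I a h" and \<beta>: "\<beta> \<in> expos n" shows "level_lift u I (a + weight u \<beta>) (sgl \<beta> c * h)"
proof -
  obtain g where g: "g \<in> I" "\<forall>\<alpha>\<in>supp (h - g). a < weight u \<alpha>"
    using h by (auto simp: level_lift_def)
  have eq: "sgl \<beta> c * h - sgl \<beta> c * g = sgl \<beta> c * (h - g)" by (simp add: right_diff_distrib)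
  have "\<forall>\<alpha>\<in>supp (sgl \<beta> c * h - sgl \<beta> c * g). a + weight u \<beta> < weight u \<alpha>"
    unfolding eq using supp_mult_sgl[of \<beta> c "h - g"] g(2) by (fastforce simp: weight_add)
  moreover have "sgl \<beta> c * g \<in> I" using mpoly_idealD(4)[OF I g(1)] polys_sgl[OF \<beta>] by blast
  ultimately show ?thesis unfolding level_lift_def by blast
qed

text \<open>Lifts can be added and multiplied by terms, so the right side is an ideal; conversely, a
  nonzero component that lifts is itself an initial form. Membership is thus tested weight by
  weight, and homogeneity of the initial ideal becomes visible.\<close>

lemma init_ideal_char:
  assumes I: "ideal (I :: 'k::field mpoly set) (mpoly_ring n)"
  shows "init_ideal n u I = {h \<in> polys n. \<forall>a. level_lift u I a (level u a h)}" (is "_ = ?K")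
proof
  interpret R: cring "mpoly_ring n :: 'k mpoly ring" by (rule cring_mpoly_ring)
  have I0: "level_lift u I a 0" for a
    unfolding level_lift_def by (intro bexI[of _ 0]) (use mpoly_idealD[OF I] in auto)
  have "ideal ?K (mpoly_ring n)"
  proof (rule mpoly_idealI)
    show "0 \<in> ?K" using I0 by simp
    fix p q assume "p \<in> ?K" "q \<in> ?K"
    then show "p + q \<in> ?K" using level_lift_add[OF I] by (auto simp: res_add polys_add)
  next
    fix p q :: "'k mpoly" assume p: "p \<in> ?K" and q: "q \<in> polys n"
    from q have "supp q \<subseteq> expos n" by (simp add: polys_def)
    then have "\<forall>a. level_lift u I a (level u a (q * p))"
    proof (induction rule: poly_induct)
      case (add p' q') then show ?case using level_lift_add[OF I] by (auto simp: res_add distrib_right)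
    next
      case (sgl \<beta> c)
      show ?case
      proof
        fix a
        have "level u a (sgl \<beta> c * p) = sgl \<beta> c * level u (a - weight u \<beta>) p"
          by (rule res_mult_sgl) (auto simp: weight_add)
        moreover have "level_lift u I (a - weight u \<beta>) (level u (a - weight u \<beta>) p)" using p by blast
        ultimately show "level_lift u I a (level u a (sgl \<beta> c * p))"
          using level_lift_sgl[OF I _ sgl] by fastforce
      qed
    qed (use expos_0 in blast)
    then show "q * p \<in> ?K" using p q by (auto intro: polys_mult)
  qed auto
  moreover have "init_form u ` I \<subseteq> ?K"
  proof (rule image_subsetI)
    fix g assume g: "g \<in> I"
    have gn: "g \<in> polys n" using mpoly_idealD(1)[OF I] g by blast
    let ?P = "\<lambda>\<alpha>. \<forall>\<beta>\<in>supp g. weight u \<alpha> \<le> weight u \<beta>"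
    have "level_lift u I a (level u a (res ?P g))" for a
    proof (cases "\<exists>\<alpha>\<in>supp g. ?P \<alpha> \<and> weight u \<alpha> = a")
      case True
      then obtain \<alpha> where \<alpha>: "\<alpha> \<in> supp g" "?P \<alpha>" "weight u \<alpha> = a" by blast
      have "a < weight u \<beta>" if "\<beta> \<in> supp (level u a (res ?P g) - g)" for \<beta>
      proof (rule ccontr)
        assume n: "\<not> ?thesis"
        have bg: "\<beta> \<in> supp g" using that by (auto simp: mem_supp lookup_minus coef_res when_def split: if_splits)
        then have "weight u \<beta> = a" using n \<alpha> by fastforce
        moreover have "?P \<beta>" using \<alpha> calculation by simp
        ultimately show False using that by (simp add: mem_supp lookup_minus coef_res)
      qed
      then show ?thesis unfolding level_lift_def using g by blast
    next
      case False
      then have "level u a (res ?P g) = 0" unfolding res_res by (intro res_False) auto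
      then show ?thesis using I0 by simp
    qed
    then show "init_form u g \<in> ?K" using gn by (auto simp: init_form_res intro: polys_res)
  qed
  ultimately show "init_ideal n u I \<subseteq> ?K"
    unfolding init_ideal_def by (rule R.genideal_minimal)
  have sub: "init_form u ` I \<subseteq> carrier (mpoly_ring n)"
    using mpoly_idealD(1)[OF I] by (auto simp: init_form_res intro!: polys_res)
  have idl: "ideal (init_ideal n u I) (mpoly_ring n)"
    unfolding init_ideal_def by (rule R.genideal_ideal[OF sub])
  have gen: "init_form u ` I \<subseteq> init_ideal n u I" unfolding init_ideal_def by (rule R.genideal_self[OF sub])
  show "?K \<subseteq> init_ideal n u I"
  proof
    fix h assume h: "h \<in> ?K"
    have lev: "level u a h \<in> init_ideal n u I" for a
    proof (cases "level u a h = 0")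
      case True then show ?thesis using mpoly_idealD(2)[OF idl] by simp
    next
      case False
      obtain g where g: "g \<in> I" "\<forall>\<alpha>\<in>supp (level u a h - g). a < weight u \<alpha>"
        using h by (auto simp: level_lift_def)
      \<comment> \<open>The lift agrees with the component up to weight \<open>a\<close>, so it has
        no terms of smaller weight and the component is its initial form.\<close>
      have cg: "coef g \<alpha> = coef (level u a h) \<alpha>" if "weight u \<alpha> \<le> a" for \<alpha>
      proof -
        have "\<alpha> \<notin> supp (level u a h - g)" using g(2) that by force
        then show ?thesis by (simp add: mem_supp lookup_minus)
      qed
      have ge: "a \<le> weight u \<alpha>" if "\<alpha> \<in> supp g" for \<alpha>
        using that cg[of \<alpha>] by (cases "weight u \<alpha> \<le> a") (auto simp: mem_supp coef_res when_def split: if_splits)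
      obtain \<alpha>0 where a0: "\<alpha>0 \<in> supp (level u a h)" using False by fastforce
      then have a0g: "\<alpha>0 \<in> supp g" "weight u \<alpha>0 = a" using cg[of \<alpha>0] by (auto simp: supp_res mem_supp coef_res)
      have "init_form u g = level u a h"
        unfolding init_form_res
      proof (rule poly_mapping_eqI)
        fix \<alpha>
        show "coef (res (\<lambda>\<alpha>. \<forall>\<beta>\<in>supp g. weight u \<alpha> \<le> weight u \<beta>) g) \<alpha> = coef (level u a h) \<alpha>"
        proof (cases "weight u \<alpha> = a")
          case True
          then have "\<forall>\<beta>\<in>supp g. weight u \<alpha> \<le> weight u \<beta>" using ge by simp
          with True cg[of \<alpha>] show ?thesis by (simp add: coef_res)
        next
          case False
          then have "\<alpha> \<in> supp g \<Longrightarrow> \<not> (\<forall>\<beta>\<in>supp g. weight u \<alpha> \<le> weight u \<beta>)" using a0g ge[of \<alpha>] by fastforce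
          with False show ?thesis by (auto simp: coef_res mem_supp when_def)
        qed
      qed
      then show ?thesis using gen g(1) by (metis image_eqI subsetD)
    qed
    have "(\<Sum>a\<in>weight u ` supp h. level u a h) \<in> init_ideal n u I"
      by (rule mpoly_ideal_sum[OF idl lev])
    then show "h \<in> init_ideal n u I" by (simp add: sum_res_levels)
  qed
qed

section \<open>A Krull intersection argument\<close>

text \<open>By Dickson's lemma an infinite descent would contain an exponent divisible by an earlier
  one, hence not smaller than it. The extra coordinate is held constant.\<close>

lemma wf_expos: "wf {(\<alpha>, \<beta>). \<alpha> \<in> expos n \<and> \<beta> \<in> expos n \<and> \<alpha> < \<beta>}"
  unfolding wf_iff_no_infinite_down_chain
proof
  assume "\<exists>f. \<forall>i. (f (Suc i), f i) \<in> {(\<alpha>, \<beta>). \<alpha> \<in> expos n \<and> \<beta> \<in> expos n \<and> \<alpha> < \<beta>}"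
  then obtain f where f: "\<And>i. f i \<in> expos n" "\<And>i. f (Suc i) < f i" by auto
  obtain i j \<beta> where ij: "i < j" "f j = \<beta> + f i"
    using dickson[of f n "\<lambda>_. 0"] f(1) by metis
  have "f j < f i" using ij(1)
    by (induction j) (auto simp: less_Suc_eq intro: less_trans[OF f(2)] f(2))
  then show False using expo_le_add[of "f i" \<beta>] ij(2) by (simp add: not_le[symmetric])
qed

text \<open>This is the Rees algebra argument for Krull's intersection theorem without the extra variable:
  the pair of a monomial \<open>\<alpha>\<close> and the excess weight \<open>w \<alpha> - A m\<close> plays the role of a monomial with
  one more variable, and each \<open>g m\<close> is chosen with minimal leading monomial modulo its
  predecessors.\<close>

lemma weighted_noetherian:
  fixes p :: "nat \<Rightarrow> 'k::field mpoly" and w :: "expo \<Rightarrow> int" and A :: "nat \<Rightarrow> int"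
  assumes p: "\<And>j. p j \<in> polys n" and w_add: "\<And>\<alpha> \<beta>. w (\<alpha> + \<beta>) = w \<alpha> + w \<beta>"
    and pw: "\<And>j \<alpha>. \<alpha> \<in> supp (p j) \<Longrightarrow> A j \<le> w \<alpha>"
  obtains m q where "p m = (\<Sum>j<m. q j * p j)" "\<And>j. q j \<in> polys n"
    "\<And>j \<alpha>. \<alpha> \<in> supp (q j) \<Longrightarrow> A m - A j \<le> w \<alpha>"
proof (rule ccontr)
  assume contra: "\<not> thesis"
  note main = that
  have w0: "w 0 = 0" using w_add[of 0 0] by simp
  \<comment> \<open>Combinations of the first \<open>m\<close> polynomials in which the coefficient
    of \<open>p j\<close> supplies the weight missing between \<open>A j\<close> and
    \<open>a\<close>; this is the degree \<open>a\<close> part of an ideal in the Rees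
    picture.\<close>
  define T where "T m a = {(\<Sum>j<m. q j * p j) | q. \<forall>j. q j \<in> polys n \<and> (\<forall>\<alpha>\<in>supp (q j). a - A j \<le> w \<alpha>)}" for m a
  have TI: "(\<Sum>j<m. q j * p j) \<in> T m a"
    if "\<And>j. q j \<in> polys n" "\<And>j \<alpha>. \<alpha> \<in> supp (q j) \<Longrightarrow> a - A j \<le> w \<alpha>" for q m a
    unfolding T_def using that by blast
  have TE: thesis'
    if t: "t \<in> T m a" and goal: "\<And>q. t = (\<Sum>j<m. q j * p j) \<Longrightarrow> (\<And>j. q j \<in> polys n) \<Longrightarrow>
      (\<And>j \<alpha>. \<alpha> \<in> supp (q j) \<Longrightarrow> a - A j \<le> w \<alpha>) \<Longrightarrow> thesis'" for t m a thesis'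
  proof -
    from t obtain q where "t = (\<Sum>j<m. q j * p j)" "\<forall>j. q j \<in> polys n \<and> (\<forall>\<alpha>\<in>supp (q j). a - A j \<le> w \<alpha>)"
      unfolding T_def by blast
    then show ?thesis by (intro goal[of q]) auto
  qed
  have T_add: "t + t' \<in> T m a" if tt: "t \<in> T m a" "t' \<in> T m a" for t t' m a
  proof -
    obtain q where q: "t = (\<Sum>j<m. q j * p j)" "\<And>j. q j \<in> polys n" "\<And>j \<alpha>. \<alpha> \<in> supp (q j) \<Longrightarrow> a - A j \<le> w \<alpha>"
      using tt(1) by (rule TE) (rule that)
    obtain q' where q': "t' = (\<Sum>j<m. q' j * p j)" "\<And>j. q' j \<in> polys n" "\<And>j \<alpha>. \<alpha> \<in> supp (q' j) \<Longrightarrow> a - A j \<le> w \<alpha>"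
      using tt(2) by (rule TE) (rule that)
    have "t + t' = (\<Sum>j<m. (q j + q' j) * p j)" by (simp add: q(1) q'(1) distrib_right sum.distrib)
    also have "\<dots> \<in> T m a"
    proof (rule TI)
      show "q j + q' j \<in> polys n" for j using q q' by (intro polys_add)
      fix j \<alpha> assume "\<alpha> \<in> supp (q j + q' j)"
      then show "a - A j \<le> w \<alpha>" using keys_add[of "q j" "q' j"] q(3) q'(3) by blast
    qed
    finally show ?thesis .
  qed
  have T_sgl: "sgl \<beta> c * t \<in> T m' a'"
    if t: "t \<in> T m a" and \<beta>: "\<beta> \<in> expos n" and le: "m \<le> m'" "a' \<le> a + w \<beta>" for t \<beta> c m m' a a'
  proof -
    obtain q where q: "t = (\<Sum>j<m. q j * p j)" "\<And>j. q j \<in> polys n" "\<And>j \<alpha>. \<alpha> \<in> supp (q j) \<Longrightarrow> a - A j \<le> w \<alpha>"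
      using t by (rule TE) (rule that)
    define q' where "q' j = (if j < m then sgl \<beta> c * q j else 0)" for j
    have "sgl \<beta> c * t = (\<Sum>j<m. q' j * p j)" by (simp add: q(1) q'_def sum_distrib_left mult.assoc)
    also have "\<dots> = (\<Sum>j<m'. q' j * p j)" by (rule sum.mono_neutral_left) (use le in \<open>auto simp: q'_def\<close>)
    also have "\<dots> \<in> T m' a'"
    proof (rule TI)
      show "q' j \<in> polys n" for j using q(2) \<beta> by (auto simp: q'_def intro: polys_mult polys_sgl)
      fix j \<alpha> assume "\<alpha> \<in> supp (q' j)"
      then have "\<alpha> \<in> supp (sgl \<beta> c * q j)" by (auto simp: q'_def split: if_splits)
      then obtain \<gamma> where "\<alpha> = \<beta> + \<gamma>" "\<gamma> \<in> supp (q j)" using supp_mult_sgl[of \<beta> c "q j"] by blast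
      then show "a' - A j \<le> w \<alpha>" using q(3)[of \<gamma> j] le by (simp add: w_add)
    qed
    finally show ?thesis .
  qed
  have T_p: "p i \<in> T (Suc i) (A i)" for i
  proof -
    have "(\<Sum>j<Suc i. (if j = i then 1 else 0) * p j) \<in> T (Suc i) (A i)"
      by (rule TI) (auto simp: w0 split: if_splits)
    then show ?thesis by simp
  qed
  have T_supp: "a \<le> w \<alpha>" "\<alpha> \<in> expos n" if t: "t \<in> T m a" and \<alpha>: "\<alpha> \<in> supp t" for t m a \<alpha>
  proof -
    obtain q where q: "t = (\<Sum>j<m. q j * p j)" "\<And>j. q j \<in> polys n" "\<And>j \<alpha>. \<alpha> \<in> supp (q j) \<Longrightarrow> a - A j \<le> w \<alpha>"
      using t by (rule TE) (rule that)
    obtain j where "\<alpha> \<in> supp (q j * p j)" using \<alpha> keys_sum[of "\<lambda>j. q j * p j" "{..<m}"] unfolding q(1) by blast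
    then obtain \<beta> \<gamma> where bg: "\<alpha> = \<beta> + \<gamma>" "\<beta> \<in> supp (q j)" "\<gamma> \<in> supp (p j)" using keys_mult[of "q j" "p j"] by blast
    show "a \<le> w \<alpha>" using q(3)[OF bg(2)] pw[OF bg(3)] by (simp add: bg(1) w_add)
    show "\<alpha> \<in> expos n" using bg(1) polysD[OF q(2) bg(2)] polysD[OF p bg(3)] by (simp add: expos_add)
  qed
  have T_mono: "t \<in> T m' a" if "t \<in> T m a" "m \<le> m'" for t m m' a
    using T_sgl[OF that(1) expos_0 that(2), of a 1] by (simp add: w0)
  define cand where "cand m = {p m + t | t. t \<in> T m (A m)}" for m
  have cand_T: "g \<in> T (Suc m) (A m)" if "g \<in> cand m" for g m
    using that T_add[OF T_p T_mono] unfolding cand_def by fastforce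
  \<comment> \<open>A vanishing candidate would express \<open>p m\<close> through its predecessors
    in just the form that is assumed impossible.\<close>
  have cand_nz: "g \<noteq> 0" if g: "g \<in> cand m" for g m
  proof
    assume "g = 0"
    then obtain t where t: "t \<in> T m (A m)" "p m + t = 0" using g unfolding cand_def by auto
    have "sgl 0 (- 1) * t \<in> T m (A m)" using T_sgl[OF t(1) expos_0, of m "A m" "- 1"] by (simp add: w0)
    moreover have "sgl 0 (- 1) * t = p m"
      using t(2) unfolding add_eq_0_iff2 by (simp add: single_uminus)
    ultimately have "p m \<in> T m (A m)" by simp
    then have thesis by (rule TE) (rule main)
    with contra show False ..
  qed
  have "\<exists>g\<in>cand m. \<forall>g'\<in>cand m. \<not> Max (supp g') < Max (supp g)" for m
  proof -
    have "p m + 0 \<in> cand m" unfolding cand_def using TI[of "\<lambda>_. 0" "A m" m] by fastforce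
    then have "Max (supp (p m)) \<in> (\<lambda>g. Max (supp g)) ` cand m" by force
    with wf_expos[of n] obtain z where z: "z \<in> (\<lambda>g. Max (supp g)) ` cand m"
      "\<And>y. (y, z) \<in> {(\<alpha>, \<beta>). \<alpha> \<in> expos n \<and> \<beta> \<in> expos n \<and> \<alpha> < \<beta>} \<Longrightarrow> y \<notin> (\<lambda>g. Max (supp g)) ` cand m"
      by (rule wfE_min) (rule that)
    have ex: "Max (supp g) \<in> expos n" if "g \<in> cand m" for g
      using Max_in[of "supp g"] cand_nz[OF that] T_supp(2)[OF cand_T[OF that]] by simp
    obtain g where g: "g \<in> cand m" "z = Max (supp g)" using z(1) by blast
    have "\<not> Max (supp g') < Max (supp g)" if "g' \<in> cand m" for g'
      using z(2)[of "Max (supp g')"] g ex that by auto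
    then show ?thesis using g(1) by blast
  qed
  then obtain g where g: "\<And>m. g m \<in> cand m" "\<And>m g'. g' \<in> cand m \<Longrightarrow> \<not> Max (supp g') < Max (supp (g m))"
    by metis
  define \<alpha> where "\<alpha> m = Max (supp (g m))" for m
  have \<alpha>: "\<alpha> m \<in> supp (g m)" for m using Max_in[of "supp (g m)"] cand_nz[OF g(1)] by (simp add: \<alpha>_def)
  have \<alpha>_ge: "\<gamma> \<le> \<alpha> m" if "\<gamma> \<in> supp (g m)" for \<gamma> m unfolding \<alpha>_def using that by simp
  have \<alpha>n: "\<alpha> m \<in> expos n" "A m \<le> w (\<alpha> m)" for m using T_supp[OF cand_T[OF g(1)] \<alpha>] by auto
  obtain i j \<beta> where ij: "i < j" "\<alpha> j = \<beta> + \<alpha> i" "nat (w (\<alpha> i) - A i) \<le> nat (w (\<alpha> j) - A j)"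
    by (rule dickson[of \<alpha> n "\<lambda>m. nat (w (\<alpha> m) - A m)"]) (use \<alpha>n in blast)+
  have \<beta>: "\<beta> \<in> expos n" using \<alpha>n(1)[of j] ij(2) by (simp add: expos_add)
  define c where "c = - coef (g j) (\<alpha> j) / coef (g i) (\<alpha> i)"
  define s where "s = sgl \<beta> c * g i"
  have "w (\<alpha> i) - A i \<le> w (\<alpha> j) - A j" using ij(3) \<alpha>n(2)[of j] by (simp add: nat_le_eq_zle)
  \<comment> \<open>Here the comparison of excess weights pays off: shifting \<open>g i\<close> by
    \<open>\<beta>\<close> reaches the weight demanded at stage \<open>j\<close>, so cancelling the
    leading term of \<open>g j\<close> stays among the candidates and contradicts
    minimality.\<close>
  then have "A j \<le> A i + w \<beta>" unfolding ij(2) w_add by simp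
  then have "s \<in> T j (A j)"
    unfolding s_def using ij(1) by (intro T_sgl[OF cand_T[OF g(1)] \<beta>]) auto
  then have gs: "g j + s \<in> cand j"
    using g(1)[of j] T_add unfolding cand_def by (auto simp: add.assoc)
  have "coef s (\<alpha> j) = - coef (g j) (\<alpha> j)"
    using \<alpha>[of i] by (simp add: s_def ij(2) coef_mult_sgl c_def mem_supp)
  then have "\<alpha> j \<notin> supp (g j + s)" by (simp add: mem_supp lookup_add)
  moreover have "\<gamma> \<le> \<alpha> j" if "\<gamma> \<in> supp (g j + s)" for \<gamma>
  proof -
    have "\<gamma> \<in> supp (g j) \<or> \<gamma> \<in> (\<lambda>\<alpha>. \<beta> + \<alpha>) ` supp (g i)"
      using that keys_add[of "g j" s] supp_mult_sgl[of \<beta> c "g i"] unfolding s_def by blast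
    then show ?thesis
    proof
      assume "\<gamma> \<in> (\<lambda>\<alpha>. \<beta> + \<alpha>) ` supp (g i)"
      then show ?thesis using \<alpha>_ge[of _ i] unfolding ij(2) by (auto intro: add_left_mono)
    qed (rule \<alpha>_ge)
  qed
  moreover have "Max (supp (g j + s)) \<in> supp (g j + s)" using cand_nz[OF gs] by simp
  ultimately have "Max (supp (g j + s)) < \<alpha> j" by (metis order.not_eq_order_implies_strict)
  then show False using g(2)[OF gs] by (simp add: \<alpha>_def)
qed

section \<open>Integral weights and representatives of maximal order\<close>

lemma common_denominator:
  assumes "finite S"
  shows "\<exists>N::int. N > 0 \<and> (\<forall>q\<in>S. \<exists>z::int. of_int N * (q::rat) = of_int z)"
  using assms
proof (induction S rule: finite_induct)
  case empty show ?case by (intro exI[of _ 1]) auto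
next
  case (insert q S)
  then obtain N :: int where N: "N > 0" "\<forall>q\<in>S. \<exists>z::int. of_int N * (q::rat) = of_int z" by blast
  obtain a d where ad: "quotient_of q = (a, d)" by force
  note d = quotient_of_denom_pos[OF ad] quotient_of_div[OF ad]
  have "\<exists>z::int. of_int (N * d) * x = of_int z" if "x \<in> insert q S" for x
  proof (cases "x = q")
    case True
    have "of_int (N * d) * x = of_int (N * a)" unfolding True d(2) using d(1) by simp
    then show ?thesis by (rule exI)
  next
    case False
    then have "x \<in> S" using that by simp
    then obtain z :: int where z: "of_int N * x = of_int z" using bspec[OF N(2)] by fast
    have "of_int (N * d) * x = (of_int N * x) * of_int d" by (simp only: of_int_mult mult_ac)
    also have "\<dots> = of_int (z * d)" unfolding z by simp
    finally show ?thesis by (rule exI)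
  qed
  then show ?case using N(1) d(1) by (intro exI[of _ "N * d"]) simp
qed

text \<open>Clearing denominators turns a strict increase of the weight into an increase by at least
  one step, so repeated raising passes every bound. The same spacing later gives
  discreteness.\<close>

lemma integral_weight:
  obtains w :: "expo \<Rightarrow> int" and N :: rat where "N > 0" "\<And>\<alpha> \<beta>. w (\<alpha> + \<beta>) = w \<alpha> + w \<beta>"
    "\<And>\<alpha>. \<alpha> \<in> expos n \<Longrightarrow> of_int (w \<alpha>) = N * weight u \<alpha>"
proof -
  obtain N :: int where N: "N > 0" "\<forall>q\<in>coef u ` {..<n}. \<exists>z::int. of_int N * q = of_int z"
    using common_denominator[of "coef u ` {..<n}"] by auto
  then have "\<forall>i\<in>{..<n}. \<exists>z::int. of_int N * coef u i = of_int z" by blast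
  then obtain z :: "nat \<Rightarrow> int" where z: "\<forall>i\<in>{..<n}. of_int N * coef u i = of_int (z i)"
    unfolding bchoice_iff by blast
  define w where "w \<alpha> = (\<Sum>i<n. z i * int (coef \<alpha> i))" for \<alpha> :: expo
  have "of_int (w \<alpha>) = of_int N * weight u \<alpha>" if "\<alpha> \<in> expos n" for \<alpha>
  proof -
    have "of_int N * weight u \<alpha> = (\<Sum>i<n. (of_int N * coef u i) * of_nat (coef \<alpha> i))"
      using that weight_superset[of "{..<n}" \<alpha> u] by (simp add: expos_def sum_distrib_left mult.assoc)
    also have "\<dots> = (\<Sum>i<n. of_int (z i) * of_nat (coef \<alpha> i))" using z by (intro sum.cong) auto
    finally show ?thesis by (simp add: w_def)
  qed
  moreover have "w (\<alpha> + \<beta>) = w \<alpha> + w \<beta>" for \<alpha> \<beta>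
    by (simp add: w_def lookup_add algebra_simps sum.distrib)
  ultimately show ?thesis using that[of "of_int N" w] N(1) by simp
qed

context scalar_hom begin

definition rel :: "(nat \<Rightarrow> 'a) \<Rightarrow> nat \<Rightarrow> 'k mpoly set" where
  "rel b n = {p \<in> polys n. ev b p = 0}"

lemma relation_ideal_rel: "relation_ideal n \<phi> b = rel b n"
  unfolding relation_ideal_def a_kernel_def' rel_def
  by (simp add: mpoly_eval_ev ring_of_type_algebra_def)

lemma ideal_rel: "ideal (rel b n) (mpoly_ring n)"
  by (rule mpoly_idealI) (auto simp: rel_def ev_add ev_mult polys_add polys_mult)

text \<open>Subtract a relation that agrees with the component of weight \<open>a\<close> up to that
  weight: the value is unchanged and all terms of weight \<open>a\<close> disappear.\<close>

lemma raise_representative: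
  assumes J: "level u a p \<in> init_ideal n u (rel b n)" and ge: "\<And>\<alpha>. \<alpha> \<in> supp p \<Longrightarrow> a \<le> weight u \<alpha>"
    and p: "p \<in> polys n"
  shows "\<exists>p'\<in>polys n. ev b p' = ev b p \<and> (\<forall>\<alpha>\<in>supp p'. a < weight u \<alpha>)"
proof -
  have "level_lift u (rel b n) a (level u a (level u a p))"
    using J unfolding init_ideal_char[OF ideal_rel] by blast
  then have "level_lift u (rel b n) a (level u a p)" by (simp add: res_res)
  then obtain g where g: "g \<in> rel b n" "\<And>\<alpha>. \<alpha> \<in> supp (level u a p - g) \<Longrightarrow> a < weight u \<alpha>"
    unfolding level_lift_def by blast
  have "a < weight u \<alpha>" if \<alpha>: "\<alpha> \<in> supp (p - g)" for \<alpha>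
  proof (rule ccontr)
    assume n: "\<not> ?thesis"
    then have "\<alpha> \<notin> supp (level u a p - g)" using g(2) by blast
    then have "coef (level u a p) \<alpha> = coef g \<alpha>" by (simp add: mem_supp lookup_minus)
    then have "coef (level u a p) \<alpha> \<noteq> coef p \<alpha>" using \<alpha> by (auto simp: mem_supp lookup_minus)
    then have "\<alpha> \<in> supp p" "weight u \<alpha> \<noteq> a" by (auto simp: mem_supp coef_res when_def split: if_splits)
    with n ge show False by force
  qed
  then show ?thesis using g(1) p by (intro bexI[of _ "p - g"]) (auto simp: rel_def ev_diff polys_diff)
qed

text \<open>If every representative could be raised, \<open>f\<close> would have representatives of
  weight beyond every bound. By \<open>weighted_noetherian\<close> one of them is a combination of
  its predecessors with coefficients of positive weight. Evaluating and cancelling \<open>f\<close>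
  gives a relation \<open>1 - Q\<close> whose initial form is 1.\<close>

lemma top_representative:
  assumes one: "1 \<notin> init_ideal n u (rel b n)" and f: "f \<noteq> 0" "f \<in> subal b n"
  shows "\<exists>p\<in>polys n. \<exists>a. ev b p = f \<and> (\<forall>\<alpha>\<in>supp p. a \<le> weight u \<alpha>) \<and>
    level u a p \<notin> init_ideal n u (rel b n)"
proof (rule ccontr)
  assume "\<not> ?thesis"
  then have no: "level u a p \<in> init_ideal n u (rel b n)"
    if "p \<in> polys n" "ev b p = f" "\<And>\<alpha>. \<alpha> \<in> supp p \<Longrightarrow> a \<le> weight u \<alpha>" for p a
    using that by blast
  obtain w :: "expo \<Rightarrow> int" and N :: rat where w: "N > 0" "\<And>\<alpha> \<beta>. w (\<alpha> + \<beta>) = w \<alpha> + w \<beta>"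
    "\<And>\<alpha>. \<alpha> \<in> expos n \<Longrightarrow> of_int (w \<alpha>) = N * weight u \<alpha>"
    by (rule integral_weight[of n u]) (rule that)
  obtain p0 where p0: "p0 \<in> polys n" "ev b p0 = f" using f by (auto simp: subal_def)
  define k where "k = Min (insert 0 (w ` supp p0))"
  define A where "A j = k + int j" for j
  define P where "P j p \<longleftrightarrow> p \<in> polys n \<and> ev b p = f \<and> (\<forall>\<alpha>\<in>supp p. A j \<le> w \<alpha>)" for j p
  have "\<exists>p. P 0 p" using p0 by (intro exI[of _ p0]) (auto simp: P_def A_def k_def)
  moreover have "\<exists>p'. P (Suc j) p' \<and> True" if "P j p" for j p
  proof -
    have p: "p \<in> polys n" "ev b p = f" "\<And>\<alpha>. \<alpha> \<in> supp p \<Longrightarrow> A j \<le> w \<alpha>" using that by (auto simp: P_def)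
    \<comment> \<open>The integer bound \<open>A j\<close> expressed in the scale of the rational
      weight.\<close>
    define a where "a = of_int (A j) / N"
    have ge: "a \<le> weight u \<alpha>" if "\<alpha> \<in> supp p" for \<alpha>
    proof -
      have "(of_int (A j) :: rat) \<le> of_int (w \<alpha>)" using p(3)[OF that] by simp
      then show ?thesis using w(3)[OF polysD[OF p(1) that]] w(1) by (simp add: a_def field_simps)
    qed
    obtain p' where p': "p' \<in> polys n" "ev b p' = ev b p" "\<forall>\<alpha>\<in>supp p'. a < weight u \<alpha>"
      using raise_representative[OF no[OF p(1,2) ge] ge p(1)] by blast
    have "A (Suc j) \<le> w \<alpha>" if "\<alpha> \<in> supp p'" for \<alpha>
    proof -
      have "(of_int (A j) :: rat) < of_int (w \<alpha>)"
        using p'(3)[rule_format, OF that] w(3)[OF polysD[OF p'(1) that]] w(1) by (simp add: a_def field_simps)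
      then show ?thesis by (simp add: A_def)
    qed
    then show ?thesis using p' p by (auto simp: P_def)
  qed
  ultimately obtain ps where ps: "\<And>j. P j (ps j)" using dependent_nat_choice[of P "\<lambda>_ _ _. True"] by blast
  obtain m q where q: "ps m = (\<Sum>j<m. q j * ps j)" "\<And>j. q j \<in> polys n"
    "\<And>j \<alpha>. \<alpha> \<in> supp (q j) \<Longrightarrow> A m - A j \<le> w \<alpha>"
  proof (rule weighted_noetherian[of ps n w A])
    show "ps j \<in> polys n" for j using ps by (simp add: P_def)
    show "A j \<le> w \<alpha>" if "\<alpha> \<in> supp (ps j)" for j \<alpha> using ps that by (simp add: P_def)
  qed (use w in blast)+
  define Q where "Q = (\<Sum>j<m. q j)"
  have evf: "ev b (ps j) = f" for j using ps by (simp add: P_def)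
  have "f = ev b (\<Sum>j<m. q j * ps j)" using evf[of m] q(1) by simp
  also have "\<dots> = ev b Q * f" by (simp add: Q_def ev_sum ev_mult evf sum_distrib_right)
  finally have "ev b Q = 1" using f(1) by simp
  moreover have Qn: "Q \<in> polys n" unfolding Q_def using q(2) by (intro polys_sum)
  ultimately have g: "1 - Q \<in> rel b n" by (simp add: rel_def ev_diff polys_diff)
  have Q_pos: "0 < weight u \<alpha>" if \<alpha>: "\<alpha> \<in> supp Q" for \<alpha>
  proof -
    obtain j where j: "j < m" "\<alpha> \<in> supp (q j)" using \<alpha> keys_sum[of q "{..<m}"] unfolding Q_def by blast
    then have "w \<alpha> > 0" using q(3)[OF j(2)] by (simp add: A_def)
    then have "(0::rat) < of_int (w \<alpha>)" by simp
    then show ?thesis using w(3)[OF polysD[OF Qn \<alpha>]] w(1) by (simp add: zero_less_mult_iff)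
  qed
  have "level_lift u (rel b n) a (level u a 1)" for a
  proof (cases "a = 0")
    case True
    have "level u 0 (1 :: 'k mpoly) = 1" by (rule res_True) simp
    then show ?thesis unfolding level_lift_def True using g Q_pos by (intro bexI[of _ "1 - Q"]) auto
  next
    case False
    then have "level u a (1 :: 'k mpoly) = 0" by (intro res_False) auto
    then show ?thesis unfolding level_lift_def using mpoly_idealD(2)[OF ideal_rel] by (intro bexI[of _ 0]) auto
  qed
  then have "1 \<in> init_ideal n u (rel b n)" unfolding init_ideal_char[OF ideal_rel] by simp
  with one show False by blast
qed

end

section \<open>Prime degenerations\<close>

abbreviation wlevel :: "(expo \<Rightarrow> ratvec) \<Rightarrow> ratvec \<Rightarrow> 'k::field mpoly \<Rightarrow> 'k mpoly" where
  "wlevel W l \<equiv> res (\<lambda>\<alpha>. W \<alpha> = l)"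

text \<open>\<open>W\<close> is the vector-valued weight of exponents, ordered lexicographically; \<open>J\<close> is the
  \<open>W\<close>-homogeneous ideal of initial forms of the relations between the generators.\<close>

locale degeneration = scalar_hom \<phi> for \<phi> :: "'k::field \<Rightarrow> 'a::idom" +
  fixes b :: "nat \<Rightarrow> 'a" and n :: nat and J :: "'k mpoly set" and W :: "expo \<Rightarrow> ratvec"
  assumes W_add: "W (\<alpha> + \<beta>) = W \<alpha> + W \<beta>"
    and J_ideal: "ideal J (mpoly_ring n)"
    and J_prime: "p \<in> polys n \<Longrightarrow> q \<in> polys n \<Longrightarrow> p * q \<in> J \<Longrightarrow> p \<in> J \<or> q \<in> J"
    and J_homogeneous: "h \<in> J \<Longrightarrow> wlevel W l h \<in> J"
    and J_monomial: "\<alpha> \<in> expos n \<Longrightarrow> sgl \<alpha> 1 \<notin> J"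
    and J_raise: "h \<in> J \<Longrightarrow> (\<And>\<alpha>. \<alpha> \<in> supp h \<Longrightarrow> W \<alpha> = l) \<Longrightarrow>
      \<exists>q\<in>polys n. ev b q = ev b h \<and> (\<forall>\<alpha>\<in>supp q. l < W \<alpha>)"
    and J_top: "f \<noteq> 0 \<Longrightarrow> \<exists>p\<in>polys n. \<exists>l. ev b p = f \<and> (\<forall>\<alpha>\<in>supp p. l \<le> W \<alpha>) \<and> wlevel W l p \<notin> J"
    and J_rel: "p \<in> polys n \<Longrightarrow> ev b p = 0 \<Longrightarrow> (\<And>\<alpha>. \<alpha> \<in> supp p \<Longrightarrow> l \<le> W \<alpha>) \<Longrightarrow> wlevel W l p \<in> J"

text \<open>Since \<open>W\<close> refines the single weight \<open>u\<close>, facts about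
  \<open>u\<close>-initial forms carry over. For \<open>J_top\<close>, let \<open>h\<close> be the
  initial form outside \<open>J\<close> given by \<open>top_representative\<close>, and take the
  least \<open>W\<close>-component of \<open>h\<close> outside \<open>J\<close>. The components
  below it lie in \<open>J\<close> and can be traded for terms of larger \<open>u\<close>-weight,
  which are also larger for \<open>W\<close>.\<close>

lemma (in scalar_hom) degenerationI:
  assumes gen: "subal b n = UNIV" and J: "init_ideal n u (rel b n) = J" "primeideal J (mpoly_ring n)"
    and mono: "\<And>\<alpha>. \<alpha> \<in> expos n \<Longrightarrow> sgl \<alpha> 1 \<notin> J"
    and W_add: "\<And>\<alpha> \<beta>. W (\<alpha> + \<beta>) = W \<alpha> + W \<beta>"
    and hom: "\<And>h l. h \<in> J \<Longrightarrow> wlevel W l h \<in> J"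
    and mon: "\<And>\<alpha> \<beta>. weight u \<alpha> < weight u \<beta> \<Longrightarrow> W \<alpha> < W \<beta>"
  shows "degeneration \<phi> b n J W"
proof -
  interpret Jp: primeideal J "mpoly_ring n" by fact
  have idl: "ideal J (mpoly_ring n)" by (rule Jp.ideal_axioms)
  have eq: "weight u \<alpha> = weight u \<beta>" if "W \<alpha> = W \<beta>" for \<alpha> \<beta>
    using mon[of \<alpha> \<beta>] mon[of \<beta> \<alpha>] that by (metis less_irrefl linorder_neqE)
  have le: "weight u \<alpha> \<le> weight u \<beta>" if "W \<alpha> \<le> W \<beta>" for \<alpha> \<beta>
    using mon[of \<beta> \<alpha>] that by (meson not_le)
  have lift: "\<exists>q\<in>polys n. ev b q = ev b h \<and> (\<forall>\<alpha>\<in>supp q. a < weight u \<alpha>)"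
    if h: "h \<in> J" "\<And>\<alpha>. \<alpha> \<in> supp h \<Longrightarrow> weight u \<alpha> = a" for h a
  proof -
    have "level u a h = h" using h(2) by (rule res_True)
    then have "level u a h \<in> init_ideal n u (rel b n)" using h(1) J(1) by simp
    moreover have "h \<in> polys n" using h(1) mpoly_idealD(1)[OF idl] by blast
    moreover have "a \<le> weight u \<alpha>" if "\<alpha> \<in> supp h" for \<alpha> using h(2)[OF that] by simp
    ultimately show ?thesis using raise_representative[of u a h n b] by blast
  qed
  show ?thesis
  proof (intro degeneration.intro degeneration_axioms.intro)
    show "scalar_hom \<phi>" by (rule scalar_hom_axioms)
    show "W (\<alpha> + \<beta>) = W \<alpha> + W \<beta>" for \<alpha> \<beta> by fact
    show "ideal J (mpoly_ring n)" by fact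
    show "p \<in> J \<or> q \<in> J" if "p \<in> polys n" "q \<in> polys n" "p * q \<in> J" for p q
      using Jp.I_prime[of p q] that by simp
    show "wlevel W l h \<in> J" if "h \<in> J" for h l using hom[OF that] .
    show "sgl \<alpha> 1 \<notin> J" if "\<alpha> \<in> expos n" for \<alpha> using mono[OF that] .
    show "\<exists>q\<in>polys n. ev b q = ev b h \<and> (\<forall>\<alpha>\<in>supp q. l < W \<alpha>)"
      if h: "h \<in> J" "\<And>\<alpha>. \<alpha> \<in> supp h \<Longrightarrow> W \<alpha> = l" for h l
    proof (cases "h = 0")
      case True then show ?thesis by (intro bexI[of _ 0]) auto
    next
      case False
      then obtain \<alpha>0 where a0: "\<alpha>0 \<in> supp h" by fastforce
      then have "weight u \<alpha> = weight u \<alpha>0" if "\<alpha> \<in> supp h" for \<alpha> using h(2) that eq by metis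
      from lift[OF h(1) this] obtain q where "q \<in> polys n" "ev b q = ev b h" "\<forall>\<alpha>\<in>supp q. weight u \<alpha>0 < weight u \<alpha>" by blast
      then show ?thesis using mon[of \<alpha>0] h(2)[OF a0] by auto
    qed
    show "wlevel W l p \<in> J" if p: "p \<in> polys n" "ev b p = 0" "\<And>\<alpha>. \<alpha> \<in> supp p \<Longrightarrow> l \<le> W \<alpha>" for p l
    proof (cases "\<exists>\<alpha>0\<in>supp p. W \<alpha>0 = l")
      case False
      then have "wlevel W l p = 0" by (intro res_False) auto
      then show ?thesis using mpoly_idealD(2)[OF idl] by simp
    next
      case True
      then obtain \<alpha>0 where a0: "\<alpha>0 \<in> supp p" "W \<alpha>0 = l" by blast
      define a where "a = weight u \<alpha>0"
      have ge: "a \<le> weight u \<alpha>" if "\<alpha> \<in> supp p" for \<alpha> unfolding a_def using le p(3)[OF that] a0(2) by simp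
      have "level_lift u (rel b n) c (level u c (level u a p))" for c
      proof (cases "c = a")
        case True
        have "a < weight u \<alpha>" if "\<alpha> \<in> supp (level u a p - p)" for \<alpha>
        proof -
          have "\<alpha> \<in> supp p" "weight u \<alpha> \<noteq> a"
            using that supp_minus_res[of p "\<lambda>\<alpha>. weight u \<alpha> = a"] supp_uminus[of "p - level u a p"] by auto
          then show ?thesis using ge by force
        qed
        then show ?thesis unfolding level_lift_def using p(1,2) True by (intro bexI[of _ p]) (auto simp: rel_def res_res)
      next
        case False
        then have "level u c (level u a p) = 0" unfolding res_res by (intro res_False) auto
        then show ?thesis unfolding level_lift_def using mpoly_idealD(2)[OF ideal_rel] by (intro bexI[of _ 0]) auto
      qed
      then have "level u a p \<in> J" unfolding J(1)[symmetric] init_ideal_char[OF ideal_rel] using polys_res[OF p(1)] by blast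
      then have "wlevel W l (level u a p) \<in> J" by (rule hom)
      moreover have "(W \<alpha> = l \<and> weight u \<alpha> = a) = (W \<alpha> = l)" for \<alpha> using eq[of \<alpha> \<alpha>0] a0 by (auto simp: a_def)
      ultimately show ?thesis by (simp add: res_res)
    qed
    show "\<exists>p\<in>polys n. \<exists>l. ev b p = f \<and> (\<forall>\<alpha>\<in>supp p. l \<le> W \<alpha>) \<and> wlevel W l p \<notin> J" if f: "f \<noteq> 0" for f
    proof -
      have "1 \<notin> init_ideal n u (rel b n)" using mono[of 0] by (simp add: J(1))
      moreover have "f \<in> subal b n" using gen by simp
      ultimately obtain p a where p: "p \<in> polys n" "ev b p = f" "\<forall>\<alpha>\<in>supp p. a \<le> weight u \<alpha>"
        "level u a p \<notin> J"
        using top_representative[of n u b f] f unfolding J(1) by blast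
      define h where "h = level u a p"
      define L where "L = W ` supp h"
      have sum_h: "(\<Sum>l\<in>L. wlevel W l h) = h" unfolding L_def by (rule sum_res_levels) auto
      define Bad where "Bad = {l\<in>L. wlevel W l h \<notin> J}"
      have "Bad \<noteq> {}"
        using mpoly_ideal_sum[OF idl, of L "\<lambda>l. wlevel W l h"] p(4) unfolding sum_h by (auto simp: Bad_def h_def)
      moreover have "finite Bad" by (simp add: Bad_def L_def)
      ultimately have l0: "Min Bad \<in> Bad" "\<And>l. l \<in> Bad \<Longrightarrow> Min Bad \<le> l" by auto
      define l0 where "l0 = Min Bad"
      obtain \<alpha>0 where a0: "\<alpha>0 \<in> supp h" "W \<alpha>0 = l0" using l0(1) by (auto simp: Bad_def L_def l0_def)
      then have wa0: "weight u \<alpha>0 = a" by (simp add: h_def supp_res)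
      \<comment> \<open>The part of \<open>h\<close> to be traded: being in \<open>J\<close> and
        homogeneous for \<open>u\<close>, it has the same value as a polynomial \<open>q\<close>
        with only terms of larger \<open>u\<close>-weight.\<close>
      define g where "g = res (\<lambda>\<alpha>. W \<alpha> < l0) h"
      have "g = (\<Sum>l\<in>{l\<in>L. l < l0}. wlevel W l g)"
        by (rule sum_res_levels[symmetric]) (auto simp: L_def g_def supp_res)
      also have "\<dots> = (\<Sum>l\<in>{l\<in>L. l < l0}. wlevel W l h)"
        by (rule sum.cong) (auto simp: g_def res_res intro!: arg_cong[of _ _ "\<lambda>P. res P h"])
      also have "\<dots> \<in> J"
      proof (rule mpoly_ideal_sum[OF idl])
        fix l assume "l \<in> {l\<in>L. l < l0}"
        then have "l \<in> L" "l \<notin> Bad" using l0(2)[of l] by (auto simp: l0_def)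
        then show "wlevel W l h \<in> J" by (simp add: Bad_def)
      qed
      finally have "g \<in> J" .
      moreover have "weight u \<alpha> = a" if "\<alpha> \<in> supp g" for \<alpha> using that by (simp add: g_def h_def supp_res)
      ultimately obtain q where q: "q \<in> polys n" "ev b q = ev b g" "\<forall>\<alpha>\<in>supp q. a < weight u \<alpha>" using lift by blast
      have gn: "g \<in> polys n" using p(1) by (simp add: g_def h_def polys_res)
      have big: "l0 < W \<alpha>" if "a < weight u \<alpha>" for \<alpha> using mon[of \<alpha>0 \<alpha>] that a0 wa0 by simp
      have pg: "l0 \<le> W \<alpha>" if "\<alpha> \<in> supp (p - g)" for \<alpha>
      proof (cases "weight u \<alpha> = a")
        case True
        then have "\<not> W \<alpha> < l0" using that by (auto simp: mem_supp lookup_minus g_def h_def coef_res)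
        then show ?thesis by simp
      next
        case False
        then have "\<alpha> \<in> supp p" using that by (auto simp: mem_supp lookup_minus g_def h_def coef_res)
        then show ?thesis using p(3) False big[of \<alpha>] by force
      qed
      have "l0 \<le> W \<alpha>" if "\<alpha> \<in> supp (p - g + q)" for \<alpha>
        using that keys_add[of "p - g" q] pg q(3) big by (blast intro: less_imp_le)
      moreover have "wlevel W l0 (p - g + q) = wlevel W l0 h"
      proof -
        have "wlevel W l0 q = 0" using q(3) big by (intro res_False) fastforce
        moreover have "wlevel W l0 g = 0" unfolding g_def res_res by (intro res_False) auto
        moreover have "wlevel W l0 p = wlevel W l0 h"
          unfolding h_def res_res by (rule arg_cong[of _ _ "\<lambda>P. res P p"]) (use eq[of _ \<alpha>0] a0 wa0 in auto)
        ultimately show ?thesis by (simp add: res_add res_diff)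
      qed
      moreover have "wlevel W l0 h \<notin> J" using l0(1) by (simp add: Bad_def l0_def)
      moreover have "p - g + q \<in> polys n" using p(1) gn q(1) by (intro polys_add polys_diff)
      moreover have "ev b (p - g + q) = f" using p(2) q(2) by (simp add: ev_add ev_diff)
      ultimately show ?thesis by (intro bexI[of _ "p - g + q"] exI[of _ l0]) auto
    qed
  qed
qed

section \<open>The valuation and its associated graded algebra\<close>

definition lex_rel :: "nat \<Rightarrow> ratvec rel" where
  "lex_rel d = {(x, y). x \<in> rat_space d \<and> y \<in> rat_space d \<and> x \<le> y}"

lemma rat_space_add: "x \<in> rat_space d \<Longrightarrow> y \<in> rat_space d \<Longrightarrow> x + y \<in> rat_space d"
  using keys_add[of x y] by (auto simp: rat_space_def)
lemma rat_space_diff: "x \<in> rat_space d \<Longrightarrow> y \<in> rat_space d \<Longrightarrow> x - y \<in> rat_space d"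
  using supp_diff[of x y] by (auto simp: rat_space_def)
lemma rat_space_0 [simp]: "0 \<in> rat_space d" by (simp add: rat_space_def)

lemma group_ordering_lex_rel: "group_ordering d (lex_rel d)"
  unfolding group_ordering_def linear_order_on_def partial_order_on_def preorder_on_def
    refl_on_def trans_def antisym_def total_on_def lex_rel_def
  by (auto simp: rat_space_add intro: add_right_mono)

context degeneration begin

text \<open>The choice is forced for nonzero \<open>f\<close>: by \<open>val_eqI\<close>, every
  representative whose lowest form lies outside \<open>J\<close> exhibits the same value.\<close>

definition val :: "'a \<Rightarrow> ratvec" where
  "val f = (SOME l. \<exists>p\<in>polys n. ev b p = f \<and> (\<forall>\<alpha>\<in>supp p. l \<le> W \<alpha>) \<and> wlevel W l p \<notin> J)"

lemma W_0 [simp]: "W 0 = 0" using W_add[of 0 0] by simp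

lemma J_0: "0 \<in> J" using mpoly_idealD(2)[OF J_ideal] .

lemma val_witness:
  assumes "f \<noteq> 0"
  obtains p where "p \<in> polys n" "ev b p = f" "\<And>\<alpha>. \<alpha> \<in> supp p \<Longrightarrow> val f \<le> W \<alpha>" "wlevel W (val f) p \<notin> J"
proof -
  have "\<exists>l. \<exists>p\<in>polys n. ev b p = f \<and> (\<forall>\<alpha>\<in>supp p. l \<le> W \<alpha>) \<and> wlevel W l p \<notin> J"
    using J_top[OF assms] by blast
  from someI_ex[OF this] show ?thesis using that unfolding val_def[symmetric] by blast
qed

text \<open>If a representative had order above the value, its difference from a witness would be a
  relation with the lowest form of the witness, and \<open>J_rel\<close> would put that form into
  \<open>J\<close>.\<close>

lemma val_ge:
  assumes p: "p \<in> polys n" "ev b p \<noteq> 0" "\<And>\<alpha>. \<alpha> \<in> supp p \<Longrightarrow> l \<le> W \<alpha>"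
  shows "l \<le> val (ev b p)"
proof (rule ccontr)
  assume "\<not> ?thesis"
  then have lt: "val (ev b p) < l" by simp
  obtain p' where p': "p' \<in> polys n" "ev b p' = ev b p" "\<And>\<alpha>. \<alpha> \<in> supp p' \<Longrightarrow> val (ev b p) \<le> W \<alpha>"
    "wlevel W (val (ev b p)) p' \<notin> J"
    by (rule val_witness[OF p(2)]) (rule that)
  have "val (ev b p) \<le> W \<alpha>" if "\<alpha> \<in> supp (p' - p)" for \<alpha>
    using that supp_diff[of p' p] p'(3) p(3) lt by (meson UnE less_imp_le order_trans subsetD)
  then have "wlevel W (val (ev b p)) (p' - p) \<in> J"
    using p p' by (intro J_rel) (auto simp: polys_diff ev_diff)
  moreover have "wlevel W (val (ev b p)) p = 0"
    using p(3) lt by (intro res_False) (metis leD)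
  ultimately show False using p'(4) by (simp add: res_diff)
qed

lemma val_eqI:
  assumes p: "p \<in> polys n" "\<And>\<alpha>. \<alpha> \<in> supp p \<Longrightarrow> l \<le> W \<alpha>" "wlevel W l p \<notin> J"
  shows "ev b p \<noteq> 0" "val (ev b p) = l"
proof -
  show nz: "ev b p \<noteq> 0" using J_rel[OF p(1) _ p(2)] p(3) by blast
  have le: "l \<le> val (ev b p)" by (rule val_ge[OF p(1) nz p(2)])
  show "val (ev b p) = l"
  proof (rule ccontr)
    assume "val (ev b p) \<noteq> l"
    with le have lt: "l < val (ev b p)" by simp
    obtain p' where p': "p' \<in> polys n" "ev b p' = ev b p" "\<And>\<alpha>. \<alpha> \<in> supp p' \<Longrightarrow> val (ev b p) \<le> W \<alpha>"
      "wlevel W (val (ev b p)) p' \<notin> J"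
      by (rule val_witness[OF nz]) (rule that)
    have "l \<le> W \<alpha>" if "\<alpha> \<in> supp (p - p')" for \<alpha>
      using that supp_diff[of p p'] p'(3) p(2) lt by (meson UnE less_imp_le order_trans subsetD)
    then have "wlevel W l (p - p') \<in> J"
      using p p' by (intro J_rel) (auto simp: polys_diff ev_diff)
    moreover have "wlevel W l p' = 0"
      using p'(3) lt by (intro res_False) (metis leD)
    ultimately show False using p(3) by (simp add: res_diff)
  qed
qed

text \<open>Both the target space and the discreteness of the values are obtained from the weights
  of monomials through this inclusion.\<close>

lemma val_in_image: "f \<noteq> 0 \<Longrightarrow> val f \<in> W ` expos n"
proof -
  assume "f \<noteq> 0"
  then obtain p where p: "p \<in> polys n" "wlevel W (val f) p \<notin> J" by (rule val_witness) (rule that)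
  then have "wlevel W (val f) p \<noteq> 0" using J_0 by metis
  then obtain \<alpha> where "\<alpha> \<in> supp (wlevel W (val f) p)" by fastforce
  then have "\<alpha> \<in> supp p" "val f = W \<alpha>" by (auto simp: supp_res)
  then show ?thesis using polysD[OF p(1)] by blast
qed

lemma wlevel_mult:
  assumes "\<And>\<alpha>. \<alpha> \<in> supp p \<Longrightarrow> l \<le> W \<alpha>" "\<And>\<alpha>. \<alpha> \<in> supp q \<Longrightarrow> m \<le> W \<alpha>"
  shows "wlevel W (l + m) (p * q) = wlevel W l p * wlevel W m q"
proof -
  define p' q' where "p' = p - wlevel W l p" and "q' = q - wlevel W m q"
  have p': "l < W \<alpha>" if "\<alpha> \<in> supp p'" for \<alpha>
    using that assms(1)[of \<alpha>] by (auto simp: p'_def supp_minus_res less_le)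
  have q': "m < W \<alpha>" if "\<alpha> \<in> supp q'" for \<alpha>
    using that assms(2)[of \<alpha>] by (auto simp: q'_def supp_minus_res less_le)
  have "p * q = wlevel W l p * wlevel W m q + (wlevel W l p * q' + p' * q)"
    by (simp add: p'_def q'_def algebra_simps)
  then have "wlevel W (l + m) (p * q) = wlevel W (l + m) (wlevel W l p * wlevel W m q) +
     (wlevel W (l + m) (wlevel W l p * q') + wlevel W (l + m) (p' * q))"
    by (simp add: res_add)
  also have "wlevel W (l + m) (wlevel W l p * wlevel W m q) = wlevel W l p * wlevel W m q"
    using keys_mult[of "wlevel W l p" "wlevel W m q"] by (intro res_True) (auto simp: supp_res W_add)
  also have "wlevel W (l + m) (wlevel W l p * q') = 0"
  proof (rule res_False)
    fix \<alpha> assume "\<alpha> \<in> supp (wlevel W l p * q')"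
    then obtain \<beta> \<gamma> where "\<alpha> = \<beta> + \<gamma>" "W \<beta> = l" "\<gamma> \<in> supp q'"
      using keys_mult[of "wlevel W l p" q'] by (auto simp: supp_res)
    then show "W \<alpha> \<noteq> l + m" using q'[of \<gamma>] by (auto simp: W_add)
  qed
  also have "wlevel W (l + m) (p' * q) = 0"
  proof (rule res_False)
    fix \<alpha> assume "\<alpha> \<in> supp (p' * q)"
    then obtain \<beta> \<gamma> where "\<alpha> = \<beta> + \<gamma>" "\<beta> \<in> supp p'" "\<gamma> \<in> supp q"
      using keys_mult[of p' q] by blast
    then have "W \<alpha> > l + m" using p'[of \<beta>] assms(2)[of \<gamma>] by (auto simp: W_add intro: add_less_le_mono)
    then show "W \<alpha> \<noteq> l + m" by simp
  qed
  finally show ?thesis by simp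
qed

lemma val_mult:
  assumes "f \<noteq> 0" "g \<noteq> 0" shows "val (f * g) = val f + val g"
proof -
  obtain p where p: "p \<in> polys n" "ev b p = f" "\<And>\<alpha>. \<alpha> \<in> supp p \<Longrightarrow> val f \<le> W \<alpha>" "wlevel W (val f) p \<notin> J"
    by (rule val_witness[OF assms(1)]) (rule that)
  obtain q where q: "q \<in> polys n" "ev b q = g" "\<And>\<alpha>. \<alpha> \<in> supp q \<Longrightarrow> val g \<le> W \<alpha>" "wlevel W (val g) q \<notin> J"
    by (rule val_witness[OF assms(2)]) (rule that)
  have "val (ev b (p * q)) = val f + val g"
  proof (rule val_eqI)
    show "p * q \<in> polys n" using p q by (intro polys_mult)
    show "val f + val g \<le> W \<alpha>" if \<alpha>: "\<alpha> \<in> supp (p * q)" for \<alpha>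
    proof -
      obtain \<beta> \<gamma> where "\<alpha> = \<beta> + \<gamma>" "\<beta> \<in> supp p" "\<gamma> \<in> supp q" using \<alpha> keys_mult[of p q] by blast
      then show ?thesis using p(3) q(3) by (auto simp: W_add intro: add_mono)
    qed
    have "wlevel W (val f) p * wlevel W (val g) q \<notin> J"
      using J_prime[OF polys_res[OF p(1)] polys_res[OF q(1)]] p(4) q(4) by blast
    then show "wlevel W (val f + val g) (p * q) \<notin> J" using wlevel_mult[of p "val f" q "val g", OF p(3) q(3)] by simp
  qed
  then show ?thesis by (simp add: ev_mult p q)
qed

lemma val_scalar:
  assumes "c \<noteq> 0" "f \<noteq> 0" shows "val (\<phi> c * f) = val f"
proof -
  have "ev b (sgl 0 c) = \<phi> c" by simp
  moreover have "sgl 0 c \<notin> J"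
  proof
    assume "sgl 0 c \<in> J"
    then have "sgl 0 (inverse c) * sgl 0 c \<in> J" using mpoly_idealD(4)[OF J_ideal] polys_sgl[OF expos_0] by blast
    then show False using J_monomial[OF expos_0] assms(1) by (simp add: mult_single)
  qed
  moreover have "wlevel W 0 (sgl 0 c) = sgl 0 c" by (rule res_True) (auto split: if_splits)
  ultimately have "val (\<phi> c) = 0" using val_eqI(2)[of "sgl 0 c" 0] by (simp add: polys_sgl assms(1))
  then show ?thesis using val_mult[of "\<phi> c" f] assms by simp
qed

text \<open>The ideal \<open>J\<close> contains no variable. Since no generator is 0, removing 0 in
  the definition of a Khovanskii basis loses none of them.\<close>

lemma val_generator:
  assumes "i < n" shows "b i \<noteq> 0" "val (b i) = W (sgl i 1)"
proof -
  let ?p = "sgl (sgl i 1) 1 :: 'k mpoly"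
  have p: "?p \<in> polys n" using assms by (intro polys_sgl expos_sgl)
  have "wlevel W (W (sgl i 1)) ?p = ?p" by (rule res_True) simp
  then have "wlevel W (W (sgl i 1)) ?p \<notin> J" using J_monomial[OF expos_sgl[OF assms]] by simp
  from val_eqI[OF p _ this] show "b i \<noteq> 0" "val (b i) = W (sgl i 1)" by simp_all
qed

end

locale graded_degeneration = degeneration \<phi> b n J W
  for \<phi> :: "'k::field \<Rightarrow> 'a::idom" and b n J W +
  fixes d :: nat
  assumes W_space: "\<alpha> \<in> expos n \<Longrightarrow> W \<alpha> \<in> rat_space d"
begin

lemma val_space: "f \<noteq> 0 \<Longrightarrow> val f \<in> rat_space d"
  using val_in_image[of f] W_space by auto

abbreviation Fge :: "ratvec \<Rightarrow> 'a set" where "Fge l \<equiv> filt_ge (lex_rel d) val l"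
abbreviation Fgt :: "ratvec \<Rightarrow> 'a set" where "Fgt l \<equiv> filt_gt (lex_rel d) val l"

text \<open>A predicate in place of a fixed inequality lets one set of lemmas handle the weak
  filtration, the strict filtration and their products.\<close>

definition above :: "(ratvec \<Rightarrow> bool) \<Rightarrow> 'a set" where
  "above P = ev b ` {p \<in> polys n. \<forall>\<alpha>\<in>supp p. P (W \<alpha>)}"

lemma aboveI: "p \<in> polys n \<Longrightarrow> (\<And>\<alpha>. \<alpha> \<in> supp p \<Longrightarrow> P (W \<alpha>)) \<Longrightarrow> ev b p \<in> above P"
  by (auto simp: above_def)

lemma aboveE:
  assumes "f \<in> above P"
  obtains p where "p \<in> polys n" "ev b p = f" "\<And>\<alpha>. \<alpha> \<in> supp p \<Longrightarrow> P (W \<alpha>)"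
  using assms unfolding above_def by blast

text \<open>Closure of the filtration under sums and products can then be read off from
  representatives. In the strict case the finite support provides a least weight, still above
  \<open>l\<close>, to which \<open>val_ge\<close> applies.\<close>

lemma filt_above:
  assumes l: "l \<in> rat_space d"
  shows "(f \<in> Fge l \<longleftrightarrow> f \<in> above ((\<le>) l)) \<and> (f \<in> Fgt l \<longleftrightarrow> f \<in> above ((<) l))"
proof (cases "f = 0")
  case True
  have "f \<in> above P" for P using aboveI[of 0 P] True by simp
  then show ?thesis using True by (simp add: filt_ge_def filt_gt_def)
next
  case False
  obtain p where p: "p \<in> polys n" "ev b p = f" "\<And>\<alpha>. \<alpha> \<in> supp p \<Longrightarrow> val f \<le> W \<alpha>"
    by (rule val_witness[OF False]) (rule that)
  have "f \<in> above ((\<le>) l)" if "l \<le> val f"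
    using aboveI[OF p(1), of "(\<le>) l"] p(2,3) that by (auto intro: order_trans)
  moreover have "f \<in> above ((<) l)" if "l < val f"
    using aboveI[OF p(1), of "(<) l"] p(2,3) that by (auto intro: less_le_trans)
  moreover have "l \<le> val f" if fa: "f \<in> above ((\<le>) l)"
  proof -
    obtain q where "q \<in> polys n" "ev b q = f" "\<And>\<alpha>. \<alpha> \<in> supp q \<Longrightarrow> l \<le> W \<alpha>"
      using fa by (rule aboveE) (rule that)
    then show ?thesis using val_ge[of q l] False by simp
  qed
  moreover have "l < val f" if fa: "f \<in> above ((<) l)"
  proof -
    obtain q where q: "q \<in> polys n" "ev b q = f" "\<And>\<alpha>. \<alpha> \<in> supp q \<Longrightarrow> l < W \<alpha>"
      using fa by (rule aboveE) (rule that)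
    then have "supp q \<noteq> {}" using False by auto
    then have "Min (W ` supp q) \<in> W ` supp q" by (intro Min_in) auto
    then have "l < Min (W ` supp q)" using q(3) by auto
    also have "Min (W ` supp q) \<le> val (ev b q)" using q False by (intro val_ge) auto
    finally show ?thesis using q(2) by simp
  qed
  moreover have "f \<in> Fge l \<longleftrightarrow> l \<le> val f" "f \<in> Fgt l \<longleftrightarrow> l < val f"
    using False l val_space by (auto simp: filt_ge_def filt_gt_def lex_rel_def)
  ultimately show ?thesis by blast
qed

lemma Fge_above: "l \<in> rat_space d \<Longrightarrow> Fge l = above ((\<le>) l)"
  and Fgt_above: "l \<in> rat_space d \<Longrightarrow> Fgt l = above ((<) l)"
  using filt_above by (simp_all add: set_eq_iff)

lemma FgeI: "l \<in> rat_space d \<Longrightarrow> p \<in> polys n \<Longrightarrow> (\<And>\<alpha>. \<alpha> \<in> supp p \<Longrightarrow> l \<le> W \<alpha>) \<Longrightarrow> ev b p \<in> Fge l"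
  and FgtI: "l \<in> rat_space d \<Longrightarrow> p \<in> polys n \<Longrightarrow> (\<And>\<alpha>. \<alpha> \<in> supp p \<Longrightarrow> l < W \<alpha>) \<Longrightarrow> ev b p \<in> Fgt l"
  by (simp_all add: Fge_above Fgt_above aboveI)

lemma above_add:
  assumes "f \<in> above P" "g \<in> above P" shows "f + g \<in> above P"
proof -
  obtain p where p: "p \<in> polys n" "ev b p = f" "\<And>\<alpha>. \<alpha> \<in> supp p \<Longrightarrow> P (W \<alpha>)"
    using assms(1) by (rule aboveE) (rule that)
  obtain q where q: "q \<in> polys n" "ev b q = g" "\<And>\<alpha>. \<alpha> \<in> supp q \<Longrightarrow> P (W \<alpha>)"
    using assms(2) by (rule aboveE) (rule that)
  have "ev b (p + q) \<in> above P"
    by (rule aboveI) (use p q keys_add[of p q] in \<open>auto intro: polys_add\<close>)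
  then show ?thesis by (simp add: ev_add p q)
qed

lemma above_uminus: "f \<in> above P \<Longrightarrow> - f \<in> above P"
  by (erule aboveE) (auto simp: ev_uminus[symmetric] polys_uminus intro!: aboveI)

lemma above_mult:
  assumes "f \<in> above P" "g \<in> above Q" "\<And>x y. P x \<Longrightarrow> Q y \<Longrightarrow> R (x + y)"
  shows "f * g \<in> above R"
proof -
  obtain p q where a: "f = ev b p" "g = ev b q" "p \<in> polys n" "q \<in> polys n"
    "\<forall>\<alpha>\<in>supp p. P (W \<alpha>)" "\<forall>\<alpha>\<in>supp q. Q (W \<alpha>)"
    using assms(1,2) unfolding above_def by blast
  have "ev b (p * q) \<in> above R"
  proof (rule aboveI)
    fix \<alpha> assume "\<alpha> \<in> supp (p * q)"
    then obtain \<beta> \<gamma> where "\<alpha> = \<beta> + \<gamma>" "\<beta> \<in> supp p" "\<gamma> \<in> supp q" using keys_mult[of p q] by blast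
    then show "R (W \<alpha>)" using a assms(3) by (simp add: W_add)
  qed (use a in \<open>auto intro: polys_mult\<close>)
  then show ?thesis by (simp add: a ev_mult)
qed

lemma Fgt_subset: "Fgt l \<subseteq> Fge l" by (auto simp: filt_gt_def filt_ge_def)
lemma F_0: "0 \<in> Fge l" "0 \<in> Fgt l" by (auto simp: filt_gt_def filt_ge_def)

lemma Fge_add: "l \<in> rat_space d \<Longrightarrow> f \<in> Fge l \<Longrightarrow> g \<in> Fge l \<Longrightarrow> f + g \<in> Fge l"
  and Fgt_add: "l \<in> rat_space d \<Longrightarrow> f \<in> Fgt l \<Longrightarrow> g \<in> Fgt l \<Longrightarrow> f + g \<in> Fgt l"
  by (simp_all only: Fge_above Fgt_above above_add)

lemma Fge_uminus: "l \<in> rat_space d \<Longrightarrow> f \<in> Fge l \<Longrightarrow> - f \<in> Fge l"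
  and Fgt_uminus: "l \<in> rat_space d \<Longrightarrow> f \<in> Fgt l \<Longrightarrow> - f \<in> Fgt l"
  by (simp_all only: Fge_above Fgt_above above_uminus)

lemma Fge_mult:
  assumes "l \<in> rat_space d" "m \<in> rat_space d" "f \<in> Fge l" "g \<in> Fge m" shows "f * g \<in> Fge (l + m)"
  using assms(3,4) unfolding assms(1,2)[THEN Fge_above] rat_space_add[OF assms(1,2), THEN Fge_above]
  by (rule above_mult) (rule add_mono)

lemma Fgt_mult:
  assumes "l \<in> rat_space d" "m \<in> rat_space d" "f \<in> Fgt l" "g \<in> Fge m" shows "f * g \<in> Fgt (l + m)"
  using assms(3,4) unfolding assms(1)[THEN Fgt_above] assms(2)[THEN Fge_above] rat_space_add[OF assms(1,2), THEN Fgt_above]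
  by (rule above_mult) (rule add_less_le_mono)

text \<open>The kernel of the comparison map in one degree: \<open>J_raise\<close> moves the value
  of a form in \<open>J\<close> strictly up, while a form outside \<open>J\<close> attains its own
  degree as value.\<close>

lemma Fgt_homogeneous:
  assumes l: "l \<in> rat_space d" and h: "h \<in> polys n" "\<And>\<alpha>. \<alpha> \<in> supp h \<Longrightarrow> W \<alpha> = l"
  shows "ev b h \<in> Fgt l \<longleftrightarrow> h \<in> J"
proof
  assume "h \<in> J"
  then obtain q where "q \<in> polys n" "ev b q = ev b h" "\<forall>\<alpha>\<in>supp q. l < W \<alpha>"
    using J_raise[of h l] h(2) by blast
  then show "ev b h \<in> Fgt l" using FgtI[OF l, of q] by simp
next
  assume f: "ev b h \<in> Fgt l"
  show "h \<in> J"
  proof (rule ccontr)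
    assume "h \<notin> J"
    moreover have "wlevel W l h = h" using h(2) by (rule res_True)
    ultimately have "ev b h \<noteq> 0" "val (ev b h) = l" using val_eqI[of h l] h by auto
    then show False using f by (simp add: filt_gt_def)
  qed
qed

lemma valuation_val: "valuation \<phi> d (lex_rel d) val"
  unfolding valuation_def
proof (intro conjI allI impI)
  fix f g :: 'a assume fg: "f \<noteq> 0" "g \<noteq> 0" "f + g \<noteq> 0"
  define l where "l = min_wrt (lex_rel d) (val f) (val g)"
  have sp: "val f \<in> rat_space d" "val g \<in> rat_space d" "val (f + g) \<in> rat_space d" using fg val_space by auto
  have l: "l \<in> rat_space d" "l \<le> val f" "l \<le> val g"
    using sp by (auto simp: l_def min_wrt_def lex_rel_def)
  have "f \<in> Fge l" "g \<in> Fge l" using fg l sp by (auto simp: filt_ge_def lex_rel_def)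
  then have "f + g \<in> Fge l" by (rule Fge_add[OF l(1)])
  then show "(min_wrt (lex_rel d) (val f) (val g), val (f + g)) \<in> lex_rel d"
    using fg by (simp add: filt_ge_def l_def)
qed (rule val_space val_mult val_scalar; assumption)+

section \<open>Residue classes and the pieces of the associated graded algebra\<close>

abbreviation cls :: "ratvec \<Rightarrow> 'a \<Rightarrow> 'a set" where "cls l f \<equiv> gr_class (lex_rel d) val l f"
abbreviation piece :: "ratvec \<Rightarrow> 'a set monoid" where "piece l \<equiv> gr_piece (lex_rel d) val l"

lemma cls_eq: "cls l f = (\<lambda>h. h + f) ` Fgt l"
  by (auto simp: gr_class_def a_r_coset_def r_coset_def ring_of_type_algebra_def)

lemma cls_eq_iff:
  assumes l: "l \<in> rat_space d"
  shows "cls l f = cls l g \<longleftrightarrow> f - g \<in> Fgt l"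
proof
  assume "cls l f = cls l g"
  moreover have "f \<in> cls l f" unfolding cls_eq using F_0 by force
  ultimately obtain h where "h \<in> Fgt l" "f = h + g" unfolding cls_eq by blast
  then show "f - g \<in> Fgt l" by simp
next
  have *: "cls l f \<subseteq> cls l g" if "f - g \<in> Fgt l" for f g
  proof
    fix x assume "x \<in> cls l f"
    then obtain h where "h \<in> Fgt l" "x = h + f" unfolding cls_eq by blast
    then have "h + (f - g) \<in> Fgt l" "x = (h + (f - g)) + g" using Fgt_add[OF l] that by auto
    then show "x \<in> cls l g" unfolding cls_eq by blast
  qed
  assume fg: "f - g \<in> Fgt l"
  then have "g - f \<in> Fgt l" using Fgt_uminus[OF l fg] by simp
  with fg show "cls l f = cls l g" using * by blast
qed

lemma carrier_piece: "carrier (piece l) = cls l ` Fge l"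
  by (auto simp: gr_piece_def FactGroup_def RCOSETS_def gr_class_def a_r_coset_def r_coset_def
      ring_of_type_algebra_def)

lemma one_piece: "\<one>\<^bsub>piece l\<^esub> = cls l 0"
  by (simp add: gr_piece_def cls_eq)

lemma mult_piece:
  assumes l: "l \<in> rat_space d"
  shows "cls l f \<otimes>\<^bsub>piece l\<^esub> cls l g = cls l (f + g)"
proof -
  have "cls l f \<otimes>\<^bsub>piece l\<^esub> cls l g = {x + y | x y. x \<in> cls l f \<and> y \<in> cls l g}"
    by (auto simp: gr_piece_def set_mult_def ring_of_type_algebra_def)
  also have "\<dots> = cls l (f + g)"
  proof
    show "{x + y | x y. x \<in> cls l f \<and> y \<in> cls l g} \<subseteq> cls l (f + g)"
    proof clarify
      fix x y assume "x \<in> cls l f" "y \<in> cls l g"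
      then obtain h k where "h \<in> Fgt l" "k \<in> Fgt l" "x = h + f" "y = k + g" unfolding cls_eq by blast
      then have "h + k \<in> Fgt l" "x + y = (h + k) + (f + g)" using Fgt_add[OF l] by auto
      then show "x + y \<in> cls l (f + g)" unfolding cls_eq by blast
    qed
    show "cls l (f + g) \<subseteq> {x + y | x y. x \<in> cls l f \<and> y \<in> cls l g}"
    proof
      fix z assume "z \<in> cls l (f + g)"
      then obtain h where h: "h \<in> Fgt l" "z = h + (f + g)" unfolding cls_eq by blast
      have "h + f \<in> cls l f" "0 + g \<in> cls l g" unfolding cls_eq using h F_0 by blast+
      moreover have "z = (h + f) + (0 + g)" using h by simp
      ultimately show "z \<in> {x + y | x y. x \<in> cls l f \<and> y \<in> cls l g}" by blast
    qed
  qed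
  finally show ?thesis .
qed

lemma comm_group_piece:
  assumes l: "l \<in> rat_space d" shows "comm_group (piece l)"
proof (rule comm_groupI)
  fix x assume "x \<in> carrier (piece l)"
  then obtain f where f: "x = cls l f" "f \<in> Fge l" by (auto simp: carrier_piece)
  then show "\<exists>y\<in>carrier (piece l). y \<otimes>\<^bsub>piece l\<^esub> x = \<one>\<^bsub>piece l\<^esub>"
    using Fge_uminus[OF l] by (intro bexI[of _ "cls l (- f)"]) (auto simp: carrier_piece mult_piece[OF l] one_piece)
qed (use l in \<open>auto simp: carrier_piece mult_piece[OF l] one_piece F_0 Fge_add[OF l] add_ac\<close>)

lemma finprod_cls:
  assumes l: "l \<in> rat_space d" and "finite V" "\<And>a. a \<in> V \<Longrightarrow> f a \<in> Fge l"
  shows "finprod (piece l) (\<lambda>a. cls l (f a)) V = cls l (\<Sum>a\<in>V. f a) \<and> (\<Sum>a\<in>V. f a) \<in> Fge l"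
  using assms(2,3)
proof (induction V rule: finite_induct)
  case empty
  interpret comm_group "piece l" by (rule comm_group_piece[OF l])
  show ?case by (simp add: one_piece F_0)
next
  case (insert a V)
  interpret comm_group "piece l" by (rule comm_group_piece[OF l])
  have "finprod (piece l) (\<lambda>a. cls l (f a)) (insert a V) = cls l (f a) \<otimes>\<^bsub>piece l\<^esub> finprod (piece l) (\<lambda>a. cls l (f a)) V"
    using insert by (intro finprod_insert) (auto simp: carrier_piece)
  then show ?case using insert mult_piece[OF l] Fge_add[OF l] by simp
qed

lemma gr_class_mult_cls:
  assumes lm: "l \<in> rat_space d" "m \<in> rat_space d" and fg: "f \<in> Fge l" "g \<in> Fge m"
  shows "gr_class_mult (lex_rel d) val l m (cls l f) (cls m g) = cls (l + m) (f * g)"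
proof -
  have "cls (l + m) (x * y) = cls (l + m) (f * g)" if xy: "x \<in> cls l f" "y \<in> cls m g" for x y
  proof -
    obtain h k where hk: "h \<in> Fgt l" "k \<in> Fgt m" "x = h + f" "y = k + g" using xy unfolding cls_eq by blast
    have "h * (k + g) \<in> Fgt (l + m)"
      using hk fg Fgt_subset[of m] by (intro Fgt_mult lm Fge_add) auto
    moreover have "k * f \<in> Fgt (m + l)" using hk fg by (intro Fgt_mult lm)
    ultimately have "h * (k + g) + k * f \<in> Fgt (l + m)"
      using Fgt_add[OF rat_space_add[OF lm]] by (simp add: add.commute)
    moreover have "x * y - f * g = h * (k + g) + k * f" by (simp add: hk algebra_simps)
    ultimately show ?thesis using cls_eq_iff[OF rat_space_add[OF lm]] by simp
  qed
  moreover have "f \<in> cls l f" "g \<in> cls m g" unfolding cls_eq using F_0 by force+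
  ultimately show ?thesis unfolding gr_class_mult_def by blast
qed

end

section \<open>The comparison map from the polynomial ring to the associated graded algebra\<close>

context graded_degeneration begin

abbreviation grA :: "(ratvec \<Rightarrow> 'a set) ring" where "grA \<equiv> gr_alg d (lex_rel d) val"

text \<open>Each \<open>W\<close>-component is sent to the class of its value in its own degree; by
  \<open>Fgt_homogeneous\<close> that class vanishes exactly when the component lies in
  \<open>J\<close>.\<close>

definition gr_map :: "'k mpoly \<Rightarrow> ratvec \<Rightarrow> 'a set" where
  "gr_map p = (\<lambda>c\<in>rat_space d. cls c (ev b (wlevel W c p)))"

lemma wlevel_Fge: "p \<in> polys n \<Longrightarrow> c \<in> rat_space d \<Longrightarrow> ev b (wlevel W c p) \<in> Fge c"
  by (rule FgeI) (auto simp: polys_res supp_res)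

lemma group_piece: "c \<in> rat_space d \<Longrightarrow> group (piece c)"
  using comm_group_piece comm_group.axioms(2) by blast

lemma carrier_grA:
  "carrier grA = {x \<in> \<Pi>\<^sub>E c\<in>rat_space d. carrier (piece c). finite {c \<in> rat_space d. x c \<noteq> \<one>\<^bsub>piece c\<^esub>}}"
proof -
  have "carrier grA = carrier (sum_group (rat_space d) piece)" by (simp add: gr_alg_def Let_def)
  also have "\<dots> = {x \<in> \<Pi>\<^sub>E c\<in>rat_space d. carrier (piece c). finite {c \<in> rat_space d. x c \<noteq> \<one>\<^bsub>piece c\<^esub>}}"
    by (rule carrier_sum_group) (rule group_piece)
  finally show ?thesis .
qed

lemma add_grA: "x \<oplus>\<^bsub>grA\<^esub> y = (\<lambda>c\<in>rat_space d. x c \<otimes>\<^bsub>piece c\<^esub> y c)"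
  by (simp add: gr_alg_def Let_def)
lemma zero_grA: "\<zero>\<^bsub>grA\<^esub> = (\<lambda>c\<in>rat_space d. \<one>\<^bsub>piece c\<^esub>)"
  by (simp add: gr_alg_def Let_def)
lemma one_grA: "\<one>\<^bsub>grA\<^esub> = gr_homogeneous d (lex_rel d) val 0 1"
  by (simp add: gr_alg_def Let_def)
lemma mult_grA: "x \<otimes>\<^bsub>grA\<^esub> y = (\<lambda>c\<in>rat_space d.
    finprod (piece c) (\<lambda>a. gr_class_mult (lex_rel d) val a (c - a) (x a) (y (c - a)))
      {a \<in> rat_space d. x a \<noteq> \<one>\<^bsub>piece a\<^esub>})"
  by (simp add: gr_alg_def Let_def)

lemma gr_map_one_iff:
  assumes p: "p \<in> polys n" and c: "c \<in> rat_space d"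
  shows "gr_map p c = \<one>\<^bsub>piece c\<^esub> \<longleftrightarrow> ev b (wlevel W c p) \<in> Fgt c"
  using c by (simp add: gr_map_def one_piece cls_eq_iff)

lemma gr_map_support:
  assumes "p \<in> polys n"
  shows "{c \<in> rat_space d. gr_map p c \<noteq> \<one>\<^bsub>piece c\<^esub>} \<subseteq> W ` supp p"
proof
  fix c assume c: "c \<in> {c \<in> rat_space d. gr_map p c \<noteq> \<one>\<^bsub>piece c\<^esub>}"
  show "c \<in> W ` supp p"
  proof (rule ccontr)
    assume "c \<notin> W ` supp p"
    then have "wlevel W c p = 0" by (intro res_False) auto
    then show False using c gr_map_one_iff[OF assms, of c] F_0 by simp
  qed
qed

lemma gr_map_carrier:
  assumes "p \<in> polys n" shows "gr_map p \<in> carrier grA"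
proof -
  have "finite {c \<in> rat_space d. gr_map p c \<noteq> \<one>\<^bsub>piece c\<^esub>}"
    using gr_map_support[OF assms] by (rule finite_subset) simp
  then show ?thesis
    unfolding carrier_grA using wlevel_Fge[OF assms] by (auto simp: gr_map_def carrier_piece)
qed

lemma gr_map_add:
  assumes "p \<in> polys n" "q \<in> polys n" shows "gr_map (p + q) = gr_map p \<oplus>\<^bsub>grA\<^esub> gr_map q"
  unfolding add_grA by (rule ext) (simp add: gr_map_def res_add ev_add mult_piece)

lemma gr_map_homogeneous:
  assumes h: "h \<in> polys n" "\<And>\<alpha>. \<alpha> \<in> supp h \<Longrightarrow> W \<alpha> = a"
  shows "gr_map h = gr_homogeneous d (lex_rel d) val a (ev b h)"
proof
  fix c
  have "wlevel W c h = h" if "c = a" using h that by (intro res_True) auto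
  moreover have "wlevel W c h = 0" if "c \<noteq> a" using h that by (intro res_False) auto
  ultimately show "gr_map h c = gr_homogeneous d (lex_rel d) val a (ev b h) c"
    by (auto simp: gr_map_def gr_homogeneous_def one_piece)
qed

lemma wlevel_mult_homogeneous:
  assumes u: "\<And>\<alpha>. \<alpha> \<in> supp u \<Longrightarrow> W \<alpha> = a"
  shows "wlevel W c (u * q) = u * wlevel W (c - a) q"
proof -
  define q' where "q' = q - wlevel W (c - a) q"
  have q': "W \<alpha> \<noteq> c - a" if "\<alpha> \<in> supp q'" for \<alpha>
    using that by (auto simp: q'_def supp_minus_res)
  have "u * q = u * wlevel W (c - a) q + u * q'" by (simp add: q'_def algebra_simps)
  then have "wlevel W c (u * q) = wlevel W c (u * wlevel W (c - a) q) + wlevel W c (u * q')"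
    by (simp only: res_add)
  also have "wlevel W c (u * wlevel W (c - a) q) = u * wlevel W (c - a) q"
  proof (rule res_True)
    fix \<alpha> assume "\<alpha> \<in> supp (u * wlevel W (c - a) q)"
    then obtain \<beta> \<gamma> where "\<alpha> = \<beta> + \<gamma>" "\<beta> \<in> supp u" "\<gamma> \<in> supp (wlevel W (c - a) q)"
      using keys_mult[of u "wlevel W (c - a) q"] by blast
    then show "W \<alpha> = c" using u by (simp add: W_add supp_res)
  qed
  also have "wlevel W c (u * q') = 0"
  proof (rule res_False)
    fix \<alpha> assume "\<alpha> \<in> supp (u * q')"
    then obtain \<beta> \<gamma> where "\<alpha> = \<beta> + \<gamma>" "\<beta> \<in> supp u" "\<gamma> \<in> supp q'"
      using keys_mult[of u q'] by blast
    then show "W \<alpha> \<noteq> c" using u[of \<beta>] q'[of \<gamma>] by (auto simp: W_add)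
  qed
  finally show ?thesis by simp
qed

lemma wlevel_convolution:
  "wlevel W c (p * q) = (\<Sum>a\<in>W ` supp p. wlevel W a p * wlevel W (c - a) q)"
proof -
  have "p * q = (\<Sum>a\<in>W ` supp p. wlevel W a p * q)"
    by (simp add: sum_distrib_right[symmetric] sum_res_levels)
  then have "wlevel W c (p * q) = (\<Sum>a\<in>W ` supp p. wlevel W c (wlevel W a p * q))"
    by (simp only: res_sum)
  also have "\<dots> = (\<Sum>a\<in>W ` supp p. wlevel W a p * wlevel W (c - a) q)"
    by (rule sum.cong[OF refl], rule wlevel_mult_homogeneous) (simp add: supp_res)
  finally show ?thesis .
qed

lemma W_supp_space: "p \<in> polys n \<Longrightarrow> W ` supp p \<subseteq> rat_space d"
  using polysD W_space by blast

lemma Fgt_sum: "l \<in> rat_space d \<Longrightarrow> (\<And>a. a \<in> V \<Longrightarrow> f a \<in> Fgt l) \<Longrightarrow> sum f V \<in> Fgt l"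
  by (induction V rule: infinite_finite_induct) (auto intro: F_0 Fgt_add)

text \<open>The product in \<open>grA\<close> sums over the degrees \<open>V\<close> in which the
  left factor is nonzero, the product of polynomials over all weights \<open>L\<close> of
  \<open>p\<close>. The degrees in \<open>L - V\<close> contribute elements of the strict filtration
  step, which do not affect the class.\<close>

lemma gr_map_mult:
  assumes p: "p \<in> polys n" and q: "q \<in> polys n" shows "gr_map (p * q) = gr_map p \<otimes>\<^bsub>grA\<^esub> gr_map q"
proof
  fix c
  show "gr_map (p * q) c = (gr_map p \<otimes>\<^bsub>grA\<^esub> gr_map q) c"
  proof (cases "c \<in> rat_space d")
    case False
    then show ?thesis by (simp add: gr_map_def mult_grA)
  next
    case c: True
    interpret comm_group "piece c" by (rule comm_group_piece[OF c])
    define V where "V = {a \<in> rat_space d. gr_map p a \<noteq> \<one>\<^bsub>piece a\<^esub>}"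
    define L where "L = W ` supp p"
    define f where "f a = ev b (wlevel W a p) * ev b (wlevel W (c - a) q)" for a
    have VL: "V \<subseteq> L" unfolding V_def L_def using p by (rule gr_map_support)
    have fL: "finite L" by (simp add: L_def)
    have Ld: "L \<subseteq> rat_space d" unfolding L_def using p by (rule W_supp_space)
    have f: "f a \<in> Fge c" if "a \<in> L" for a
    proof -
      have a: "a \<in> rat_space d" "c - a \<in> rat_space d" using that Ld c by (auto intro: rat_space_diff)
      show ?thesis using Fge_mult[OF a wlevel_Fge[OF p a(1)] wlevel_Fge[OF q a(2)]] by (simp add: f_def)
    qed
    have cm: "gr_class_mult (lex_rel d) val a (c - a) (gr_map p a) (gr_map q (c - a)) = cls c (f a)" if "a \<in> V" for a
    proof -
      have a: "a \<in> rat_space d" "c - a \<in> rat_space d" using that VL Ld c by (auto intro: rat_space_diff)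
      show ?thesis
        using gr_class_mult_cls[OF a wlevel_Fge[OF p a(1)] wlevel_Fge[OF q a(2)]] a by (simp add: gr_map_def f_def)
    qed
    have "(gr_map p \<otimes>\<^bsub>grA\<^esub> gr_map q) c = finprod (piece c) (\<lambda>a. gr_class_mult (lex_rel d) val a (c - a) (gr_map p a) (gr_map q (c - a))) V"
      using c by (simp add: mult_grA V_def)
    also have "\<dots> = finprod (piece c) (\<lambda>a. cls c (f a)) V"
      by (rule finprod_cong') (use cm f VL in \<open>auto simp: carrier_piece\<close>)
    also have "\<dots> = cls c (\<Sum>a\<in>V. f a)"
      using finprod_cls[OF c, of V f] finite_subset[OF VL fL] f VL by blast
    also have "\<dots> = cls c (\<Sum>a\<in>L. f a)"
    proof -
      have "f a \<in> Fgt c" if "a \<in> L - V" for a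
      proof -
        have a: "a \<in> rat_space d" "c - a \<in> rat_space d" using that Ld c by (auto intro: rat_space_diff)
        then have "ev b (wlevel W a p) \<in> Fgt a" using that gr_map_one_iff[OF p a(1)] by (simp add: V_def)
        from Fgt_mult[OF a this wlevel_Fge[OF q a(2)]] show ?thesis by (simp add: f_def)
      qed
      then have "(\<Sum>a\<in>L - V. f a) \<in> Fgt c"
        by (rule Fgt_sum[OF c])
      moreover have "(\<Sum>a\<in>L. f a) - (\<Sum>a\<in>V. f a) = (\<Sum>a\<in>L - V. f a)" using sum_diff[OF fL VL, of f] by simp
      ultimately show ?thesis using cls_eq_iff[OF c] by metis
    qed
    also have "(\<Sum>a\<in>L. f a) = ev b (wlevel W c (p * q))"
      unfolding wlevel_convolution ev_sum ev_mult f_def L_def ..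
    finally have "(gr_map p \<otimes>\<^bsub>grA\<^esub> gr_map q) c = cls c (ev b (wlevel W c (p * q)))" .
    moreover have "gr_map (p * q) c = cls c (ev b (wlevel W c (p * q)))" using c by (simp add: gr_map_def)
    ultimately show ?thesis by (simp only:)
  qed
qed

lemma gr_map_hom: "gr_map \<in> ring_hom (mpoly_ring n) grA"
proof (rule ring_hom_memI)
  have "gr_map 1 = gr_homogeneous d (lex_rel d) val 0 (ev b 1)" by (rule gr_map_homogeneous) auto
  then show "gr_map \<one>\<^bsub>mpoly_ring n\<^esub> = \<one>\<^bsub>grA\<^esub>" by (simp add: one_grA)
qed (auto simp: gr_map_carrier gr_map_add gr_map_mult)

lemma gr_map_eq_zero_iff:
  assumes p: "p \<in> polys n" shows "gr_map p = \<zero>\<^bsub>grA\<^esub> \<longleftrightarrow> p \<in> J"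
proof -
  have "gr_map p = \<zero>\<^bsub>grA\<^esub> \<longleftrightarrow> (\<forall>c\<in>rat_space d. gr_map p c = \<one>\<^bsub>piece c\<^esub>)"
    unfolding zero_grA gr_map_def fun_eq_iff by (auto simp: restrict_def)
  also have "\<dots> \<longleftrightarrow> (\<forall>c\<in>rat_space d. wlevel W c p \<in> J)"
  proof (rule ball_cong[OF refl])
    fix c assume c: "c \<in> rat_space d"
    show "(gr_map p c = \<one>\<^bsub>piece c\<^esub>) = (wlevel W c p \<in> J)"
      unfolding gr_map_one_iff[OF p c] by (rule Fgt_homogeneous[OF c polys_res[OF p]]) (simp add: supp_res)
  qed
  also have "\<dots> \<longleftrightarrow> p \<in> J"
  proof
    assume a: "\<forall>c\<in>rat_space d. wlevel W c p \<in> J"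
    have "(\<Sum>c\<in>W ` supp p. wlevel W c p) \<in> J"
      using a W_supp_space[OF p] by (intro mpoly_ideal_sum[OF J_ideal]) auto
    then show "p \<in> J" by (simp add: sum_res_levels)
  qed (use J_homogeneous in blast)
  finally show ?thesis .
qed

text \<open>A class in degree \<open>c\<close> comes from a polynomial with weights at least
  \<open>c\<close>; dropping the terms of larger weight keeps the class and makes the polynomial
  homogeneous. The finitely many nonzero degrees are then added up.\<close>

lemma gr_map_surj: "gr_map ` polys n = carrier grA"
proof
  show "gr_map ` polys n \<subseteq> carrier grA" using gr_map_carrier by blast
  show "carrier grA \<subseteq> gr_map ` polys n"
  proof
    fix x assume x: "x \<in> carrier grA"
    define V where "V = {c \<in> rat_space d. x c \<noteq> \<one>\<^bsub>piece c\<^esub>}"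
    have V: "finite V" "V \<subseteq> rat_space d" using x by (auto simp: carrier_grA V_def)
    have "\<exists>p\<in>polys n. x c = cls c (ev b p) \<and> (\<forall>\<alpha>\<in>supp p. W \<alpha> = c)" if c: "c \<in> rat_space d" for c
    proof -
      have "x c \<in> carrier (piece c)" using x c by (auto simp: carrier_grA)
      then obtain f where f: "x c = cls c f" "f \<in> Fge c" by (auto simp: carrier_piece)
      obtain p where p: "p \<in> polys n" "ev b p = f" "\<And>\<alpha>. \<alpha> \<in> supp p \<Longrightarrow> c \<le> W \<alpha>"
        using f(2) unfolding Fge_above[OF c] by (rule aboveE) (rule that)
      have "c < W \<alpha>" if "\<alpha> \<in> supp (p - wlevel W c p)" for \<alpha>
      proof -
        have "\<alpha> \<in> supp p" "W \<alpha> \<noteq> c" using that by (auto simp: supp_minus_res)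
        then show ?thesis using p(3) by (auto simp: less_le)
      qed
      then have "ev b (p - wlevel W c p) \<in> Fgt c" using p(1) c by (intro FgtI) (auto intro: polys_diff polys_res)
      then have "cls c f = cls c (ev b (wlevel W c p))" using cls_eq_iff[OF c] p(2) by (simp add: ev_diff)
      then show ?thesis using f(1) p(1) by (intro bexI[of _ "wlevel W c p"]) (auto simp: supp_res polys_res)
    qed
    then have "\<forall>c\<in>rat_space d. \<exists>p. p \<in> polys n \<and> x c = cls c (ev b p) \<and> (\<forall>\<alpha>\<in>supp p. W \<alpha> = c)" by blast
    then obtain h where h: "\<forall>c\<in>rat_space d. h c \<in> polys n \<and> x c = cls c (ev b (h c)) \<and> (\<forall>\<alpha>\<in>supp (h c). W \<alpha> = c)"
      unfolding bchoice_iff by blast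
    define p where "p = (\<Sum>c\<in>V. h c)"
    have p: "p \<in> polys n" unfolding p_def using h V by (intro polys_sum) auto
    have lev: "wlevel W c p = (if c \<in> V then h c else 0)" if c: "c \<in> rat_space d" for c
    proof -
      have "wlevel W c p = (\<Sum>a\<in>V. wlevel W c (h a))" by (simp add: p_def res_sum)
      also have "\<dots> = (\<Sum>a\<in>V. if a = c then h c else 0)"
      proof (rule sum.cong[OF refl])
        fix a assume "a \<in> V"
        then have a: "a \<in> rat_space d" using V by blast
        show "wlevel W c (h a) = (if a = c then h c else 0)"
        proof (cases "a = c")
          case True
          then show ?thesis using h a by (auto intro!: res_True)
        next
          case False
          then show ?thesis using h a by (auto intro!: res_False)
        qed
      qed
      finally show ?thesis using V(1) by simp
    qed
    have "gr_map p = x"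
    proof
      fix c
      show "gr_map p c = x c"
      proof (cases "c \<in> rat_space d")
        case False
        then show ?thesis using x by (auto simp: gr_map_def carrier_grA PiE_def extensional_def)
      next
        case True
        then show ?thesis using h lev[OF True] by (cases "c \<in> V") (auto simp: gr_map_def V_def one_piece)
      qed
    qed
    then show "x \<in> gr_map ` polys n" using p by blast
  qed
qed

text \<open>The ring axioms are transported along the surjection \<open>gr_map\<close>, which avoids
  computing with nested convolutions.\<close>

lemma ring_grA: "ring grA"
proof -
  interpret R: cring "mpoly_ring n :: 'k mpoly ring" by (rule cring_mpoly_ring)
  have "ring (grA \<lparr>carrier := gr_map ` carrier (mpoly_ring n), zero := gr_map \<zero>\<^bsub>mpoly_ring n\<^esub>\<rparr>)"
    by (rule R.ring_hom_imp_img_ring[OF gr_map_hom])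
  moreover have "gr_map 0 = \<zero>\<^bsub>grA\<^esub>" using gr_map_eq_zero_iff[of 0] J_0 by simp
  ultimately show ?thesis by (simp add: gr_map_surj)
qed

lemma gr_map_const: "gr_map (mpoly_const c) = gr_const \<phi> d (lex_rel d) val c"
  unfolding gr_const_def mpoly_const_def
  by (subst gr_map_homogeneous[where a=0]) (auto simp: polys_sgl split: if_splits)

text \<open>The homomorphism theorem yields an isomorphism out of the quotient, so its inverse is
  the map wanted here; constants match because of \<open>gr_map_const\<close>.\<close>

lemma gr_alg_isomorphic:
  "alg_isomorphic grA (gr_const \<phi> d (lex_rel d) val) (mpoly_ring n Quot J)
     (\<lambda>c. J +>\<^bsub>mpoly_ring n\<^esub> mpoly_const c)"
proof -
  interpret R: cring "mpoly_ring n :: 'k mpoly ring" by (rule cring_mpoly_ring)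
  interpret h: ring_hom_ring "mpoly_ring n" grA gr_map
    by (rule ring_hom_ringI2[OF R.ring_axioms ring_grA gr_map_hom])
  have ker: "a_kernel (mpoly_ring n) grA gr_map = J"
    using gr_map_eq_zero_iff mpoly_idealD(1)[OF J_ideal] unfolding a_kernel_def' by auto
  define k where "k = (\<lambda>Z. the_elem (gr_map ` Z))"
  have iso: "k \<in> ring_iso (mpoly_ring n Quot J) grA"
    using h.FactRing_iso_set unfolding ker k_def by (simp add: gr_map_surj)
  have qr: "ring (mpoly_ring n Quot J)" by (rule ideal.quotient_is_ring[OF J_ideal])
  have k: "k (J +>\<^bsub>mpoly_ring n\<^esub> p) = gr_map p" if "p \<in> polys n" for p
    using h.the_elem_simp[of p] that unfolding ker k_def by simp
  have cst: "mpoly_const c \<in> polys n" for c :: 'k by (simp add: mpoly_const_def polys_sgl)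
  have "inv_into (carrier (mpoly_ring n Quot J)) k (gr_const \<phi> d (lex_rel d) val c) = J +>\<^bsub>mpoly_ring n\<^esub> mpoly_const c" for c
  proof -
    have "J +>\<^bsub>mpoly_ring n\<^esub> mpoly_const c \<in> carrier (mpoly_ring n Quot J)"
      using cst[of c] by (auto simp: FactRing_def A_RCOSETS_def' a_r_coset_def')
    moreover have "inj_on k (carrier (mpoly_ring n Quot J))"
      using iso by (auto simp: ring_iso_def bij_betw_def)
    ultimately show ?thesis using inv_into_f_f k[OF cst[of c]] gr_map_const by metis
  qed
  then show ?thesis
    unfolding alg_isomorphic_def using ring_iso_set_sym[OF qr iso] by blast
qed

text \<open>The surjection \<open>gr_map\<close> sends variables to the images of the generators and
  constants to constants, so generation of the polynomial ring carries over to
  \<open>grA\<close>.\<close>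

lemma khovanskii_basis_generators: "khovanskii_basis \<phi> d (lex_rel d) val (b ` {..<n})"
proof -
  interpret grA: ring grA by (rule ring_grA)
  interpret h: ring_hom_ring "mpoly_ring n" grA gr_map
    by (rule ring_hom_ringI2[OF cring.axioms(1)[OF cring_mpoly_ring] ring_grA gr_map_hom])
  define T where "T = range (gr_const \<phi> d (lex_rel d) val) \<union> gr_image d (lex_rel d) val ` (b ` {..<n} - {0})"
  have cst: "mpoly_const c \<in> polys n" for c :: 'k by (simp add: mpoly_const_def polys_sgl)
  have T_const: "gr_map (mpoly_const c) \<in> T" for c by (simp add: gr_map_const T_def)
  have var: "gr_map (sgl (sgl i 1) 1) = gr_image d (lex_rel d) val (b i)" if "i < n" for i
    unfolding gr_image_def val_generator(2)[OF that]
    by (subst gr_map_homogeneous[where a="W (sgl i 1)"]) (use that in \<open>auto simp: polys_sgl expos_sgl\<close>)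
  have T_var: "gr_map (sgl (sgl i 1) 1) \<in> T" if "i < n" for i
    unfolding var[OF that] T_def using val_generator(1)[OF that] that by blast
  have sub: "T \<subseteq> carrier grA"
  proof
    fix x assume "x \<in> T"
    then consider c where "x = gr_const \<phi> d (lex_rel d) val c" | i where "i < n" "x = gr_image d (lex_rel d) val (b i)"
      unfolding T_def by blast
    then show "x \<in> carrier grA"
    proof cases
      case 1
      show ?thesis unfolding 1 gr_map_const[symmetric] by (rule gr_map_carrier[OF cst])
    next
      case 2
      show ?thesis unfolding 2(2) var[OF 2(1), symmetric]
        using 2(1) by (intro gr_map_carrier polys_sgl expos_sgl)
    qed
  qed
  have mono: "gr_map (sgl \<alpha> 1) \<in> generate_ring grA T" if "\<alpha> \<in> expos n" for \<alpha>
  proof -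
    have "supp \<alpha> \<subseteq> {..<n}" using that by (simp add: expos_def)
    then have "\<alpha> \<in> expos n \<and> gr_map (sgl \<alpha> 1) \<in> generate_ring grA T"
    proof (induction rule: expo_induct)
      case zero
      have "gr_map (sgl 0 1) = \<one>\<^bsub>grA\<^esub>" using h.hom_one by simp
      then show ?case by (simp add: generate_ring.one)
    next
      case (step \<alpha> i)
      then have i: "i < n" by simp
      have "gr_map (sgl (\<alpha> + sgl i 1) 1) = gr_map (sgl \<alpha> 1 * sgl (sgl i 1) 1)" by (simp add: mult_single)
      also have "\<dots> = gr_map (sgl \<alpha> 1) \<otimes>\<^bsub>grA\<^esub> gr_map (sgl (sgl i 1) 1)"
        using step i by (intro gr_map_mult polys_sgl expos_sgl) auto
      also have "\<dots> \<in> generate_ring grA T"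
        using step(1) generate_ring.incl[OF T_var[OF i]] by (intro generate_ring.eng_mult) auto
      finally show ?case using step i by (simp add: expos_add expos_sgl)
    qed
    then show ?thesis by blast
  qed
  have "p \<in> polys n \<and> gr_map p \<in> generate_ring grA T" if "p \<in> polys n" for p
  proof -
    have "supp p \<subseteq> expos n" using that by (simp add: polys_def)
    then show ?thesis
    proof (induction rule: poly_induct)
      case (add p q)
      then show ?case by (auto simp: gr_map_add polys_add intro: generate_ring.eng_add)
    next
      case (sgl \<alpha> c)
      have "gr_map (sgl \<alpha> c) = gr_map (mpoly_const c * sgl \<alpha> 1)" by (simp add: mult_single mpoly_const_def)
      also have "\<dots> = gr_map (mpoly_const c) \<otimes>\<^bsub>grA\<^esub> gr_map (sgl \<alpha> 1)"
        using sgl by (intro gr_map_mult cst polys_sgl)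
      also have "\<dots> \<in> generate_ring grA T"
        by (rule generate_ring.eng_mult[OF generate_ring.incl[OF T_const] mono[OF sgl]])
      finally show ?case using sgl by (simp add: polys_sgl)
    qed (use expos_0 in blast)
  qed
  then have "carrier grA \<subseteq> generate_ring grA T" unfolding gr_map_surj[symmetric] by blast
  moreover have "generate_ring grA T \<subseteq> carrier grA" by (rule grA.generate_ring_incl[OF sub])
  ultimately show ?thesis
    unfolding khovanskii_basis_def alg_generates_def T_def by blast
qed

end

section \<open>Weight matrices\<close>

text \<open>The order of the list matters: the lexicographic order compares by its first vector
  first. Entries past the end of the list are 0, so the vectors fit into every
  \<open>rat_space d\<close> with \<open>length us \<le> d\<close>.\<close>

definition weight_vec :: "ratvec list \<Rightarrow> expo \<Rightarrow> ratvec" where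
  "weight_vec us \<alpha> = (\<Sum>j<length us. sgl j (weight (us ! j) \<alpha>))"

lemma coef_weight_vec: "coef (weight_vec us \<alpha>) j = (if j < length us then weight (us ! j) \<alpha> else 0)"
  by (simp add: weight_vec_def lookup_sum lookup_single when_def)

lemma weight_vec_add: "weight_vec us (\<alpha> + \<beta>) = weight_vec us \<alpha> + weight_vec us \<beta>"
  by (rule poly_mapping_eqI) (simp add: coef_weight_vec lookup_add weight_add)

lemma weight_vec_space: "length us \<le> d \<Longrightarrow> weight_vec us \<alpha> \<in> rat_space d"
  by (auto simp: rat_space_def mem_supp coef_weight_vec split: if_splits)

lemma weight_sgl: "weight u (sgl i k) = coef u i * of_nat k"
  by (simp add: weight_def)

lemma sgl_one_eq_iff: "sgl i (1::rat) = sgl j 1 \<longleftrightarrow> i = j"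
proof
  assume "sgl i (1::rat) = sgl j 1"
  then have "coef (sgl i (1::rat)) i = coef (sgl j 1) i" by simp
  then show "i = j" by (simp add: lookup_single when_def split: if_splits)
qed simp

text \<open>The component for the vector weight is cut out by restricting to one row after another.
  A level with a nonzero entry beyond the last row is never attained, so its component is 0.\<close>

lemma weight_vec_homogeneous:
  assumes "\<And>u a h. u \<in> set us \<Longrightarrow> h \<in> J \<Longrightarrow> level u a h \<in> J" "0 \<in> J" "h \<in> J"
  shows "wlevel (weight_vec us) l h \<in> J"
proof -
  have step: "res (\<lambda>\<alpha>. \<forall>j<k. weight (us ! j) \<alpha> = coef l j) h \<in> J" if "k \<le> length us" for k
    using that
  proof (induction k)
    case 0
    have "res (\<lambda>\<alpha>. \<forall>j<0. weight (us ! j) \<alpha> = coef l j) h = h" by (rule res_True) simp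
    then show ?case using assms(3) by simp
  next
    case (Suc k)
    then have "level (us ! k) (coef l k) (res (\<lambda>\<alpha>. \<forall>j<k. weight (us ! j) \<alpha> = coef l j) h) \<in> J"
      by (intro assms(1)) auto
    moreover have "(\<lambda>\<alpha>. weight (us ! k) \<alpha> = coef l k \<and> (\<forall>j<k. weight (us ! j) \<alpha> = coef l j)) =
        (\<lambda>\<alpha>. \<forall>j<Suc k. weight (us ! j) \<alpha> = coef l j)"
      by (auto simp: fun_eq_iff less_Suc_eq)
    ultimately show ?case by (simp only: res_res)
  qed
  show ?thesis
  proof (cases "\<forall>j\<ge>length us. coef l j = 0")
    case True
    then have "(\<lambda>\<alpha>. weight_vec us \<alpha> = l) = (\<lambda>\<alpha>. \<forall>j<length us. weight (us ! j) \<alpha> = coef l j)"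
      by (auto simp: fun_eq_iff poly_mapping_eq_iff coef_weight_vec)
    then show ?thesis using step[of "length us"] by simp
  next
    case False
    then obtain j where "j \<ge> length us" "coef l j \<noteq> 0" by blast
    then have "weight_vec us \<alpha> \<noteq> l" for \<alpha> using coef_weight_vec[of us \<alpha> j] by auto
    then have "wlevel (weight_vec us) l h = 0" by (intro res_False)
    then show ?thesis using assms(2) by simp
  qed
qed

lemma coef_scaled_unit: "coef (scaleQ c (sgl j 1)) i = (if j = i then c else 0)"
  by (simp add: lookup_scaleQ lookup_single when_def)

lemma independent_units: "ratvec.independent ((\<lambda>j. sgl j 1) ` V)"
  unfolding ratvec.dependent_explicit
proof (rule notI, elim exE conjE bexE)
  fix t u and v :: ratvec
  assume t: "finite t" "t \<subseteq> (\<lambda>j. sgl j 1) ` V" "(\<Sum>v\<in>t. scaleQ (u v) v) = 0" "v \<in> t" "u v \<noteq> 0"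
  obtain j where j: "v = sgl j 1" using t(2,4) by blast
  have "coef (\<Sum>v\<in>t. scaleQ (u v) v) j = (\<Sum>w\<in>t. if w = v then u v else 0)"
    unfolding lookup_sum
  proof (rule sum.cong[OF refl])
    fix w assume "w \<in> t"
    then obtain i where "w = sgl i 1" using t(2) by blast
    then show "coef (scaleQ (u w) w) j = (if w = v then u v else 0)"
      by (auto simp: lookup_scaleQ j lookup_single when_def sgl_one_eq_iff)
  qed
  then show False using t by simp
qed

lemma vector_space_pair_rat: "vector_space_pair scaleQ ((*) :: rat \<Rightarrow> rat \<Rightarrow> rat)"
  by (intro vector_space_pair.intro ratvec.vector_space_axioms, unfold_locales) (simp_all add: algebra_simps)

lemma independent_nth:
  assumes "ratvec.independent (set us)" "distinct us" "(\<Sum>j<length us. scaleQ (w j) (us ! j)) = 0" "j < length us"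
  shows "w j = 0"
proof -
  have bij: "bij_betw ((!) us) {..<length us} (set us)" by (rule bij_betw_nth) (use assms in auto)
  define u where "u v = w (the_inv_into {..<length us} ((!) us) v)" for v
  have u: "u (us ! j) = w j" if "j < length us" for j
    using the_inv_into_f_f[OF bij_betw_imp_inj_on[OF bij]] that by (simp add: u_def)
  have "(\<Sum>v\<in>set us. scaleQ (u v) v) = (\<Sum>j<length us. scaleQ (u (us ! j)) (us ! j))"
    by (rule sum.reindex_bij_betw[OF bij, symmetric])
  also have "\<dots> = (\<Sum>j<length us. scaleQ (w j) (us ! j))" by (intro sum.cong) (auto simp: u)
  finally have "(\<Sum>v\<in>set us. scaleQ (u v) v) = 0" using assms(3) by simp
  then have "u (us ! j) = 0" using ratvec.independentD[OF assms(1), of "set us" u "us ! j"] assms(4) by simp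
  then show ?thesis using u[OF assms(4)] by simp
qed

text \<open>The row rank of the matrix with rows \<open>us\<close> is at most its column rank.\<close>

lemma independent_columns:
  assumes us: "ratvec.independent (set us)" "distinct us" "set us \<subseteq> rat_space n"
  obtains D where "D \<subseteq> {..<n}" "inj_on (\<lambda>i. weight_vec us (sgl i 1)) D"
    "ratvec.independent ((\<lambda>i. weight_vec us (sgl i 1)) ` D)" "length us \<le> card D"
proof -
  define M where "M i = weight_vec us (sgl i 1)" for i
  have cM: "coef (M i) j = (if j < length us then coef (us ! j) i else 0)" for i j
    by (simp add: M_def coef_weight_vec weight_sgl)
  interpret rq: vector_space_pair scaleQ "(*) :: rat \<Rightarrow> rat \<Rightarrow> rat" by (rule vector_space_pair_rat)
  obtain B where B: "B \<subseteq> M ` {..<n}" "ratvec.independent B" "M ` {..<n} \<subseteq> ratvec.span B"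
    by (rule ratvec.maximal_independent_subset)
  have units: "sgl j 1 \<in> ratvec.span B" if j: "j < length us" for j
  proof (rule ccontr)
    assume n: "sgl j 1 \<notin> ratvec.span B"
    have ind: "ratvec.independent (insert (sgl j 1) B)" by (rule ratvec.independent_insertI[OF n B(2)])
    \<comment> \<open>If a unit vector were outside the span of the columns, a linear functional
      could vanish on all columns and be 1 on it. The values \<open>w\<close> of the functional on
      the unit vectors would then give a nontrivial linear relation between the rows.\<close>
    obtain g where g: "Vector_Spaces.linear scaleQ (*) g"
      "\<forall>x\<in>insert (sgl j 1) B. g x = (if x = sgl j 1 then 1 else 0)"
      using rq.linear_independent_extend[OF ind, of "\<lambda>x. if x = sgl j 1 then 1 else 0"] by blast
    have gB: "g x = 0" if "x \<in> B" for x using g(2) that n ratvec.span_base[OF that] by auto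
    have gs: "g x = 0" if "x \<in> ratvec.span B" for x
      using rq.linear_eq_0_on_span[OF g(1) gB that] .
    define w where "w k = g (sgl k 1)" for k
    have "(\<Sum>k<length us. scaleQ (w k) (us ! k)) = 0"
    proof (rule poly_mapping_eqI)
      fix i
      show "coef (\<Sum>k<length us. scaleQ (w k) (us ! k)) i = coef 0 i"
      proof (cases "i < n")
        case True
        have "M i = (\<Sum>k<length us. scaleQ (coef (us ! k) i) (sgl k 1))"
          by (rule poly_mapping_eqI) (simp add: cM lookup_sum coef_scaled_unit)
        then have "g (M i) = (\<Sum>k<length us. coef (us ! k) i * w k)"
          by (simp add: rq.linear_sum[OF g(1)] rq.linear_scale[OF g(1)] w_def)
        moreover have "g (M i) = 0" using gs B(3) True by blast
        ultimately show ?thesis by (simp add: lookup_sum lookup_scaleQ mult.commute)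
      next
        case False
        have "coef (us ! k) i = 0" if "k < length us" for k
        proof -
          have "us ! k \<in> rat_space n" using us(3) nth_mem[OF that] by blast
          then have "i \<notin> supp (us ! k)" using False by (auto simp: rat_space_def)
          then show ?thesis by (simp add: mem_supp)
        qed
        then show ?thesis by (simp add: lookup_sum lookup_scaleQ)
      qed
    qed
    then have "w j = 0" using independent_nth[OF us(1,2) _ j] by blast
    moreover have "w j = 1" using g(2) by (simp add: w_def)
    ultimately show False by simp
  qed
  have "finite B" using B(1) by (rule finite_subset) simp
  have "card ((\<lambda>j. sgl j (1::rat)) ` {..<length us}) \<le> card B"
    using ratvec.independent_span_bound[OF \<open>finite B\<close> independent_units[of "{..<length us}"]] units by blast
  moreover have "inj_on (\<lambda>j. sgl j (1::rat)) {..<length us}"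
    by (rule inj_onI) (simp add: sgl_one_eq_iff)
  ultimately have r: "length us \<le> card B" by (simp add: card_image)
  obtain D where D: "D \<subseteq> {..<n}" "inj_on M D" "B = M ` D"
    using B(1) unfolding subset_image_inj by blast
  show ?thesis using that[of D] D B(2) r unfolding M_def by (simp add: card_image)
qed

lemma weight_vec_columns:
  assumes "finite D" "supp \<alpha> \<subseteq> D"
  shows "weight_vec us \<alpha> = (\<Sum>i\<in>D. scaleQ (of_nat (coef \<alpha> i)) (weight_vec us (sgl i 1)))"
  by (rule poly_mapping_eqI)
    (simp add: coef_weight_vec weight_sgl lookup_sum lookup_scaleQ weight_superset[OF assms] mult.commute)

text \<open>Equal weights would be a linear relation between the independent columns, with the
  differences of the exponents as coefficients.\<close>

lemma weight_vec_inj: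
  assumes D: "finite D" "inj_on (\<lambda>i. weight_vec us (sgl i 1)) D"
    "ratvec.independent ((\<lambda>i. weight_vec us (sgl i 1)) ` D)"
    and \<alpha>: "supp \<alpha> \<subseteq> D" "supp \<beta> \<subseteq> D" "weight_vec us \<alpha> = weight_vec us \<beta>"
  shows "\<alpha> = \<beta>"
proof (rule poly_mapping_eqI)
  fix i
  let ?M = "\<lambda>i. weight_vec us (sgl i 1)"
  show "coef \<alpha> i = coef \<beta> i"
  proof (cases "i \<in> D")
    case False
    then have "i \<notin> supp \<alpha>" "i \<notin> supp \<beta>" using \<alpha> by auto
    then show ?thesis by (simp add: mem_supp)
  next
    case True
    define c where "c i = (of_nat (coef \<alpha> i) - of_nat (coef \<beta> i) :: rat)" for i
    have "(\<Sum>i\<in>D. scaleQ (c i) (?M i)) = weight_vec us \<alpha> - weight_vec us \<beta>"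
      unfolding weight_vec_columns[OF D(1) \<alpha>(1)] weight_vec_columns[OF D(1) \<alpha>(2)]
      by (simp add: c_def ratvec.scale_left_diff_distrib sum_subtractf)
    then have z: "(\<Sum>i\<in>D. scaleQ (c i) (?M i)) = 0" using \<alpha>(3) by simp
    have "(\<Sum>v\<in>?M ` D. scaleQ (c (the_inv_into D ?M v)) v) = (\<Sum>i\<in>D. scaleQ (c i) (?M i))"
      unfolding sum.reindex[OF D(2)] by (intro sum.cong) (simp_all add: the_inv_into_f_f[OF D(2)] del: One_nat_def)
    then have "(\<Sum>v\<in>?M ` D. scaleQ (c (the_inv_into D ?M v)) v) = 0" using z by simp
    from ratvec.independentD[OF D(3) _ _ this, of "?M i"] D(1) True
    have "c i = 0" by (simp add: the_inv_into_f_f[OF D(2)] del: One_nat_def)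
    then show ?thesis by (simp add: c_def)
  qed
qed

text \<open>As \<open>W\<close> separates the monomials involved, the lowest form of a nonzero
  relation would be a single term, and \<open>J\<close> would contain a monomial.\<close>

lemma (in degeneration) algebraically_independent:
  assumes D: "D \<subseteq> {..<n}" and inj: "\<And>\<alpha> \<beta>. supp \<alpha> \<subseteq> D \<Longrightarrow> supp \<beta> \<subseteq> D \<Longrightarrow> W \<alpha> = W \<beta> \<Longrightarrow> \<alpha> = \<beta>"
    and p: "supp p \<subseteq> {\<alpha>. supp \<alpha> \<subseteq> D}" "ev b p = 0"
  shows "p = 0"
proof (rule ccontr)
  assume "p \<noteq> 0"
  then have "Min (W ` supp p) \<in> W ` supp p" by (intro Min_in) auto
  then obtain \<alpha> where \<alpha>: "\<alpha> \<in> supp p" "W \<alpha> = Min (W ` supp p)" by force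
  have le: "W \<alpha> \<le> W \<beta>" if "\<beta> \<in> supp p" for \<beta> unfolding \<alpha>(2) using that by (intro Min_le) auto
  have pn: "p \<in> polys n" using p(1) D by (auto simp: polys_def expos_def)
  have "wlevel W (W \<alpha>) p = sgl \<alpha> (coef p \<alpha>)"
  proof (rule poly_mapping_eqI)
    fix \<beta>
    have "\<beta> = \<alpha>" if "\<beta> \<in> supp p" "W \<beta> = W \<alpha>" using inj[of \<beta> \<alpha>] that \<alpha>(1) p(1) by blast
    then show "coef (wlevel W (W \<alpha>) p) \<beta> = coef (sgl \<alpha> (coef p \<alpha>)) \<beta>"
      by (cases "\<beta> \<in> supp p") (auto simp: coef_res lookup_single when_def mem_supp)
  qed
  then have "sgl \<alpha> (coef p \<alpha>) \<in> J" using J_rel[OF pn p(2) le] by simp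
  then have "sgl 0 (inverse (coef p \<alpha>)) * sgl \<alpha> (coef p \<alpha>) \<in> J"
    using mpoly_idealD(4)[OF J_ideal] polys_sgl[OF expos_0] by blast
  then show False using J_monomial[OF polysD[OF pn \<alpha>(1)]] \<alpha>(1) by (simp add: mult_single mem_supp)
qed

section \<open>Rank and discreteness of the set of values\<close>

lemma valuation_rank_ge:
  assumes "E \<subseteq> value_semigroup v" "finite E" "ratvec.independent E"
  shows "enat (card E) \<le> valuation_rank v"
proof -
  have "intmod.independent E"
    unfolding intmod.dependent_explicit
  proof (rule notI, elim exE conjE bexE)
    fix t u and x :: ratvec
    assume t: "finite t" "t \<subseteq> E" "(\<Sum>v\<in>t. scaleZ (u v) v) = 0" "x \<in> t" "u x \<noteq> 0"
    have "of_int (u x) = (0 :: rat)"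
      using ratvec.independentD[OF assms(3) t(1,2), of "\<lambda>v. of_int (u v)" x] t(3,4) by (simp add: scaleZ_def)
    then show False using t(5) by simp
  qed
  moreover have "E \<subseteq> intmod.span (value_semigroup v)" using assms(1) intmod.span_superset by blast
  ultimately show ?thesis unfolding valuation_rank_def using assms(2) by (intro Sup_upper) blast
qed

text \<open>On exponents each row takes values in the multiples of some \<open>1 / N\<close>, so
  confining every row to a small interval isolates a point. This is an open condition in the product
  topology since only finitely many coordinates are confined; all others are 0 anyway.\<close>

lemma discrete_weight_vec:
  "discrete ((\<lambda>x i. real_of_rat (coef x i)) ` weight_vec us ` expos n)"
proof (rule discreteI)
  let ?F = "\<lambda>x i. real_of_rat (coef x i)"
  let ?S = "?F ` weight_vec us ` expos n"
  fix y assume y: "y \<in> ?S"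
  then obtain \<alpha> where \<alpha>: "\<alpha> \<in> expos n" "y = ?F (weight_vec us \<alpha>)" by blast
  have "\<exists>N>0. \<forall>\<beta>\<in>expos n. \<bar>weight u \<beta> - weight u \<alpha>\<bar> < 1 / N \<longrightarrow> weight u \<beta> = weight u \<alpha>" for u :: ratvec
  proof -
    obtain w :: "expo \<Rightarrow> int" and N :: rat where N: "N > 0" "\<And>\<alpha> \<beta>. w (\<alpha> + \<beta>) = w \<alpha> + w \<beta>"
      "\<And>\<alpha>. \<alpha> \<in> expos n \<Longrightarrow> of_int (w \<alpha>) = N * weight u \<alpha>"
      by (rule integral_weight[of n u]) (rule that)
    have "weight u \<beta> = weight u \<alpha>" if \<beta>: "\<beta> \<in> expos n" "\<bar>weight u \<beta> - weight u \<alpha>\<bar> < 1 / N" for \<beta>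
    proof -
      have "\<bar>of_int (w \<beta>) - of_int (w \<alpha>) :: rat\<bar> = N * \<bar>weight u \<beta> - weight u \<alpha>\<bar>"
        unfolding N(3)[OF \<beta>(1)] N(3)[OF \<alpha>(1)] right_diff_distrib[symmetric] using N(1) by (simp add: abs_mult)
      also have "\<dots> < 1" using \<beta>(2) N(1) by (simp add: field_simps)
      finally have "\<bar>w \<beta> - w \<alpha>\<bar> < 1" by (metis of_int_abs of_int_diff of_int_less_1_iff)
      then have w: "w \<beta> = w \<alpha>" by simp
      have "N * weight u \<beta> = N * weight u \<alpha>"
        unfolding N(3)[OF \<beta>(1), symmetric] N(3)[OF \<alpha>(1), symmetric] w ..
      then show ?thesis using N(1) unfolding mult_cancel_left by auto
    qed
    then show ?thesis using N(1) by blast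
  qed
  then obtain N where N: "\<And>u. N u > 0"
    "\<And>u \<beta>. \<beta> \<in> expos n \<Longrightarrow> \<bar>weight u \<beta> - weight u \<alpha>\<bar> < 1 / N u \<Longrightarrow> weight u \<beta> = weight u \<alpha>"
    by metis
  define T where "T = (\<Inter>j<length us. {z :: nat \<Rightarrow> real. \<bar>z j - y j\<bar> < real_of_rat (1 / N (us ! j))})"
  have "open T"
    unfolding T_def
    by (intro open_INT finite_lessThan ballI open_Collect_less continuous_intros continuous_on_product_coordinates)
  moreover have "T \<inter> ?S = {y}"
  proof
    have "y \<in> T" using N(1) by (simp add: T_def)
    then show "{y} \<subseteq> T \<inter> ?S" using y by blast
    show "T \<inter> ?S \<subseteq> {y}"
    proof
      fix z assume z: "z \<in> T \<inter> ?S"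
      then obtain \<beta> where \<beta>: "\<beta> \<in> expos n" "z = ?F (weight_vec us \<beta>)" by blast
      have "weight (us ! j) \<beta> = weight (us ! j) \<alpha>" if j: "j < length us" for j
      proof -
        have "\<bar>z j - y j\<bar> < real_of_rat (1 / N (us ! j))" using z j unfolding T_def by blast
        then have "real_of_rat \<bar>weight (us ! j) \<beta> - weight (us ! j) \<alpha>\<bar> < real_of_rat (1 / N (us ! j))"
          using j by (simp add: \<alpha>(2) \<beta>(2) coef_weight_vec of_rat_diff[symmetric])
        then show ?thesis using N(2)[OF \<beta>(1)] unfolding of_rat_less by blast
      qed
      then have "weight_vec us \<beta> = weight_vec us \<alpha>" by (intro poly_mapping_eqI) (simp add: coef_weight_vec)
      then show "z \<in> {y}" by (simp add: \<alpha>(2) \<beta>(2))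
    qed
  qed
  ultimately show "y isolated_in ?S" unfolding isolated_in_def using y by blast
qed

lemma discrete_subset: "discrete T \<Longrightarrow> S \<subseteq> T \<Longrightarrow> discrete (S :: 'b::topological_space set)"
  unfolding discrete_def isolated_in_def
proof
  fix x assume a: "\<forall>x\<in>T. x \<in> T \<and> (\<exists>U. open U \<and> U \<inter> T = {x})" "S \<subseteq> T" "x \<in> S"
  then obtain U where U: "open U" "U \<inter> T = {x}" by blast
  then have "U \<inter> S = {x}" using a(2,3) by blast
  then show "x \<in> S \<and> (\<exists>U. open U \<and> U \<inter> S = {x})" using U(1) a(3) by blast
qed

theorem theorem1:
  fixes \<phi> :: "'k::field \<Rightarrow> 'a::idom"
    and b :: "nat \<Rightarrow> 'a"
    and n d :: nat
    and C :: "ratvec set"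
    and I :: "'k mpoly set"
  assumes "\<phi> \<in> ring_hom (ring_of_type_algebra :: 'k ring) (ring_of_type_algebra :: 'a ring)"
    and "alg_generates (ring_of_type_algebra :: 'a ring) \<phi> (b ` {..<n})"
    and "krull_dim (ring_of_type_algebra :: 'a ring) = enat d"
    and "I = relation_ideal n \<phi> b"
    and "prime_cone n I C"
  shows "\<exists>(r :: ratvec rel) (v :: 'a \<Rightarrow> ratvec).
    group_ordering d r \<and> valuation \<phi> d r v \<and> discrete_valuation v \<and>
    finite (b ` {..<n}) \<and> khovanskii_basis \<phi> d r v (b ` {..<n}) \<and>
    enat (cone_dim C) \<le> valuation_rank v \<and>
    alg_isomorphic (gr_alg d r v) (gr_const \<phi> d r v)
      (mpoly_ring n Quot init_ideal_cone n C I)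
      (\<lambda>c. init_ideal_cone n C I +>\<^bsub>mpoly_ring n\<^esub> mpoly_const c)"
proof -
  interpret scalar_hom \<phi> by unfold_locales (rule assms(1))
  have I: "I = rel b n" using assms(4) by (simp add: relation_ideal_rel)
  have "open_cone n I C" and prime: "primeideal (init_ideal_cone n C I) (mpoly_ring n)"
    using assms(5) unfolding prime_cone_def by (rule conjunct1, rule conjunct2)
  from this(1) have cone: "polyhedral_cone n C" "C \<subseteq> tropical_variety n I"
    "\<forall>u\<in>C. \<forall>u'\<in>C. init_ideal n u I = init_ideal n u' I"
    unfolding open_cone_def by - (elim conjE, assumption)+
  obtain u0 where u0: "u0 \<in> C" using cone(1) unfolding polyhedral_cone_def by blast
  have Cn: "C \<subseteq> rat_space n" using cone(2) by (auto simp: tropical_variety_def)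
  define J where "J = init_ideal n u0 I"
  have init_J: "init_ideal n u I = J" if "u \<in> C" for u unfolding J_def using bspec[OF bspec[OF cone(3) that] u0] .
  have cone_J: "init_ideal_cone n C I = J"
    unfolding init_ideal_cone_def 
  proof (rule the_equality)
    show "\<forall>u\<in>C. init_ideal n u I = J" using init_J by blast
    show "J' = J" if "\<forall>u\<in>C. init_ideal n u I = J'" for J'
      using bspec[OF that u0] unfolding J_def by (rule sym)
  qed
  \<comment> \<open>Choosing the basis inside \<open>C\<close> gives each of its vectors the initial
    ideal \<open>J\<close>, and hence makes \<open>J\<close> homogeneous for every row.\<close>
  obtain B where B: "B \<subseteq> C" "ratvec.independent B" "C \<subseteq> ratvec.span B"
    by (rule ratvec.maximal_independent_subset) (rule that)
  have "x \<in> ratvec.span ((\<lambda>j. sgl j 1) ` {..<n})" if x: "x \<in> rat_space n" for x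
  proof -
    have "coef x k = 0" if "\<not> k < n" for k using x that by (auto simp: rat_space_def mem_supp subset_iff)
    then have "x = (\<Sum>j<n. scaleQ (coef x j) (sgl j 1))"
      by (intro poly_mapping_eqI) (simp add: lookup_sum coef_scaled_unit)
    also have "\<dots> \<in> ratvec.span ((\<lambda>j. sgl j 1) ` {..<n})"
      by (intro ratvec.span_sum ratvec.span_scale ratvec.span_base) auto
    finally show ?thesis .
  qed
  then have "B \<subseteq> ratvec.span ((\<lambda>j. sgl j 1) ` {..<n})" using B(1) Cn by blast
  then have finB: "finite B"
    using ratvec.independent_span_bound[OF _ B(2), of "(\<lambda>j. sgl j 1) ` {..<n}"] by blast
  have "ratvec.span B = ratvec.span C"
    using B by (metis ratvec.span_mono ratvec.span_minimal ratvec.subspace_span subset_antisym)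
  then have dim: "cone_dim C = card B"
    unfolding cone_dim_def using ratvec.dim_eq_card[of B "ratvec.span C"] B(2) by (simp add: ratvec.span_span)
  obtain us where us: "set us = B" "distinct us" using finite_distinct_list[OF finB] by blast
  have len: "length us = cone_dim C" using us distinct_card[of us] dim by simp
  define W where "W = weight_vec us"
  define u where "u = (if us = [] then 0 else us ! 0)"
  have uC: "u \<in> C"
  proof (cases "us = []")
    case True
    then have "C \<subseteq> {0}" using B(3) us(1) by simp
    then have "u0 = 0" using u0 by blast
    then show ?thesis using u0 True by (simp add: u_def)
  next
    case False
    then show ?thesis using us(1) B(1) nth_mem[of 0 us] by (auto simp: u_def)
  qed
  have J_ideal: "ideal J (mpoly_ring n)" using primeideal.axioms(1)[OF prime] by (simp only: cone_J)
  have J_hom: "wlevel W l h \<in> J" if "h \<in> J" for l h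
    unfolding W_def
  proof (rule weight_vec_homogeneous)
    fix u' a and h :: "'k mpoly" assume u': "u' \<in> set us" and h: "h \<in> J"
    have J': "J = {h \<in> polys n. \<forall>a. level_lift u' (rel b n) a (level u' a h)}"
      using init_J[of u'] u' us(1) B(1) init_ideal_char[OF ideal_rel, where u=u'] unfolding I by auto
    have hn: "h \<in> polys n" and lift: "\<And>a. level_lift u' (rel b n) a (level u' a h)" using h unfolding J' by auto
    have "level_lift u' (rel b n) c (level u' c (level u' a h))" for c
    proof (cases "c = a")
      case True
      then show ?thesis using lift[of a] by (simp add: res_res)
    next
      case False
      then have "level u' c (level u' a h) = 0" unfolding res_res by (intro res_False) auto
      then show ?thesis unfolding level_lift_def using mpoly_idealD(2)[OF ideal_rel] by (intro bexI[of _ 0]) auto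
    qed
    then show "level u' a h \<in> J" using polys_res[OF hn] unfolding J' by blast
  qed (use that mpoly_idealD(2)[OF J_ideal] in auto)
  interpret degeneration \<phi> b n J W
  proof (rule degenerationI[where u=u])
    show "subal b n = UNIV" by (rule subal_generated[OF assms(2)])
    show "init_ideal n u (rel b n) = J" using init_J[OF uC] unfolding I .
    show "primeideal J (mpoly_ring n)" using prime unfolding cone_J .
    show "sgl \<alpha> 1 \<notin> J" if "\<alpha> \<in> expos n" for \<alpha>
      using cone(2) u0 that by (auto simp: tropical_variety_def expos_def J_def)
    show "W (\<alpha> + \<beta>) = W \<alpha> + W \<beta>" for \<alpha> \<beta> by (simp add: W_def weight_vec_add)
    show "wlevel W l h \<in> J" if "h \<in> J" for h l using J_hom[OF that] .
    show "W \<alpha> < W \<beta>" if lt: "weight u \<alpha> < weight u \<beta>" for \<alpha> \<beta>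
    proof -
      have "us \<noteq> []" using lt by (auto simp: u_def weight_def)
      then show ?thesis unfolding W_def using lt
        by (intro lex_lessI[of _ 0]) (auto simp: coef_weight_vec u_def)
    qed
  qed
  obtain D where D: "D \<subseteq> {..<n}" "inj_on (\<lambda>i. W (sgl i 1)) D" "ratvec.independent ((\<lambda>i. W (sgl i 1)) ` D)"
    "length us \<le> card D"
    unfolding W_def
    by (rule independent_columns[of us n]) (use us B Cn in auto)
  have finD: "finite D" using D(1) finite_subset by blast
  have "p = 0" if "supp p \<subseteq> {\<alpha>. supp \<alpha> \<subseteq> D}" "ev b p = 0" for p
    using D(1) _ that
  proof (rule algebraically_independent)
    show "\<alpha> = \<beta>" if "supp \<alpha> \<subseteq> D" "supp \<beta> \<subseteq> D" "W \<alpha> = W \<beta>" for \<alpha> \<beta>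
      using weight_vec_inj[OF finD D(2,3)[unfolded W_def] that(1,2)] that(3) unfolding W_def by blast
  qed
  then have "enat (card D) \<le> krull_dim (ring_of_type_algebra :: 'a ring)"
    by (rule card_le_krull_dim[OF assms(2) finD])
  then have "card D \<le> d" using assms(3) by simp
  then have len_d: "length us \<le> d" using D(4) by simp
  \<comment> \<open>Only with the bound \<open>length us \<le> d\<close> are the weights known to
    lie in \<open>rat_space d\<close>.\<close>
  interpret graded_degeneration \<phi> b n J W d
    by unfold_locales (use len_d in \<open>auto simp: W_def weight_vec_space\<close>)
  have "value_semigroup val \<subseteq> weight_vec us ` expos n"
    using val_in_image unfolding value_semigroup_def W_def by blast
  then have "discrete_valuation val"
    unfolding discrete_valuation_def by (intro discrete_subset[OF discrete_weight_vec] image_mono)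
  moreover have "enat (cone_dim C) \<le> valuation_rank val"
  proof -
    have "(\<lambda>i. W (sgl i 1)) ` D \<subseteq> value_semigroup val"
    proof (rule image_subsetI)
      fix i assume "i \<in> D"
      then have i: "i < n" using D(1) by blast
      show "W (sgl i 1) \<in> value_semigroup val"
        unfolding value_semigroup_def val_generator(2)[OF i, symmetric] using val_generator(1)[OF i] by blast
    qed
    from valuation_rank_ge[OF this] have "enat (card ((\<lambda>i. W (sgl i 1)) ` D)) \<le> valuation_rank val"
      using D(3) finD by blast
    moreover have "cone_dim C \<le> card ((\<lambda>i. W (sgl i 1)) ` D)" using D(2,4) len by (simp add: card_image)
    ultimately show ?thesis by (meson enat_ord_simps(1) order_trans)
  qed
  ultimately show ?thesis
    using group_ordering_lex_rel[of d] valuation_val khovanskii_basis_generators gr_alg_isomorphic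
    unfolding cone_J by blast
qed

end
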